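(* Let $n_1,n_2,r,r_0$ be positive integers with $r_0<r<n_1$, and let $X_0\in\mathbb{C}^{n_1\times n_2}$ be a matrix of rank $r_0$. Let $S\in\mathbb{C}^{r\times n_1}$ and $\tilde S\in\mathbb{C}^{r\times n_2}$ be two independent random matrices with i.i.d. standard complex Gaussian entries. Let $Z\in\mathbb{C}^{r\times n_2}$ be any matrix, and let $\tilde Z\in\mathbb{C}^{r\times n_1}$ be a (possibly random) matrix such that the pair $(\tilde S,\tilde Z)$ is independent of $S$ and $\tilde Y:=\tilde S X_0^*+\tilde Z$ has rank $r$ almost surely. Let $Y:=SX_0+Z$ and $$X:=\tilde Y^*(S\tilde Y^* )^{\dagger}Y.$$ Let $\|\cdot\|$ be any matrix norm such that $\|AB\|\leq \|A\|_{2\to2}\|B\|$ and $\|A\|=\|A^*\|$ for all matrices $A,B$ of compatible sizes (e.g. the spectral norm or the Frobenius norm). Then for any $\delta_1,\delta_2,\epsilon>0$ with $1>\delta_2>\exp\big(-(\sqrt r-\sqrt{r_0})^2\big)$ and $\epsilon<1$, with probability at least $1-\delta_1-\delta_2-\epsilon$ over the randomness of $S$ and $\tilde S$, $$\|X-X_0\|\leq \frac{\sqrt{r(n_1-r)}\,\|\tilde Z\|}{\sqrt{\delta_1}\big(\sqrt r-\sqrt{r_0}-\sqrt{\log(1/\delta_2)}\big)}+\frac{\sqrt r\,\|Z\|}{\sqrt{\log(1/(1-\epsilon))}}.$$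
   Context: A standard complex Gaussian random variable is $X+iY$ with $X,Y\sim N(0,1/2)$ independent. $A^*$ denotes the conjugate transpose, $A^\dagger$ the Moore–Penrose pseudo-inverse, and $\|A\|_{2\to2}$ the spectral norm. The matrix $X$ is the output of the double-sketch algorithm applied to the noisy sketches $Y$ and $\tilde Y$ (equivalently computed as $Q(SQ)^\dagger Y$ where $\tilde Y^*=QR$ is a QR decomposition). *)

theory Defs
  imports "HOL-Probability.Probability" "Jordan_Normal_Form.Schur_Decomposition" "Jordan_Normal_Form.DL_Rank"
begin

definition mrank :: "complex mat \<Rightarrow> nat" where
  "mrank A = vec_space.rank (dim_row A) A"

definition pinv :: "complex mat \<Rightarrow> complex mat" where
  "pinv A = (THE B. B \<in> carrier_mat (dim_col A) (dim_row A) \<and>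
      A * B * A = A \<and> B * A * B = B \<and>
      mat_adjoint (A * B) = A * B \<and> mat_adjoint (B * A) = B * A)"

definition vnorm2 :: "complex vec \<Rightarrow> real" where
  "vnorm2 v = sqrt (\<Sum>i<dim_vec v. (cmod (v $ i))\<^sup>2)"

definition spec_norm :: "complex mat \<Rightarrow> real" where
  "spec_norm A = Sup {vnorm2 (A *\<^sub>v v) | v. v \<in> carrier_vec (dim_col A) \<and> vnorm2 v \<le> 1}"

definition admissible_norm :: "(complex mat \<Rightarrow> real) \<Rightarrow> bool" where
  "admissible_norm N \<longleftrightarrow>
    (\<forall>m n A. A \<in> carrier_mat m n \<longrightarrow> N A \<ge> 0 \<and> (N A = 0 \<longleftrightarrow> A = 0\<^sub>m m n)) \<and>
    (\<forall>m n A B. A \<in> carrier_mat m n \<longrightarrow> B \<in> carrier_mat m n \<longrightarrow> N (A + B) \<le> N A + N B) \<and>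
    (\<forall>m n A c. A \<in> carrier_mat m n \<longrightarrow> N (c \<cdot>\<^sub>m A) = cmod c * N A) \<and>
    (\<forall>m k l A B. A \<in> carrier_mat m k \<longrightarrow> B \<in> carrier_mat k l \<longrightarrow> N (A * B) \<le> spec_norm A * N B) \<and>
    (\<forall>A. N A = N (mat_adjoint A))"

definition std_complex_gaussian_mat ::
  "'a measure \<Rightarrow> nat \<Rightarrow> nat \<Rightarrow> ('a \<Rightarrow> complex mat) \<Rightarrow> bool" where
  "std_complex_gaussian_mat M r n S \<longleftrightarrow>
    (\<forall>\<omega>\<in>space M. S \<omega> \<in> carrier_mat r n) \<and>
    prob_space.indep_vars M (\<lambda>_. borel)
      (\<lambda>((i,j),b) \<omega>. if b then Re (S \<omega> $$ (i,j)) else Im (S \<omega> $$ (i,j)))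
      (({0..<r} \<times> {0..<n}) \<times> UNIV) \<and>
    (\<forall>i<r. \<forall>j<n. \<forall>b.
       distributed M lborel (\<lambda>\<omega>. if b then Re (S \<omega> $$ (i,j)) else Im (S \<omega> $$ (i,j)))
         (\<lambda>x. ennreal (normal_density 0 (sqrt (1/2)) x)))"

text \<open>Entries of a list of matrices (matrix k has size dims k) as one element of a finite
  product space, indexed by (k,i,j); used to state independence of random matrices.\<close>
definition entry_index :: "(nat \<times> nat) list \<Rightarrow> (nat \<times> nat \<times> nat) set" where
  "entry_index ds = {(k,i,j). k < length ds \<and> i < fst (ds ! k) \<and> j < snd (ds ! k)}"

definition entries :: "(nat \<times> nat) list \<Rightarrow> complex mat list \<Rightarrow> (nat \<times> nat \<times> nat \<Rightarrow> complex)" where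
  "entries ds As = restrict (\<lambda>(k,i,j). (As ! k) $$ (i,j)) (entry_index ds)"

definition entries_space :: "(nat \<times> nat) list \<Rightarrow> (nat \<times> nat \<times> nat \<Rightarrow> complex) measure" where
  "entries_space ds = PiM (entry_index ds) (\<lambda>_. borel)"

end

theory Submission
  imports Defs
begin

text \<open>With \<open>\<Pi> = Yt\<^sup>* (S Yt\<^sup>*)\<^sup>-\<^sup>1 S\<close> the error is \<open>(\<Pi> - 1) X0 + Yt\<^sup>* (S Yt\<^sup>*)\<^sup>-\<^sup>1 Z\<close>, and \<open>(\<Pi> - 1) Yt\<^sup>* = 0\<close>
  trades \<open>X0\<close> for \<open>Zt\<close> times the inverse of \<open>St\<close> on the row space of \<open>X0\<close>, which leaves three norms to be
  bounded. Conditioning on the row space of \<open>Yt\<close>, both \<open>\<Pi>\<close> and \<open>Yt\<^sup>* (S Yt\<^sup>*)\<^sup>-\<^sup>1\<close> are controlled by the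
  inequality \<open>P (G G\<^sup>* \<ge> H H\<^sup>*) \<ge> exp (- tr (H H\<^sup>*))\<close> for a square Gaussian \<open>G\<close>: with \<open>H H\<^sup>* = t 1\<close> it bounds the
  smallest singular value, and with \<open>H\<close> the Gaussian complementary block it bounds the angle between
  the row spaces of \<open>S\<close> and \<open>Yt\<close>. The least singular value of \<open>St\<close> on an \<open>r0\<close>-dimensional space is
  bounded below by adjoining a radially reweighted Gaussian column and moving its mass outwards
  along the directions which \<open>St\<close> contracts, which costs a factor that can be computed
  explicitly. Invariance of the Gaussian measure is only needed under products of plane rotations,
  since these suffice to bring matrices into triangular form.\<close>

text \<open>The three error probabilities belong to three bad events joined by a union bound:
  \<epsilon> to \<open>S\<close> contracting a vector in the range of the adjoint of
  \<open>Yt\<close>, \<delta>1 to a vector in the row space of \<open>S\<close> being nearly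
  orthogonal to the row space of \<open>Yt\<close>, \<delta>2 to \<open>St\<close> contracting a
  vector of the row space of \<open>X0\<close>. Only the first two couple \<open>S\<close> with
  \<open>Yt\<close>; the third concerns the law of \<open>St\<close> alone, so \<open>Zt\<close> may
  depend on \<open>St\<close> in any way. Each constant inverts one tail. The threshold
  \<open>t\<close> solves 1 - exp (-r t) = \<epsilon>. The factor r (n1 - r) is the number of
  entries of the complementary block: the angle event has probability at least (1 - x)^(r (n1 - r)),
  and Bernoulli's inequality makes x = \<delta>1 / (r (n1 - r)) enough. The shift \<open>s\<close>
  solves exp (-s^2) = \<delta>2. The obstacle is the third tail, which must come out as exp (-s^2)
  with no prefactor at the edge sqrt r - sqrt r0. The extra column is weighted by exp (|z|^2) so
  that |z|^2 loses its exponential decay and a shift of mass becomes a plain translation; the tail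
  is then a ratio of one explicit weight at two points.\<close>

section \<open>The standard complex Gaussian measure\<close>

definition cgauss :: "complex measure" where
  "cgauss = density lborel (\<lambda>z. ennreal (exp (- (cmod z)\<^sup>2) / pi))"

lemma sets_cgauss [measurable_cong, simp]: "sets cgauss = sets borel"
  by (simp add: cgauss_def)

lemma space_cgauss [simp]: "space cgauss = UNIV"
  by (simp add: cgauss_def)

lemma nn_integral_cgauss:
  assumes [measurable]: "f \<in> borel_measurable borel"
  shows "(\<integral>\<^sup>+z. f z \<partial>cgauss) = (\<integral>\<^sup>+z. ennreal (exp (- (cmod z)\<^sup>2) / pi) * f z \<partial>lborel)"
  unfolding cgauss_def by (subst nn_integral_density) auto

text \<open>The disc of radius \<open>sqrt a\<close> has area \<open>pi * a\<close>, and the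
  half-lines form an intersection-stable generator.\<close>

lemma distr_lborel_cmod_square:
  "distr (lborel :: complex measure) borel (\<lambda>z. (cmod z)\<^sup>2) = density lborel (\<lambda>r. ennreal pi * indicator {0..} r)"
proof (rule measure_eqI_generator_eq)
  let ?E = "range (\<lambda>a::real. {..a})"
  show "Int_stable ?E"
  proof (rule Int_stableI)
    fix A B assume "A \<in> ?E" "B \<in> ?E"
    then obtain a b where "A = {..a}" "B = {..b}" by blast
    then have "A \<inter> B = {..min a b}" by auto
    then show "A \<inter> B \<in> ?E" by blast
  qed
  show "?E \<subseteq> Pow UNIV" by simp
  show "sets (distr (lborel :: complex measure) borel (\<lambda>z. (cmod z)\<^sup>2)) = sigma_sets UNIV ?E"
    by (simp add: borel_eq_atMost)
  show "sets (density lborel (\<lambda>r. ennreal pi * indicator {0..} (r::real))) = sigma_sets UNIV ?E"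
    by (simp add: borel_eq_atMost)
  show "range (\<lambda>n::nat. {..real n}) \<subseteq> ?E" by auto
  show "(\<Union>n::nat. {..real n}) = UNIV"
  proof (rule UNIV_eq_I[symmetric])
    fix x :: real
    obtain n where "x \<le> real n" using real_arch_simple by blast
    then show "x \<in> (\<Union>n::nat. {..real n})" by (intro UN_I[of n]) simp_all
  qed
  have val: "emeasure (distr (lborel :: complex measure) borel (\<lambda>z. (cmod z)\<^sup>2)) {..a} = ennreal (pi * max 0 a)" for a :: real
  proof -
    have le: "(cmod z)\<^sup>2 \<le> a \<longleftrightarrow> cmod z \<le> sqrt a" for z
      using real_sqrt_le_iff[of "(cmod z)\<^sup>2" a] by simp
    have neg: "\<not> (cmod z)\<^sup>2 \<le> a" if "a < 0" for z
      using that zero_le_power2[of "cmod z"] by linarith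
    have eq: "(\<lambda>z. (cmod z)\<^sup>2) -` {..a} = (if a < 0 then {} else cball (0::complex) (sqrt a))"
      using le neg by auto
    have "emeasure lborel (cball (0::complex) (sqrt a)) = ennreal (pi * a)" if "a \<ge> 0"
      using that by (subst emeasure_cball) (auto simp: unit_ball_vol_2 power2_eq_square)
    then show ?thesis
      by (subst emeasure_distr) (auto simp: eq max_def)
  qed
  show "emeasure (distr (lborel :: complex measure) borel (\<lambda>z. (cmod z)\<^sup>2)) {..real n} \<noteq> \<infinity>" for n
    by (simp add: val)
  fix X :: "real set" assume "X \<in> ?E"
  then obtain a where X: "X = {..a}" by auto
  have "emeasure (density lborel (\<lambda>r. ennreal pi * indicator {0..} r)) {..a}
      = (\<integral>\<^sup>+r. ennreal pi * indicator {0..a} r \<partial>lborel)"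
    by (subst emeasure_density) (auto intro!: nn_integral_cong split: split_indicator)
  also have "\<dots> = ennreal (pi * max 0 a)"
    by (subst nn_integral_cmult_indicator) (auto simp: ennreal_mult' max_def)
  finally show "emeasure (distr (lborel :: complex measure) borel (\<lambda>z. (cmod z)\<^sup>2)) X
    = emeasure (density lborel (\<lambda>r. ennreal pi * indicator {0..} r)) X"
    by (simp add: X val)
qed

text \<open>Whatever depends on \<open>z\<close> only through its modulus becomes an integral
  against the exponential density of rate 1, where tilting and shifting are explicit.\<close>

lemma nn_integral_cgauss_cmod_square:
  assumes [measurable]: "f \<in> borel_measurable borel"
  shows "(\<integral>\<^sup>+z. f ((cmod z)\<^sup>2) \<partial>cgauss) = (\<integral>\<^sup>+r. ennreal (exponential_density 1 r) * f r \<partial>lborel)"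
proof -
  have "(\<integral>\<^sup>+z. f ((cmod z)\<^sup>2) \<partial>cgauss) = (\<integral>\<^sup>+z. ennreal (exp (- (cmod z)\<^sup>2) / pi) * f ((cmod z)\<^sup>2) \<partial>lborel)"
    by (subst nn_integral_cgauss) auto
  also have "\<dots> = (\<integral>\<^sup>+r. ennreal (exp (- r) / pi) * f r \<partial>distr (lborel :: complex measure) borel (\<lambda>z. (cmod z)\<^sup>2))"
    by (subst nn_integral_distr) auto
  also have "\<dots> = (\<integral>\<^sup>+r. ennreal pi * indicator {0..} r * (ennreal (exp (- r) / pi) * f r) \<partial>lborel)"
    unfolding distr_lborel_cmod_square by (subst nn_integral_density) auto
  also have "\<dots> = (\<integral>\<^sup>+r. ennreal (exponential_density 1 r) * f r \<partial>lborel)"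
    by (intro nn_integral_cong)
       (auto simp: erlang_density_def mult.assoc[symmetric] ennreal_mult[symmetric] split: split_indicator)
  finally show ?thesis .
qed

lemma prob_space_cgauss: "prob_space cgauss"
proof
  have "emeasure cgauss (space cgauss) = (\<integral>\<^sup>+z. 1 \<partial>cgauss)"
    by simp
  also have "\<dots> = (\<integral>\<^sup>+r. ennreal (exponential_density 1 r) \<partial>lborel)"
    using nn_integral_cgauss_cmod_square[of "\<lambda>_. 1"] by simp
  also have "\<dots> = 1"
    using prob_space.emeasure_space_1[OF prob_space_exponential_density[of 1]]
    by (simp add: emeasure_density)
  finally show "emeasure cgauss (space cgauss) = 1" .
qed

interpretation cgauss: prob_space cgauss by (rule prob_space_cgauss)
interpretation cgauss_pair: pair_prob_space cgauss cgauss ..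
interpretation cgauss_PiM: product_prob_space "\<lambda>_. cgauss" I for I ..

subsection \<open>Invariance under plane rotations of a pair\<close>

lemma nn_integral_lborel_translate:
  fixes c :: "'a :: euclidean_space"
  assumes [measurable]: "f \<in> borel_measurable borel"
  shows "(\<integral>\<^sup>+z. f (z + c) \<partial>lborel) = (\<integral>\<^sup>+z. f z \<partial>lborel)"
proof -
  have "(\<integral>\<^sup>+z. f z \<partial>lborel) = (\<integral>\<^sup>+z. f z \<partial>distr lborel borel ((+) c))"
    by (simp add: lborel_distr_plus)
  also have "\<dots> = (\<integral>\<^sup>+z. f (z + c) \<partial>lborel)"
    by (subst nn_integral_distr) (auto simp: add.commute)
  finally show ?thesis by simp
qed

lemma nn_integral_shear_left:
  fixes f :: "complex \<Rightarrow> complex \<Rightarrow> ennreal"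
  assumes [measurable]: "case_prod f \<in> borel_measurable (borel \<Otimes>\<^sub>M borel)"
  shows "(\<integral>\<^sup>+w. \<integral>\<^sup>+z. f (z + p * w) w \<partial>lborel \<partial>lborel) = (\<integral>\<^sup>+w. \<integral>\<^sup>+z. f z w \<partial>lborel \<partial>lborel)"
  by (subst nn_integral_lborel_translate) auto

lemma nn_integral_lborel_swap:
  fixes f :: "complex \<Rightarrow> complex \<Rightarrow> ennreal"
  assumes [measurable]: "case_prod f \<in> borel_measurable (borel \<Otimes>\<^sub>M borel)"
  shows "(\<integral>\<^sup>+w. \<integral>\<^sup>+z. f z w \<partial>lborel \<partial>lborel) = (\<integral>\<^sup>+z. \<integral>\<^sup>+w. f z w \<partial>lborel \<partial>lborel)"
proof -
  have "(\<lambda>x. f (snd x) (fst x)) \<in> borel_measurable (lborel \<Otimes>\<^sub>M lborel)"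
    by measurable
  then show ?thesis
    by (intro lborel_pair.Fubini') (simp add: case_prod_unfold)
qed

lemma nn_integral_shear_right:
  fixes f :: "complex \<Rightarrow> complex \<Rightarrow> ennreal"
  assumes [measurable]: "case_prod f \<in> borel_measurable (borel \<Otimes>\<^sub>M borel)"
  shows "(\<integral>\<^sup>+w. \<integral>\<^sup>+z. f z (w + p * z) \<partial>lborel \<partial>lborel) = (\<integral>\<^sup>+w. \<integral>\<^sup>+z. f z w \<partial>lborel \<partial>lborel)"
proof -
  have "(\<integral>\<^sup>+w. \<integral>\<^sup>+z. f z (w + p * z) \<partial>lborel \<partial>lborel) = (\<integral>\<^sup>+z. \<integral>\<^sup>+w. f z (w + p * z) \<partial>lborel \<partial>lborel)"
    by (rule nn_integral_lborel_swap) measurable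
  also have "\<dots> = (\<integral>\<^sup>+z. \<integral>\<^sup>+w. f z w \<partial>lborel \<partial>lborel)"
    by (subst nn_integral_lborel_translate) auto
  also have "\<dots> = (\<integral>\<^sup>+w. \<integral>\<^sup>+z. f z w \<partial>lborel \<partial>lborel)"
    by (rule nn_integral_lborel_swap[symmetric]) measurable
  finally show ?thesis .
qed

text \<open>For \<open>b \<noteq> 0\<close> the plane rotation is a product of three shears.\<close>

lemma nn_integral_lborel_rotate_pair:
  fixes f :: "complex \<Rightarrow> complex \<Rightarrow> ennreal"
  assumes [measurable]: "case_prod f \<in> borel_measurable (borel \<Otimes>\<^sub>M borel)"
    and b: "b \<noteq> 0" and ab: "a * cnj a + b * cnj b = 1"
  shows "(\<integral>\<^sup>+w. \<integral>\<^sup>+z. f (a * z + b * w) (- cnj b * z + cnj a * w) \<partial>lborel \<partial>lborel)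
    = (\<integral>\<^sup>+w. \<integral>\<^sup>+z. f z w \<partial>lborel \<partial>lborel)"
proof -
  \<comment> \<open>These solve the factorisation of the rotation into an upper, a lower and an
    upper shear with parameters \<open>p\<close>, \<open>q\<close>, \<open>p'\<close>. The lower
    left entry forces \<open>q\<close>, the two diagonal entries give \<open>p\<close> and
    \<open>p'\<close>, and the remaining entry is then \<open>b\<close> because the determinant is
    1.\<close>
  define p where "p = (1 - a) / cnj b"
  define q where "q = - cnj b"
  define p' where "p' = (1 - cnj a) / cnj b"
  have "cnj b \<noteq> 0" using b by simp
  have 1: "1 + p * q = a" "1 + q * p' = cnj a" by (use \<open>cnj b \<noteq> 0\<close> in \<open>simp_all add: p_def q_def p'_def\<close>)
  have 2: "p' + p * cnj a = b"
  proof -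
    have "p' * cnj b = 1 - cnj a" "p * cnj b = 1 - a"
      using \<open>cnj b \<noteq> 0\<close> by (simp_all add: p_def p'_def)
    then have "(p' + p * cnj a) * cnj b = (1 - cnj a) + (1 - a) * cnj a"
      by (metis (no_types, lifting) distrib_right mult.assoc mult.commute)
    also have "\<dots> = b * cnj b" using ab by (simp add: algebra_simps)
    finally show ?thesis using \<open>cnj b \<noteq> 0\<close> by simp
  qed
  have e1: "a * z + b * w = (z + p' * w) + p * (w + q * (z + p' * w))" for z w
  proof -
    have "(z + p' * w) + p * (w + q * (z + p' * w)) = (1 + p * q) * z + (p' + p * (1 + q * p')) * w"
      by (simp add: algebra_simps)
    then show ?thesis by (simp only: 1 2)
  qed
  have e2: "- cnj b * z + cnj a * w = w + q * (z + p' * w)" for z w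
  proof -
    have "w + q * (z + p' * w) = q * z + (1 + q * p') * w" by (simp add: algebra_simps)
    then show ?thesis unfolding 1(2) by (simp only: q_def)
  qed
  have "(\<integral>\<^sup>+w. \<integral>\<^sup>+z. f (a * z + b * w) (- cnj b * z + cnj a * w) \<partial>lborel \<partial>lborel)
      = (\<integral>\<^sup>+w. \<integral>\<^sup>+z. (\<lambda>z w. f (z + p * (w + q * z)) (w + q * z)) (z + p' * w) w \<partial>lborel \<partial>lborel)"
    by (simp only: e1 e2)
  also have "\<dots> = (\<integral>\<^sup>+w. \<integral>\<^sup>+z. f (z + p * (w + q * z)) (w + q * z) \<partial>lborel \<partial>lborel)"
    by (rule nn_integral_shear_left) measurable
  also have "\<dots> = (\<integral>\<^sup>+w. \<integral>\<^sup>+z. f (z + p * w) w \<partial>lborel \<partial>lborel)"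
    by (rule nn_integral_shear_right[where f="\<lambda>z w. f (z + p * w) w"]) measurable
  also have "\<dots> = (\<integral>\<^sup>+w. \<integral>\<^sup>+z. f z w \<partial>lborel \<partial>lborel)"
    by (rule nn_integral_shear_left) measurable
  finally show ?thesis .
qed

lemma cmod_square_rotate_pair:
  assumes ab: "a * cnj a + b * cnj b = 1"
  shows "(cmod (a * z + b * w))\<^sup>2 + (cmod (- cnj b * z + cnj a * w))\<^sup>2 = (cmod z)\<^sup>2 + (cmod w)\<^sup>2"
proof -
  have "complex_of_real ((cmod (a * z + b * w))\<^sup>2 + (cmod (- cnj b * z + cnj a * w))\<^sup>2)
      = (a * z + b * w) * cnj (a * z + b * w) + (- cnj b * z + cnj a * w) * cnj (- cnj b * z + cnj a * w)"
    by (simp only: of_real_add complex_norm_square)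
  also have "\<dots> = (a * cnj a + b * cnj b) * (z * cnj z + w * cnj w)"
    by (simp add: algebra_simps)
  also have "\<dots> = complex_of_real ((cmod z)\<^sup>2 + (cmod w)\<^sup>2)"
    by (simp only: ab of_real_add complex_norm_square) simp
  finally show ?thesis by (simp only: of_real_eq_iff)
qed

text \<open>The joint density depends only on |z|^2 + |w|^2, which the rotation preserves, so the
  invariance of Lebesgue measure carries over.\<close>

lemma nn_integral_cgauss_rotate_pair:
  fixes f :: "complex \<Rightarrow> complex \<Rightarrow> ennreal"
  assumes [measurable]: "case_prod f \<in> borel_measurable (borel \<Otimes>\<^sub>M borel)"
    and b: "b \<noteq> 0" and ab: "a * cnj a + b * cnj b = 1"
  shows "(\<integral>\<^sup>+w. \<integral>\<^sup>+z. f (a * z + b * w) (- cnj b * z + cnj a * w) \<partial>cgauss \<partial>cgauss)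
    = (\<integral>\<^sup>+w. \<integral>\<^sup>+z. f z w \<partial>cgauss \<partial>cgauss)"
proof -
  define g where "g z w = ennreal (exp (- ((cmod z)\<^sup>2 + (cmod w)\<^sup>2)) / pi\<^sup>2) * f z w" for z w
  have [measurable]: "case_prod g \<in> borel_measurable (borel \<Otimes>\<^sub>M borel)"
    unfolding g_def by measurable
  have *: "(\<integral>\<^sup>+w. \<integral>\<^sup>+z. h z w \<partial>cgauss \<partial>cgauss)
      = (\<integral>\<^sup>+w. \<integral>\<^sup>+z. ennreal (exp (- ((cmod z)\<^sup>2 + (cmod w)\<^sup>2)) / pi\<^sup>2) * h z w \<partial>lborel \<partial>lborel)"
    if [measurable]: "case_prod h \<in> borel_measurable (borel \<Otimes>\<^sub>M borel)" for h
  proof -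
    have "(\<integral>\<^sup>+w. \<integral>\<^sup>+z. h z w \<partial>cgauss \<partial>cgauss)
      = (\<integral>\<^sup>+w. ennreal (exp (- (cmod w)\<^sup>2) / pi) * (\<integral>\<^sup>+z. ennreal (exp (- (cmod z)\<^sup>2) / pi) * h z w \<partial>lborel) \<partial>lborel)"
      by (subst nn_integral_cgauss) (auto simp: nn_integral_cgauss)
    also have "\<dots> = (\<integral>\<^sup>+w. \<integral>\<^sup>+z. ennreal (exp (- (cmod w)\<^sup>2) / pi) * (ennreal (exp (- (cmod z)\<^sup>2) / pi) * h z w) \<partial>lborel \<partial>lborel)"
      by (subst nn_integral_cmult) auto
    also have "\<dots> = (\<integral>\<^sup>+w. \<integral>\<^sup>+z. ennreal (exp (- ((cmod z)\<^sup>2 + (cmod w)\<^sup>2)) / pi\<^sup>2) * h z w \<partial>lborel \<partial>lborel)"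
    proof (intro nn_integral_cong)
      fix z w :: complex
      have "exp (- (cmod w)\<^sup>2) / pi * (exp (- (cmod z)\<^sup>2) / pi) = exp (- ((cmod z)\<^sup>2 + (cmod w)\<^sup>2)) / pi\<^sup>2"
        by (simp add: exp_add[symmetric] power2_eq_square)
      then show "ennreal (exp (- (cmod w)\<^sup>2) / pi) * (ennreal (exp (- (cmod z)\<^sup>2) / pi) * h z w)
          = ennreal (exp (- ((cmod z)\<^sup>2 + (cmod w)\<^sup>2)) / pi\<^sup>2) * h z w"
        unfolding mult.assoc[symmetric] by (subst ennreal_mult[symmetric]) simp_all
    qed
    finally show ?thesis .
  qed
  have "(\<integral>\<^sup>+w. \<integral>\<^sup>+z. f (a * z + b * w) (- cnj b * z + cnj a * w) \<partial>cgauss \<partial>cgauss)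
     = (\<integral>\<^sup>+w. \<integral>\<^sup>+z. g (a * z + b * w) (- cnj b * z + cnj a * w) \<partial>lborel \<partial>lborel)"
    by (subst *) (measurable, simp only: g_def cmod_square_rotate_pair[OF ab])
  also have "\<dots> = (\<integral>\<^sup>+w. \<integral>\<^sup>+z. g z w \<partial>lborel \<partial>lborel)"
    by (rule nn_integral_lborel_rotate_pair) (use b ab in auto)
  also have "\<dots> = (\<integral>\<^sup>+w. \<integral>\<^sup>+z. f z w \<partial>cgauss \<partial>cgauss)"
    by (subst *) (auto simp: g_def)
  finally show ?thesis .
qed

text \<open>The map \<open>(z, w) \<mapsto> (a z, cnj a w)\<close> is a product of two plane rotations.\<close>

lemma nn_integral_cgauss_phase:
  fixes f :: "complex \<Rightarrow> ennreal"
  assumes [measurable]: "f \<in> borel_measurable borel" and a: "cmod a = 1"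
  shows "(\<integral>\<^sup>+z. f (a * z) \<partial>cgauss) = (\<integral>\<^sup>+z. f z \<partial>cgauss)"
proof -
  have aa: "a * cnj a = 1" using a by (metis complex_norm_square mult_1 of_real_1 power_one)
  \<comment> \<open>The quarter turn (z, w) \<mapsto> (w, -z) moves the argument of \<open>f\<close>
    to the second coordinate; the rotation with off-diagonal entry \<open>- a\<close> brings it back
    with the phase removed.\<close>
  define h :: "complex \<Rightarrow> complex \<Rightarrow> ennreal" where "h = (\<lambda>z w. f (- a * w))"
  have [measurable]: "case_prod h \<in> borel_measurable (borel \<Otimes>\<^sub>M borel)"
    unfolding h_def by measurable
  have "(\<integral>\<^sup>+z. f (a * z) \<partial>cgauss) = (\<integral>\<^sup>+w. \<integral>\<^sup>+z. f (a * z) \<partial>cgauss \<partial>cgauss)"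
    by (simp add: cgauss.emeasure_space_1[simplified])
  also have "\<dots> = (\<integral>\<^sup>+w. \<integral>\<^sup>+z. h (0 * z + 1 * w) (- cnj 1 * z + cnj 0 * w) \<partial>cgauss \<partial>cgauss)"
    by (simp add: h_def)
  also have "\<dots> = (\<integral>\<^sup>+w. \<integral>\<^sup>+z. h z w \<partial>cgauss \<partial>cgauss)"
    by (rule nn_integral_cgauss_rotate_pair) auto
  also have "\<dots> = (\<integral>\<^sup>+w. \<integral>\<^sup>+z. (\<lambda>z w. f z) (0 * z + (- a) * w) (- cnj (- a) * z + cnj 0 * w) \<partial>cgauss \<partial>cgauss)"
    by (simp add: h_def)
  also have "\<dots> = (\<integral>\<^sup>+w. \<integral>\<^sup>+z. f z \<partial>cgauss \<partial>cgauss)"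
    by (rule nn_integral_cgauss_rotate_pair) (use aa in auto)
  finally show ?thesis by (simp add: cgauss.emeasure_space_1[simplified])
qed

text \<open>Modulus and phase are independent. An independent copy \<open>w\<close> supplies the
  uniform phase \<open>sgn w\<close>: multiplying \<open>z\<close> by it keeps the law of
  \<open>z\<close>, and phase invariance in \<open>w\<close> then absorbs the phase of
  \<open>z\<close> itself, leaving |z| times \<open>sgn w\<close>.\<close>

lemma nn_integral_cgauss_polar:
  fixes f :: "complex \<Rightarrow> ennreal"
  assumes [measurable]: "f \<in> borel_measurable borel"
  shows "(\<integral>\<^sup>+z. f z \<partial>cgauss)
    = (\<integral>\<^sup>+r. ennreal (exponential_density 1 r) * (\<integral>\<^sup>+w. f (of_real (sqrt r) * sgn w) \<partial>cgauss) \<partial>lborel)"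
proof -
  \<comment> \<open>\<open>sgn 0 = 0\<close> is not a phase, so the origin has to be discarded as a
    null set.\<close>
  have nz: "AE w in cgauss. w \<noteq> (0::complex)"
    unfolding cgauss_def by (subst AE_density) (auto intro: AE_lborel_singleton)
  have sgn1: "cmod (sgn w) = 1" if "w \<noteq> 0" for w :: complex
    using that by (simp add: norm_sgn)
  have "(\<integral>\<^sup>+z. f z \<partial>cgauss) = (\<integral>\<^sup>+w. \<integral>\<^sup>+z. f z \<partial>cgauss \<partial>cgauss)"
    by (simp add: cgauss.emeasure_space_1[simplified])
  also have "\<dots> = (\<integral>\<^sup>+w. \<integral>\<^sup>+z. f (sgn w * z) \<partial>cgauss \<partial>cgauss)"
    using nz by (intro nn_integral_cong_AE) (auto elim!: eventually_mono simp: nn_integral_cgauss_phase sgn1)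
  also have "\<dots> = (\<integral>\<^sup>+z. \<integral>\<^sup>+w. f (sgn w * z) \<partial>cgauss \<partial>cgauss)"
    by (rule cgauss_pair.Fubini') measurable
  also have "\<dots> = (\<integral>\<^sup>+z. \<integral>\<^sup>+w. f (of_real (sqrt ((cmod z)\<^sup>2)) * sgn w) \<partial>cgauss \<partial>cgauss)"
  proof (rule nn_integral_cong)
    fix z :: complex
    show "(\<integral>\<^sup>+w. f (sgn w * z) \<partial>cgauss) = (\<integral>\<^sup>+w. f (of_real (sqrt ((cmod z)\<^sup>2)) * sgn w) \<partial>cgauss)"
    proof (cases "z = 0")
      case False
      have "(\<integral>\<^sup>+w. f (sgn w * z) \<partial>cgauss) = (\<integral>\<^sup>+w. (\<lambda>w. f (of_real (cmod z) * sgn w)) (sgn z * w) \<partial>cgauss)"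
      proof (intro nn_integral_cong)
        fix w
        have "of_real (cmod z) * sgn z = z" using False by (simp add: sgn_eq)
        moreover have "sgn (sgn z * w) = sgn z * sgn w" by (simp add: sgn_mult)
        ultimately show "f (sgn w * z) = f (of_real (cmod z) * sgn (sgn z * w))"
          by (metis mult.assoc mult.commute)
      qed
      also have "\<dots> = (\<integral>\<^sup>+w. f (of_real (cmod z) * sgn w) \<partial>cgauss)"
        by (rule nn_integral_cgauss_phase) (auto simp: sgn1 False)
      finally show ?thesis by simp
    qed simp
  qed
  also have "\<dots> = (\<integral>\<^sup>+r. ennreal (exponential_density 1 r) * (\<integral>\<^sup>+w. f (of_real (sqrt r) * sgn w) \<partial>cgauss) \<partial>lborel)"
    by (subst nn_integral_cgauss_cmod_square) auto
  finally show ?thesis .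
qed

unbundle no vec_syntax

subsection \<open>Unitary matrices acting on Gaussian rows\<close>

lemma dim_mat_adjoint [simp]:
  "dim_row (mat_adjoint A) = dim_col A" "dim_col (mat_adjoint A) = dim_row A"
  by (simp_all add: mat_adjoint_def)

lemma carrier_mat_adjoint [simp, intro]: "A \<in> carrier_mat m n \<Longrightarrow> mat_adjoint A \<in> carrier_mat n m"
  by (intro carrier_matI) simp_all

lemma index_mat_adjoint [simp]:
  fixes A :: "complex mat"
  assumes "i < dim_col A" "j < dim_row A"
  shows "mat_adjoint A $$ (i, j) = cnj (A $$ (j, i))"
  using assms by (simp add: mat_adjoint_def mat_of_rows_index)

lemma mat_adjoint_adjoint [simp]: "mat_adjoint (mat_adjoint A) = (A :: complex mat)"
  by (rule eq_matI) auto

lemma mat_adjoint_mult: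
  fixes A B :: "complex mat"
  assumes "A \<in> carrier_mat m k" "B \<in> carrier_mat k n"
  shows "mat_adjoint (A * B) = mat_adjoint B * mat_adjoint A"
  using assms by (intro eq_matI) (auto simp: scalar_prod_def mult.commute)

lemma mat_adjoint_one [simp]: "mat_adjoint (1\<^sub>m n) = (1\<^sub>m n :: complex mat)"
  by (rule eq_matI) auto

abbreviation gauss :: "(nat \<times> nat) set \<Rightarrow> (nat \<times> nat \<Rightarrow> complex) measure" where
  "gauss I \<equiv> Pi\<^sub>M I (\<lambda>_. cgauss)"

lemma sets_gauss: "sets (gauss I) = sets (Pi\<^sub>M I (\<lambda>_. borel :: complex measure))"
  by (rule sets_PiM_cong) auto

lemma space_gauss: "space (gauss I) = extensional I"
  by (auto simp: space_PiM PiE_def)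

lemma measurable_gauss_component [measurable]: "i \<in> I \<Longrightarrow> (\<lambda>x. x i) \<in> borel_measurable (gauss I)"
  using measurable_component_singleton[of i I "\<lambda>_. cgauss"] by simp

lemma nn_integral_gauss_rotate_pair:
  assumes I: "finite I" "i \<in> I" "j \<in> I" "i \<noteq> j"
    and b: "b \<noteq> 0" and ab: "a * cnj a + b * cnj b = 1"
    and f: "f \<in> borel_measurable (gauss I)"
  shows "(\<integral>\<^sup>+x. f (x(i := a * x i + b * x j, j := - cnj b * x i + cnj a * x j)) \<partial>gauss I) = (\<integral>\<^sup>+x. f x \<partial>gauss I)"
proof -
  define K where "K = I - {i, j}"
  have K: "finite K" "i \<notin> K" "j \<notin> K" "I = insert i (insert j K)" and ji: "j \<notin> K" "i \<notin> insert j K"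
    using I by (auto simp: K_def)
  have fin: "finite (insert j K)" using K by simp
  define T where "T x = x(i := a * x i + b * x j, j := - cnj b * x i + cnj a * x j)" for x :: "nat \<times> nat \<Rightarrow> complex"
  have T: "T \<in> measurable (gauss I) (gauss I)"
  proof (rule measurable_PiM_single')
    fix k assume "k \<in> I"
    then show "(\<lambda>x. T x k) \<in> measurable (gauss I) cgauss"
      unfolding T_def using I by (cases "k = j"; cases "k = i") simp_all
  next
    show "(\<lambda>x k. T x k) \<in> space (gauss I) \<rightarrow> (\<Pi>\<^sub>E k\<in>I. space cgauss)"
      using I by (auto simp: T_def space_PiM PiE_def extensional_def)
  qed
  have fT: "(\<lambda>x. f (T x)) \<in> borel_measurable (gauss I)"
    using measurable_compose[OF T f] by simp
  have split: "(\<integral>\<^sup>+x. g x \<partial>gauss I) = (\<integral>\<^sup>+x. \<integral>\<^sup>+w. \<integral>\<^sup>+z. g (x(j := w, i := z)) \<partial>cgauss \<partial>cgauss \<partial>gauss K)"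
    if g: "g \<in> borel_measurable (gauss I)" for g
  proof -
    have g': "g \<in> borel_measurable (gauss (insert i (insert j K)))" using g K by simp
    have [measurable]: "(\<lambda>(x, z). g (x(i := z))) \<in> borel_measurable (gauss (insert j K) \<Otimes>\<^sub>M cgauss)"
      using measurable_compose[OF measurable_add_dim g'] by (simp add: split_def)
    have "(\<integral>\<^sup>+x. g x \<partial>gauss I) = (\<integral>\<^sup>+x. \<integral>\<^sup>+z. g (x(i := z)) \<partial>cgauss \<partial>gauss (insert j K))"
      unfolding K(4) by (rule cgauss_PiM.product_nn_integral_insert[OF fin ji(2) g'])
    also have "\<dots> = (\<integral>\<^sup>+x. \<integral>\<^sup>+w. \<integral>\<^sup>+z. g (x(j := w, i := z)) \<partial>cgauss \<partial>cgauss \<partial>gauss K)"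
      by (rule cgauss_PiM.product_nn_integral_insert[OF K(1) ji(1)]) measurable
    finally show ?thesis .
  qed
  have "(\<integral>\<^sup>+x. f (T x) \<partial>gauss I) = (\<integral>\<^sup>+x. \<integral>\<^sup>+w. \<integral>\<^sup>+z. f (T (x(j := w, i := z))) \<partial>cgauss \<partial>cgauss \<partial>gauss K)"
    by (rule split[OF fT])
  also have "\<dots> = (\<integral>\<^sup>+x. \<integral>\<^sup>+w. \<integral>\<^sup>+z. f (x(j := w, i := z)) \<partial>cgauss \<partial>cgauss \<partial>gauss K)"
  proof (rule nn_integral_cong)
    fix x assume x: "x \<in> space (gauss K)"
    define h where "h z w = f (x(j := w, i := z))" for z w
    have "(\<lambda>(z, w). x(j := w, i := z)) \<in> measurable (borel \<Otimes>\<^sub>M borel) (gauss I)"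
    proof (rule measurable_PiM_single')
      fix k assume "k \<in> I"
      then show "(\<lambda>u. (case u of (z, w) \<Rightarrow> x(j := w, i := z)) k) \<in> measurable (borel \<Otimes>\<^sub>M borel) cgauss"
        by (cases "k = i"; cases "k = j") (simp_all add: split_def)
    next
      show "(\<lambda>u k. (case u of (z, w) \<Rightarrow> x(j := w, i := z)) k) \<in> space (borel \<Otimes>\<^sub>M borel) \<rightarrow> (\<Pi>\<^sub>E k\<in>I. space cgauss)"
        using x I by (auto simp: K_def space_PiM PiE_def extensional_def)
    qed
    from measurable_compose[OF this f] have "case_prod h \<in> borel_measurable (borel \<Otimes>\<^sub>M borel)"
      by (simp add: h_def split_def)
    from nn_integral_cgauss_rotate_pair[OF this b ab]
    have "(\<integral>\<^sup>+w. \<integral>\<^sup>+z. h (a * z + b * w) (- cnj b * z + cnj a * w) \<partial>cgauss \<partial>cgauss) = (\<integral>\<^sup>+w. \<integral>\<^sup>+z. h z w \<partial>cgauss \<partial>cgauss)" .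
    moreover have "f (T (x(j := w, i := z))) = h (a * z + b * w) (- cnj b * z + cnj a * w)" for z w
      unfolding h_def T_def using I(4) by (intro arg_cong[where f=f]) (auto simp: fun_eq_iff)
    ultimately show "(\<integral>\<^sup>+w. \<integral>\<^sup>+z. f (T (x(j := w, i := z))) \<partial>cgauss \<partial>cgauss) = (\<integral>\<^sup>+w. \<integral>\<^sup>+z. f (x(j := w, i := z)) \<partial>cgauss \<partial>cgauss)"
      by (simp add: h_def)
  qed
  also have "\<dots> = (\<integral>\<^sup>+x. f x \<partial>gauss I)"
    by (rule split[OF f, symmetric])
  finally show ?thesis by (simp add: T_def)
qed

text \<open>On a matrix \<open>x\<close> with rows in \<open>K\<close> this is multiplication from
  the right by the transpose of \<open>U\<close>, without conjugation; this is the source of the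
  conjugates in later witnesses. The restriction keeps the result in the product space.\<close>

definition row_app :: "nat set \<Rightarrow> nat \<Rightarrow> complex mat \<Rightarrow> (nat \<times> nat \<Rightarrow> complex) \<Rightarrow> (nat \<times> nat \<Rightarrow> complex)" where
  "row_app K n U x = restrict (\<lambda>(k, i). \<Sum>j<n. U $$ (i, j) * x (k, j)) (K \<times> {..<n})"

lemma row_app_apply [simp]: "k \<in> K \<Longrightarrow> i < n \<Longrightarrow> row_app K n U x (k, i) = (\<Sum>j<n. U $$ (i, j) * x (k, j))"
  by (simp add: row_app_def)

lemma measurable_row_app [measurable]: "row_app K n U \<in> measurable (gauss (K \<times> {..<n})) (gauss (K \<times> {..<n}))"
  unfolding row_app_def
proof (rule measurable_restrict)
  fix i assume "i \<in> K \<times> {..<n}"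
  then obtain k l where i: "i = (k, l)" "k \<in> K" "l < n" by auto
  then have "(\<lambda>x. \<Sum>j<n. U $$ (l, j) * x (k, j)) \<in> borel_measurable (gauss (K \<times> {..<n}))"
    by (intro borel_measurable_sum borel_measurable_times measurable_gauss_component) auto
  then show "(\<lambda>x. case i of (k, i) \<Rightarrow> \<Sum>j<n. U $$ (i, j) * x (k, j)) \<in> measurable (gauss (K \<times> {..<n})) cgauss"
    by (simp add: i)
qed

text \<open>The invariance of the measure is made part of the notion, so that it passes to products and adjoints
  and has to be checked for plane rotations only.\<close>

definition gauss_unitary :: "nat \<Rightarrow> complex mat \<Rightarrow> bool" where
  "gauss_unitary n U \<longleftrightarrow> U \<in> carrier_mat n n \<and> mat_adjoint U * U = 1\<^sub>m n \<and> U * mat_adjoint U = 1\<^sub>m n \<and>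
    (\<forall>K f. finite K \<longrightarrow> f \<in> borel_measurable (gauss (K \<times> {..<n})) \<longrightarrow>
      (\<integral>\<^sup>+x. f (row_app K n U x) \<partial>gauss (K \<times> {..<n})) = (\<integral>\<^sup>+x. f x \<partial>gauss (K \<times> {..<n})))"

lemma gauss_unitary_carrier: "gauss_unitary n U \<Longrightarrow> U \<in> carrier_mat n n"
  by (simp add: gauss_unitary_def)

lemma nn_integral_row_app:
  assumes "gauss_unitary n U" "finite K" "f \<in> borel_measurable (gauss (K \<times> {..<n}))"
  shows "(\<integral>\<^sup>+x. f (row_app K n U x) \<partial>gauss (K \<times> {..<n})) = (\<integral>\<^sup>+x. f x \<partial>gauss (K \<times> {..<n}))"
  using assms by (simp add: gauss_unitary_def)

lemma row_app_one: "x \<in> extensional (K \<times> {..<n}) \<Longrightarrow> row_app K n (1\<^sub>m n) x = x"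
proof
  fix q assume x: "x \<in> extensional (K \<times> {..<n})"
  show "row_app K n (1\<^sub>m n) x q = x q"
  proof (cases "q \<in> K \<times> {..<n}")
    case True
    then obtain k l where q: "q = (k, l)" "k \<in> K" "l < n" by auto
    have "(\<Sum>j<n. 1\<^sub>m n $$ (l, j) * x (k, j)) = (\<Sum>j<n. if j = l then x (k, j) else 0)"
      using q by (intro sum.cong) auto
    then show ?thesis using q by simp
  next
    case False
    then show ?thesis using extensional_arb[OF x False] by (simp only: row_app_def restrict_apply if_False)
  qed
qed

lemma row_app_mult:
  assumes "U \<in> carrier_mat n n" "V \<in> carrier_mat n n"
  shows "row_app K n (U * V) x = row_app K n U (row_app K n V x)"
proof
  fix q
  show "row_app K n (U * V) x q = row_app K n U (row_app K n V x) q"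
  proof (cases "q \<in> K \<times> {..<n}")
    case True
    then obtain k l where q: "q = (k, l)" "k \<in> K" "l < n" by auto
    have "(\<Sum>j<n. (U * V) $$ (l, j) * x (k, j)) = (\<Sum>j<n. \<Sum>i<n. U $$ (l, i) * V $$ (i, j) * x (k, j))"
      using assms q by (intro sum.cong) (auto simp: scalar_prod_def sum_distrib_right lessThan_atLeast0 index_mult_mat intro!: sum.cong)
    also have "\<dots> = (\<Sum>i<n. \<Sum>j<n. U $$ (l, i) * V $$ (i, j) * x (k, j))"
      by (rule sum.swap)
    also have "\<dots> = (\<Sum>i<n. U $$ (l, i) * (\<Sum>j<n. V $$ (i, j) * x (k, j)))"
      by (simp add: sum_distrib_left mult.assoc)
    finally show ?thesis using q by simp
  qed (auto simp: row_app_def)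
qed

lemma gauss_unitary_one: "gauss_unitary n (1\<^sub>m n)"
  unfolding gauss_unitary_def
  by (auto intro!: nn_integral_cong simp: row_app_one space_gauss)

lemma gauss_unitary_mult:
  assumes U: "gauss_unitary n U" and V: "gauss_unitary n V"
  shows "gauss_unitary n (U * V)"
proof -
  have c: "U \<in> carrier_mat n n" "V \<in> carrier_mat n n" "mat_adjoint U \<in> carrier_mat n n" "mat_adjoint V \<in> carrier_mat n n"
    using U V by (auto simp: gauss_unitary_def)
  have c': "mat_adjoint U * U \<in> carrier_mat n n" "V * mat_adjoint V \<in> carrier_mat n n" "U * V \<in> carrier_mat n n"
    using c by (auto intro: mult_carrier_mat)
  note assoc = assoc_mult_mat[of _ n n _ n _ n]
  have 1: "mat_adjoint (U * V) * (U * V) = mat_adjoint V * (mat_adjoint U * U) * V"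
    unfolding mat_adjoint_mult[OF c(1,2)] assoc[OF c(4) c'(1) c(2)] assoc[OF c(3,1,2)] assoc[OF c(4,3) c'(3)] ..
  have 2: "(U * V) * mat_adjoint (U * V) = U * (V * mat_adjoint V) * mat_adjoint U"
    unfolding mat_adjoint_mult[OF c(1,2)] assoc[OF c(1) c'(2) c(3)] assoc[OF c(2,4,3)]
    by (rule assoc[OF c(1,2) mult_carrier_mat[OF c(4,3)]])
  have 3: "(\<integral>\<^sup>+x. f (row_app K n (U * V) x) \<partial>gauss (K \<times> {..<n})) = (\<integral>\<^sup>+x. f x \<partial>gauss (K \<times> {..<n}))"
    if K: "finite K" and f[measurable]: "f \<in> borel_measurable (gauss (K \<times> {..<n}))" for K f
    using nn_integral_row_app[OF V K, of "\<lambda>x. f (row_app K n U x)"] nn_integral_row_app[OF U K f] f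
    by (simp add: row_app_mult[OF c(1,2)])
  show ?thesis
    using U V c 3 unfolding gauss_unitary_def 1 2 by auto
qed

text \<open>Invariance under \<open>U\<close> is applied to \<open>f\<close> composed with the
  action of the adjoint, which undoes the action of \<open>U\<close>.\<close>

lemma gauss_unitary_adjoint:
  assumes U: "gauss_unitary n U"
  shows "gauss_unitary n (mat_adjoint U)"
proof -
  have c: "U \<in> carrier_mat n n" "mat_adjoint U \<in> carrier_mat n n" and u: "mat_adjoint U * U = 1\<^sub>m n" "U * mat_adjoint U = 1\<^sub>m n"
    using U by (auto simp: gauss_unitary_def)
  have "(\<integral>\<^sup>+x. f (row_app K n (mat_adjoint U) x) \<partial>gauss (K \<times> {..<n})) = (\<integral>\<^sup>+x. f x \<partial>gauss (K \<times> {..<n}))"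
    if K: "finite K" and f[measurable]: "f \<in> borel_measurable (gauss (K \<times> {..<n}))" for K f
  proof -
    have "(\<integral>\<^sup>+x. f (row_app K n (mat_adjoint U) x) \<partial>gauss (K \<times> {..<n}))
        = (\<integral>\<^sup>+x. f (row_app K n (mat_adjoint U) (row_app K n U x)) \<partial>gauss (K \<times> {..<n}))"
      using nn_integral_row_app[OF U K, of "\<lambda>x. f (row_app K n (mat_adjoint U) x)"] by simp
    also have "\<dots> = (\<integral>\<^sup>+x. f x \<partial>gauss (K \<times> {..<n}))"
      by (intro nn_integral_cong) (simp add: row_app_mult[symmetric, OF c(2,1)] u row_app_one space_gauss)
    finally show ?thesis .
  qed
  then show ?thesis using c u by (simp add: gauss_unitary_def)
qed

subsection \<open>Plane rotations\<close>

definition givens :: "nat \<Rightarrow> nat \<Rightarrow> nat \<Rightarrow> complex \<Rightarrow> complex \<Rightarrow> complex mat" where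
  "givens n p q a b = mat n n (\<lambda>(i, j).
     if i = p then (if j = p then a else if j = q then b else 0)
     else if i = q then (if j = p then - cnj b else if j = q then cnj a else 0)
     else of_bool (i = j))"

lemma givens_carrier [simp]: "givens n p q a b \<in> carrier_mat n n"
  by (simp add: givens_def)

lemma sum_two_deltas:
  fixes y :: "nat \<Rightarrow> complex"
  assumes "p < n" "q < n" "p \<noteq> q"
  shows "(\<Sum>j<n. (if j = p then u else if j = q then v else 0) * y j) = u * y p + v * y q"
proof -
  have "(\<Sum>j<n. (if j = p then u else if j = q then v else 0) * y j)
     = (\<Sum>j<n. (if j = p then u * y j else 0) + (if j = q then v * y j else 0))"
    using assms by (intro sum.cong) auto
  then show ?thesis using assms by (simp add: sum.distrib)
qed

lemma givens_action:
  fixes y :: "nat \<Rightarrow> complex"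
  assumes "p < n" "q < n" "p \<noteq> q" "i < n"
  shows "(\<Sum>j<n. givens n p q a b $$ (i, j) * y j)
    = (if i = p then a * y p + b * y q else if i = q then - cnj b * y p + cnj a * y q else y i)"
proof -
  have e: "(\<Sum>j<n. givens n p q a b $$ (i, j) * y j) = (\<Sum>j<n. (if i = p then (if j = p then a else if j = q then b else 0)
     else if i = q then (if j = p then - cnj b else if j = q then cnj a else 0)
     else of_bool (i = j)) * y j)"
    using assms by (intro sum.cong) (auto simp: givens_def)
  consider "i = p" | "i \<noteq> p" "i = q" | "i \<noteq> p" "i \<noteq> q" by blast
  then show ?thesis
  proof cases
    case 1 then show ?thesis unfolding e using sum_two_deltas[OF assms(1-3), of a b y] by simp
  next
    case 2 then show ?thesis unfolding e using sum_two_deltas[OF assms(1-3), of "- cnj b" "cnj a" y] assms by simp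
  next
    case 3
    have "(\<Sum>j<n. of_bool (i = j) * y j) = (\<Sum>j<n. if j = i then y j else 0)"
      by (intro sum.cong) auto
    then show ?thesis unfolding e using 3 assms by simp
  qed
qed

lemma givens_mult_inverse:
  assumes "p < n" "q < n" "p \<noteq> q" and ab: "a * cnj a + b * cnj b = 1"
  shows "givens n p q a b * givens n p q (cnj a) (- b) = 1\<^sub>m n"
proof (rule eq_matI)
  fix i j assume ij: "i < dim_row (1\<^sub>m n :: complex mat)" "j < dim_col (1\<^sub>m n :: complex mat)"
  have "(givens n p q a b * givens n p q (cnj a) (- b)) $$ (i, j)
      = (\<Sum>k<n. givens n p q a b $$ (i, k) * givens n p q (cnj a) (- b) $$ (k, j))"
    using ij by (subst index_mult_mat) (auto simp: scalar_prod_def lessThan_atLeast0 givens_def intro!: sum.cong)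
  also have "\<dots> = 1\<^sub>m n $$ (i, j)"
    using ij assms by (subst givens_action) (auto simp: givens_def algebra_simps)
  finally show "(givens n p q a b * givens n p q (cnj a) (- b)) $$ (i, j) = 1\<^sub>m n $$ (i, j)" .
qed (auto simp: givens_def)

text \<open>The rows are rotated separately, so the action on the whole matrix is a composition of
  rotations of single pairs of coordinates, one pair per row.\<close>

lemma gauss_unitary_givens:
  assumes pq: "p < n" "q < n" "p \<noteq> q" and b: "b \<noteq> 0" and ab: "a * cnj a + b * cnj b = 1"
  shows "gauss_unitary n (givens n p q a b)"
proof -
  let ?G = "givens n p q a b"
  have adj: "mat_adjoint ?G = givens n p q (cnj a) (- b)"
    using pq by (intro eq_matI) (auto simp: givens_def)
  have inv: "?G * mat_adjoint ?G = 1\<^sub>m n" "mat_adjoint ?G * ?G = 1\<^sub>m n"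
    using givens_mult_inverse[OF pq ab] givens_mult_inverse[OF pq, of "cnj a" "- b"] ab
    by (simp_all add: adj mult.commute)
  have "(\<integral>\<^sup>+x. f (row_app K n ?G x) \<partial>gauss (K \<times> {..<n})) = (\<integral>\<^sup>+x. f x \<partial>gauss (K \<times> {..<n}))"
    if K: "finite K" and f: "f \<in> borel_measurable (gauss (K \<times> {..<n}))" for K f
  proof -
    \<comment> \<open>\<open>R L\<close> rotates only the rows in \<open>L\<close>; the induction
      over \<open>L\<close> adds one row, that is one pair of coordinates, at a time.\<close>
    define R where "R L x = (\<lambda>(k, i). if k \<in> L \<and> i = p then a * x (k, p) + b * x (k, q)
        else if k \<in> L \<and> i = q then - cnj b * x (k, p) + cnj a * x (k, q) else x (k, i))"
      for L and x :: "nat \<times> nat \<Rightarrow> complex"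
    have R: "R L \<in> measurable (gauss (K \<times> {..<n})) (gauss (K \<times> {..<n}))" if "L \<subseteq> K" for L
    proof (rule measurable_PiM_single')
      fix l assume l: "l \<in> K \<times> {..<n}"
      obtain k i where "l = (k, i)" by force
      then show "(\<lambda>x. R L x l) \<in> measurable (gauss (K \<times> {..<n})) cgauss"
        unfolding R_def using l pq by (cases "k \<in> L"; cases "i = p"; cases "i = q") simp_all
    next
      show "(\<lambda>x k. R L x k) \<in> space (gauss (K \<times> {..<n})) \<rightarrow> (\<Pi>\<^sub>E k\<in>K \<times> {..<n}. space cgauss)"
        using pq that by (auto simp: R_def space_PiM PiE_def extensional_def)
    qed
    have "(\<integral>\<^sup>+x. f (R L x) \<partial>gauss (K \<times> {..<n})) = (\<integral>\<^sup>+x. f x \<partial>gauss (K \<times> {..<n}))" if "finite L" "L \<subseteq> K" for L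
      using that
    proof (induction L rule: finite_induct)
      case empty
      then show ?case by (simp add: R_def)
    next
      case (insert k L)
      have m: "(\<lambda>x. f (R L x)) \<in> borel_measurable (gauss (K \<times> {..<n}))"
        using measurable_compose[OF R f, of L] insert by simp
      have "R (insert k L) x = R L (x((k, p) := a * x (k, p) + b * x (k, q), (k, q) := - cnj b * x (k, p) + cnj a * x (k, q)))" for x
        using insert pq by (auto simp: R_def fun_eq_iff)
      then have "(\<integral>\<^sup>+x. f (R (insert k L) x) \<partial>gauss (K \<times> {..<n})) = (\<integral>\<^sup>+x. f (R L x) \<partial>gauss (K \<times> {..<n}))"
        using nn_integral_gauss_rotate_pair[OF _ _ _ _ b ab m, of "(k, p)" "(k, q)"] K pq insert by auto
      then show ?case using insert by auto
    qed
    from this[OF K order_refl]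
    have "(\<integral>\<^sup>+x. f (R K x) \<partial>gauss (K \<times> {..<n})) = (\<integral>\<^sup>+x. f x \<partial>gauss (K \<times> {..<n}))" .
    moreover have "row_app K n ?G x = R K x" if "x \<in> space (gauss (K \<times> {..<n}))" for x
    proof
      fix l :: "nat \<times> nat"
      obtain k i where "l = (k, i)" by force
      then show "row_app K n ?G x l = R K x l"
        using that pq by (auto simp: row_app_def R_def givens_action space_gauss extensional_def)
    qed
    ultimately show ?thesis by (simp cong: nn_integral_cong)
  qed
  then show ?thesis using inv by (simp add: gauss_unitary_def)
qed

section \<open>Elimination by plane rotations\<close>

lemma index_mult_mat_vec_sum:
  assumes "A \<in> carrier_mat m n" "v \<in> carrier_vec n" "i < m"
  shows "(A *\<^sub>v v) $ i = (\<Sum>j<n. A $$ (i, j) * v $ j)"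
  using assms by (auto simp: scalar_prod_def lessThan_atLeast0 intro!: sum.cong)

text \<open>Each coordinate in \<open>Q\<close> is rotated into the pivot \<open>p\<close> in turn.
  The two clauses about arbitrary \<open>x\<close> record that only the coordinates in
  \<open>insert p Q\<close> are mixed; they protect the columns already treated when the
  construction is iterated in the QR step.\<close>

lemma gauss_unitary_annihilate:
  assumes "finite Q" "Q \<subseteq> {..<n}" "p < n" "p \<notin> Q" and b: "b \<in> carrier_vec n"
  shows "\<exists>W. gauss_unitary n W \<and> (\<forall>i\<in>Q. (W *\<^sub>v b) $ i = 0) \<and>
    (\<forall>x\<in>carrier_vec n. (\<forall>i<n. i \<notin> insert p Q \<longrightarrow> (W *\<^sub>v x) $ i = x $ i) \<and>
      ((\<forall>i\<in>insert p Q. x $ i = 0) \<longrightarrow> (\<forall>i\<in>insert p Q. (W *\<^sub>v x) $ i = 0)))"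
  using assms(1,2,4)
proof (induction Q rule: finite_induct)
  case empty
  then show ?case using b by (intro exI[of _ "1\<^sub>m n"]) (auto simp: gauss_unitary_one)
next
  case (insert q Q)
  then obtain W where W: "gauss_unitary n W" and W0: "\<And>i. i \<in> Q \<Longrightarrow> (W *\<^sub>v b) $ i = 0"
    and W': "\<forall>x\<in>carrier_vec n. (\<forall>i<n. i \<notin> insert p Q \<longrightarrow> (W *\<^sub>v x) $ i = x $ i) \<and>
      ((\<forall>i\<in>insert p Q. x $ i = 0) \<longrightarrow> (\<forall>i\<in>insert p Q. (W *\<^sub>v x) $ i = 0))"
    by blast
  have W1: "\<And>x i. x \<in> carrier_vec n \<Longrightarrow> i < n \<Longrightarrow> i \<notin> insert p Q \<Longrightarrow> (W *\<^sub>v x) $ i = x $ i"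
    and W2: "\<And>x i. x \<in> carrier_vec n \<Longrightarrow> \<forall>i\<in>insert p Q. x $ i = 0 \<Longrightarrow> i \<in> insert p Q \<Longrightarrow> (W *\<^sub>v x) $ i = 0"
    using W' by blast+
  have Wc: "W \<in> carrier_mat n n" using W by (rule gauss_unitary_carrier)
  define u v where "u = (W *\<^sub>v b) $ p" and "v = (W *\<^sub>v b) $ q"
  have q: "q < n" "q \<noteq> p" "q \<notin> Q" "p \<notin> Q" "Q \<subseteq> {..<n}" using insert by auto
  show ?case
  \<comment> \<open>Plane rotations are available only with a nonzero off-diagonal entry, so an
    entry that already vanishes is left alone.\<close>
  proof (cases "v = 0")
    case True
    show ?thesis
    proof (intro exI[of _ W] conjI ballI allI impI)
      fix i assume "i \<in> insert q Q"
      then show "(W *\<^sub>v b) $ i = 0" using W0 True v_def by auto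
    next
      fix x :: "complex Matrix.vec" and i assume x: "x \<in> carrier_vec n" "\<forall>i\<in>insert p (insert q Q). x $ i = 0" "i \<in> insert p (insert q Q)"
      show "(W *\<^sub>v x) $ i = 0"
      proof (cases "i = q")
        case True then show ?thesis using W1[of x q] x q by auto
      next
        case False then show ?thesis using W2[of x i] x by auto
      qed
    qed (use W W1 in auto)
  next
    case False
    define \<rho> where "\<rho> = sqrt ((cmod u)\<^sup>2 + (cmod v)\<^sup>2)"
    have pos: "(cmod u)\<^sup>2 + (cmod v)\<^sup>2 > 0" using False by (simp add: add_nonneg_pos)
    then have \<rho>: "\<rho> > 0" "\<rho>\<^sup>2 = (cmod u)\<^sup>2 + (cmod v)\<^sup>2" by (auto simp: \<rho>_def)
    \<comment> \<open>The normalised conjugates of \<open>u\<close> and \<open>v\<close>: the new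
      entry at \<open>q\<close> is \<open>- cnj c * u + cnj a * v\<close>, and both products equal u
      v / \<rho> up to sign.\<close>
    define a c where "a = cnj u / of_real \<rho>" and "c = cnj v / of_real \<rho>"
    have "a * cnj a + c * cnj c = (u * cnj u + v * cnj v) / (of_real \<rho>)\<^sup>2"
      by (simp add: a_def c_def power2_eq_square add_divide_distrib mult.commute)
    also have "u * cnj u + v * cnj v = of_real (\<rho>\<^sup>2)"
      unfolding \<rho> of_real_add complex_norm_square ..
    finally have ac: "a * cnj a + c * cnj c = 1" using \<rho>(1) by simp
    have c0: "c \<noteq> 0" using False \<rho> by (simp add: c_def)
    define G where "G = givens n p q a c"
    have G: "gauss_unitary n G" unfolding G_def using assms(3) q c0 ac by (intro gauss_unitary_givens) auto
    have Gc: "G \<in> carrier_mat n n" by (simp add: G_def)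
    have act: "((G * W) *\<^sub>v x) $ i = (if i = p then a * (W *\<^sub>v x) $ p + c * (W *\<^sub>v x) $ q
       else if i = q then - cnj c * (W *\<^sub>v x) $ p + cnj a * (W *\<^sub>v x) $ q else (W *\<^sub>v x) $ i)"
      if "x \<in> carrier_vec n" "i < n" for x i
    proof -
      have "((G * W) *\<^sub>v x) $ i = (G *\<^sub>v (W *\<^sub>v x)) $ i"
        using that Wc Gc by simp
      also have "\<dots> = (\<Sum>j<n. G $$ (i, j) * (W *\<^sub>v x) $ j)"
        using that Wc Gc by (intro index_mult_mat_vec_sum) auto
      finally show ?thesis unfolding G_def using assms(3) q that by (simp add: givens_action)
    qed
    show ?thesis
    proof (intro exI[of _ "G * W"] conjI ballI allI impI)
      show "gauss_unitary n (G * W)" by (rule gauss_unitary_mult[OF G W])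
      fix i assume i: "i \<in> insert q Q"
      show "((G * W) *\<^sub>v b) $ i = 0"
      proof (cases "i = q")
        case True
        have "((G * W) *\<^sub>v b) $ q = - cnj c * u + cnj a * v"
          using act[OF b q(1)] q by (simp add: u_def v_def)
        then show ?thesis using True by (simp add: a_def c_def)
      next
        case False
        then have "i \<in> Q" using i by auto
        then show ?thesis using act[OF b, of i] W0[of i] q False by auto
      qed
    next
      fix x :: "complex Matrix.vec" and i assume "x \<in> carrier_vec n" "i < n" "i \<notin> insert p (insert q Q)"
      then show "((G * W) *\<^sub>v x) $ i = x $ i" using act W1 by auto
    next
      fix x :: "complex Matrix.vec" and i assume x: "x \<in> carrier_vec n" "\<forall>i\<in>insert p (insert q Q). x $ i = 0" "i \<in> insert p (insert q Q)"
      have "(W *\<^sub>v x) $ q = 0" using W1[of x q] x q by auto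
      moreover have "(W *\<^sub>v x) $ p = 0" using W2[of x p] x by auto
      moreover have "(W *\<^sub>v x) $ i = 0" if "i \<in> Q" using W2[of x i] x that by auto
      ultimately show "((G * W) *\<^sub>v x) $ i = 0"
        using act[of x i] x q assms(3) by (auto split: if_splits)
    qed
  qed
qed

text \<open>Column \<open>j\<close> is cleared below its diagonal entry with pivot \<open>j\<close>,
  which is a legal index because \<open>k \<le> n\<close>. An earlier column already vanishes at all
  coordinates from \<open>j\<close> on, and its other coordinates are not touched. The induction
  keeps the full triangular shape; only the vanishing bottom rows are exported.\<close>

lemma gauss_unitary_QR:
  assumes A: "A \<in> carrier_mat n k" and "k \<le> n"
  shows "\<exists>V. gauss_unitary n V \<and> (\<forall>i l. k \<le> i \<longrightarrow> i < n \<longrightarrow> l < k \<longrightarrow> (V * A) $$ (i, l) = 0)"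
proof -
  have "\<exists>V. gauss_unitary n V \<and> (\<forall>i l. l < i \<longrightarrow> i < n \<longrightarrow> l < j \<longrightarrow> (V *\<^sub>v col A l) $ i = 0)" if "j \<le> k" for j
    using that
  proof (induction j)
    case 0
    then show ?case using gauss_unitary_one by auto
  next
    case (Suc j)
    then obtain V where V: "gauss_unitary n V" and V0: "\<And>i l. l < i \<Longrightarrow> i < n \<Longrightarrow> l < j \<Longrightarrow> (V *\<^sub>v col A l) $ i = 0"
      by auto
    have Vc: "V \<in> carrier_mat n n" using V by (rule gauss_unitary_carrier)
    have j: "j < n" using Suc assms by simp
    have col: "col A l \<in> carrier_vec n" for l using A by auto
    have "finite {j<..<n}" "{j<..<n} \<subseteq> {..<n}" "j \<notin> {j<..<n}" "V *\<^sub>v col A j \<in> carrier_vec n"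
      using Vc col by auto
    from gauss_unitary_annihilate[OF this(1,2) j this(3,4)]
    obtain W where W: "gauss_unitary n W" and W0: "\<And>i. i \<in> {j<..<n} \<Longrightarrow> (W *\<^sub>v (V *\<^sub>v col A j)) $ i = 0"
    and W': "\<forall>x\<in>carrier_vec n. (\<forall>i<n. i \<notin> insert j {j<..<n} \<longrightarrow> (W *\<^sub>v x) $ i = x $ i) \<and>
      ((\<forall>i\<in>insert j {j<..<n}. x $ i = 0) \<longrightarrow> (\<forall>i\<in>insert j {j<..<n}. (W *\<^sub>v x) $ i = 0))"
      by blast
    have W1: "\<And>x i. x \<in> carrier_vec n \<Longrightarrow> i < n \<Longrightarrow> i \<notin> insert j {j<..<n} \<Longrightarrow> (W *\<^sub>v x) $ i = x $ i"
    and W2: "\<And>x i. x \<in> carrier_vec n \<Longrightarrow> \<forall>i\<in>insert j {j<..<n}. x $ i = 0 \<Longrightarrow> i \<in> insert j {j<..<n} \<Longrightarrow> (W *\<^sub>v x) $ i = 0"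
      using W' by blast+
    have Wc: "W \<in> carrier_mat n n" using W by (rule gauss_unitary_carrier)
    have eq: "(W * V) *\<^sub>v col A l = W *\<^sub>v (V *\<^sub>v col A l)" for l
      using Wc Vc col by (intro assoc_mult_mat_vec) auto
    show ?case
    proof (intro exI[of _ "W * V"] conjI allI impI)
      show "gauss_unitary n (W * V)" by (rule gauss_unitary_mult[OF W V])
      fix i l assume il: "l < i" "i < n" "l < Suc j"
      have vc: "V *\<^sub>v col A l \<in> carrier_vec n" using Vc col by auto
      show "((W * V) *\<^sub>v col A l) $ i = 0"
      proof (cases "l = j")
        case True
        then show ?thesis unfolding eq using W0 il by auto
      next
        case False
        then have l: "l < j" using il by auto
        have z: "\<forall>i\<in>insert j {j<..<n}. (V *\<^sub>v col A l) $ i = 0" using V0 l j by auto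
        show ?thesis
        proof (cases "i < j")
          case True
          then show ?thesis unfolding eq using W1[OF vc il(2)] V0[OF il(1,2) l] by auto
        next
          case False
          then have "i \<in> insert j {j<..<n}" using il by auto
          then show ?thesis unfolding eq using W2[OF vc z] by auto
        qed
      qed
    qed
  qed
  from this[OF order_refl] obtain V where V: "gauss_unitary n V"
    and V0: "\<And>i l. l < i \<Longrightarrow> i < n \<Longrightarrow> l < k \<Longrightarrow> (V *\<^sub>v col A l) $ i = 0" by auto
  show ?thesis
  proof (intro exI[of _ V] conjI allI impI V)
    fix i l assume il: "k \<le> i" "i < n" "l < k"
    have "(V * A) $$ (i, l) = (V *\<^sub>v col A l) $ i"
      using il A gauss_unitary_carrier[OF V] by auto
    then show "(V * A) $$ (i, l) = 0" using V0[of l i] il by simp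
  qed
qed

text \<open>Any vector can be rotated to a multiple of a chosen basis vector. This is how a column
  of \<open>H\<close>, a contracted direction and an adjoined column are each brought to a
  coordinate axis below.\<close>

lemma gauss_unitary_align:
  assumes "p < n"
  shows "\<exists>W. gauss_unitary n W \<and> (\<forall>i<n. i \<noteq> p \<longrightarrow> (\<Sum>j<n. W $$ (i, j) * b j) = 0)"
proof -
  have "finite ({..<n} - {p})" "{..<n} - {p} \<subseteq> {..<n}" "p \<notin> {..<n} - {p}" "vec n b \<in> carrier_vec n" by auto
  from gauss_unitary_annihilate[OF this(1,2) assms this(3,4)]
  obtain W where W: "gauss_unitary n W" "\<forall>i\<in>{..<n} - {p}. (W *\<^sub>v vec n b) $ i = 0" by auto
  have "(\<Sum>j<n. W $$ (i, j) * b j) = 0" if "i < n" "i \<noteq> p" for i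
    using W(2) that gauss_unitary_carrier[OF W(1)]
      index_mult_mat_vec_sum[of W n n "vec n b" i] by simp
  with W show ?thesis by blast
qed

lemma gauss_unitary_cols:
  assumes "gauss_unitary n U" "i < n" "j < n"
  shows "(\<Sum>k<n. cnj (U $$ (k, i)) * U $$ (k, j)) = of_bool (i = j)"
proof -
  have c: "U \<in> carrier_mat n n" and u: "mat_adjoint U * U = 1\<^sub>m n" using assms by (auto simp: gauss_unitary_def)
  have "(mat_adjoint U * U) $$ (i, j) = (\<Sum>k<n. cnj (U $$ (k, i)) * U $$ (k, j))"
    using assms c by (auto simp: scalar_prod_def lessThan_atLeast0 intro!: sum.cong)
  then show ?thesis unfolding u using assms by (simp split: if_splits)
qed

lemma gauss_unitary_rows:
  assumes "gauss_unitary n U" "i < n" "j < n"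
  shows "(\<Sum>k<n. U $$ (i, k) * cnj (U $$ (j, k))) = of_bool (i = j)"
proof -
  have c: "U \<in> carrier_mat n n" and u: "U * mat_adjoint U = 1\<^sub>m n" using assms by (auto simp: gauss_unitary_def)
  have "(U * mat_adjoint U) $$ (i, j) = (\<Sum>k<n. U $$ (i, k) * cnj (U $$ (j, k)))"
    using assms c by (auto simp: scalar_prod_def lessThan_atLeast0 intro!: sum.cong)
  then show ?thesis unfolding u using assms by (simp split: if_splits)
qed

lemma gauss_unitary_inverse:
  assumes "gauss_unitary n U" "m < n"
  shows "(\<Sum>i<n. cnj (U $$ (i, m)) * (\<Sum>l<n. U $$ (i, l) * y l)) = y m"
    and "(\<Sum>i<n. U $$ (m, i) * (\<Sum>l<n. cnj (U $$ (l, i)) * y l)) = y m"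
proof -
  have "(\<Sum>i<n. cnj (U $$ (i, m)) * (\<Sum>l<n. U $$ (i, l) * y l)) = (\<Sum>i<n. \<Sum>l<n. cnj (U $$ (i, m)) * U $$ (i, l) * y l)"
    by (simp add: sum_distrib_left mult.assoc)
  also have "\<dots> = (\<Sum>l<n. (\<Sum>i<n. cnj (U $$ (i, m)) * U $$ (i, l)) * y l)"
    by (subst sum.swap) (simp add: sum_distrib_right)
  also have "\<dots> = (\<Sum>l<n. if l = m then y l else 0)"
    using assms by (intro sum.cong) (auto simp: gauss_unitary_cols)
  finally show "(\<Sum>i<n. cnj (U $$ (i, m)) * (\<Sum>l<n. U $$ (i, l) * y l)) = y m" using assms by simp
  have "(\<Sum>i<n. U $$ (m, i) * (\<Sum>l<n. cnj (U $$ (l, i)) * y l)) = (\<Sum>i<n. \<Sum>l<n. U $$ (m, i) * cnj (U $$ (l, i)) * y l)"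
    by (simp add: sum_distrib_left mult.assoc)
  also have "\<dots> = (\<Sum>l<n. (\<Sum>i<n. U $$ (m, i) * cnj (U $$ (l, i))) * y l)"
    by (subst sum.swap) (simp add: sum_distrib_right)
  also have "\<dots> = (\<Sum>l<n. if l = m then y l else 0)"
    using assms by (intro sum.cong) (auto simp: gauss_unitary_rows)
  finally show "(\<Sum>i<n. U $$ (m, i) * (\<Sum>l<n. cnj (U $$ (l, i)) * y l)) = y m" using assms by simp
qed

lemma gauss_unitary_norm:
  assumes U: "gauss_unitary n U"
  shows "(\<Sum>i<n. (cmod (\<Sum>l<n. U $$ (i, l) * y l))\<^sup>2) = (\<Sum>l<n. (cmod (y l))\<^sup>2)"
proof -
  have "complex_of_real (\<Sum>i<n. (cmod (\<Sum>l<n. U $$ (i, l) * y l))\<^sup>2)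
      = (\<Sum>i<n. (\<Sum>l<n. U $$ (i, l) * y l) * (\<Sum>m<n. cnj (U $$ (i, m)) * cnj (y m)))"
    by (simp only: of_real_sum complex_norm_square cnj_sum complex_cnj_mult)
  also have "\<dots> = (\<Sum>i<n. \<Sum>m<n. cnj (y m) * (cnj (U $$ (i, m)) * (\<Sum>l<n. U $$ (i, l) * y l)))"
    by (simp add: sum_distrib_left sum_distrib_right mult_ac)
  also have "\<dots> = (\<Sum>m<n. cnj (y m) * (\<Sum>i<n. cnj (U $$ (i, m)) * (\<Sum>l<n. U $$ (i, l) * y l)))"
    by (subst sum.swap) (simp add: sum_distrib_left)
  also have "\<dots> = (\<Sum>m<n. cnj (y m) * y m)"
    by (intro sum.cong refl) (simp add: gauss_unitary_inverse[OF U])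
  also have "\<dots> = complex_of_real (\<Sum>m<n. (cmod (y m))\<^sup>2)"
    by (simp only: of_real_sum complex_norm_square mult.commute)
  finally show ?thesis by (simp only: of_real_eq_iff)
qed

subsection \<open>Domination of Gram matrices\<close>

text \<open>By continuity the condition need only be tested on a countable dense set. All events on
  quadratic forms quantify over uncountably many vectors and get their measurability from
  here.\<close>

lemma sets_Collect_all_nonneg:
  fixes q :: "'a \<Rightarrow> ('b :: second_countable_topology) \<Rightarrow> real"
  assumes q: "\<And>v. (\<lambda>x. q x v) \<in> borel_measurable M"
    and cont: "\<And>x. continuous_on UNIV (q x)"
  shows "{x \<in> space M. \<forall>v. 0 \<le> q x v} \<in> sets M"
proof -
  obtain D :: "'b set" where D: "countable D" "\<And>X. open X \<Longrightarrow> X \<noteq> {} \<Longrightarrow> \<exists>d\<in>D. d \<in> X"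
    using countable_dense_exists by metis
  have *: "(\<forall>v. 0 \<le> q x v) \<longleftrightarrow> (\<forall>v\<in>D. 0 \<le> q x v)" for x
  proof (intro iffI allI ballI)
    fix v assume D': "\<forall>v\<in>D. 0 \<le> q x v"
    have "open {v. q x v < 0}"
      using cont by (intro open_Collect_less) auto
    note D(2)[OF this]
    with D' show "0 \<le> q x v" by (metis (mono_tags, lifting) empty_iff mem_Collect_eq not_less)
  qed auto
  have ne: "D \<noteq> {}" using D(2)[OF open_UNIV] by auto
  note q[measurable]
  have "{x \<in> space M. \<forall>n. 0 \<le> q x (from_nat_into D n)} \<in> sets M"
    by measurable
  moreover have "(\<forall>v\<in>D. 0 \<le> q x v) \<longleftrightarrow> (\<forall>n. 0 \<le> q x (from_nat_into D n))" for x
    using range_from_nat_into[OF ne D(1)] by (metis rangeI imageE)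
  ultimately have "{x \<in> space M. \<forall>v\<in>D. 0 \<le> q x v} \<in> sets M" by simp
  with * show ?thesis by simp
qed

lemma continuous_on_apply [continuous_intros]: "continuous_on S (\<lambda>w :: nat \<Rightarrow> complex. w i)"
  by (rule continuous_on_subset[OF continuous_on_product_coordinates]) simp

text \<open>\<open>\<lbrakk>G G\<^sup>* \<ge> H H\<^sup>* + \<theta> e\<^sub>0 e\<^sub>0\<^sup>*\<rbrakk>\<close> for an \<open>r \<times> n\<close> matrix \<open>G\<close> and an \<open>r \<times> k\<close> matrix \<open>H\<close>.\<close>

definition dominates :: "nat \<Rightarrow> nat \<Rightarrow> nat \<Rightarrow> (nat \<times> nat \<Rightarrow> complex) \<Rightarrow> real \<Rightarrow> (nat \<times> nat \<Rightarrow> complex) \<Rightarrow> bool" where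
  "dominates r n k H \<theta> G \<longleftrightarrow> (\<forall>w. (\<Sum>l<k. (cmod (\<Sum>i<r. w i * H (i, l)))\<^sup>2) + \<theta> * (cmod (w 0))\<^sup>2
      \<le> (\<Sum>j<n. (cmod (\<Sum>i<r. w i * G (i, j)))\<^sup>2))"

lemma sets_dominates:
  assumes G: "\<And>i j. i < r \<Longrightarrow> j < n \<Longrightarrow> (\<lambda>x. G x (i, j)) \<in> borel_measurable M"
    and H: "\<And>i l. i < r \<Longrightarrow> l < k \<Longrightarrow> (\<lambda>x. H x (i, l)) \<in> borel_measurable M"
    and \<theta>: "\<theta> \<in> borel_measurable M"
  shows "{x \<in> space M. dominates r n k (H x) (\<theta> x) (G x)} \<in> sets M"
proof -
  define q where "q x w = (\<Sum>j<n. (cmod (\<Sum>i<r. w i * G x (i, j)))\<^sup>2)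
      - ((\<Sum>l<k. (cmod (\<Sum>i<r. w i * H x (i, l)))\<^sup>2) + \<theta> x * (cmod (w 0))\<^sup>2)" for x and w :: "nat \<Rightarrow> complex"
  have "{x \<in> space M. \<forall>w. 0 \<le> q x w} \<in> sets M"
  proof (rule sets_Collect_all_nonneg)
    fix w :: "nat \<Rightarrow> complex"
    have 1: "(\<lambda>x. \<Sum>i<r. w i * G x (i, j)) \<in> borel_measurable M" if "j < n" for j
      using G that by (intro borel_measurable_sum borel_measurable_times) auto
    have 2: "(\<lambda>x. \<Sum>i<r. w i * H x (i, l)) \<in> borel_measurable M" if "l < k" for l
      using H that by (intro borel_measurable_sum borel_measurable_times) auto
    show "(\<lambda>x. q x w) \<in> borel_measurable M"
      unfolding q_def using 1 2 \<theta>
      by (intro borel_measurable_diff borel_measurable_add borel_measurable_sum borel_measurable_power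
          borel_measurable_norm borel_measurable_times) auto
  next
    fix x show "continuous_on UNIV (q x)"
      unfolding q_def by (intro continuous_intros)
  qed
  then show ?thesis by (simp add: q_def dominates_def algebra_simps)
qed

lemma measurable_indicator_dominates:
  assumes "\<And>i j. i < r \<Longrightarrow> j < n \<Longrightarrow> (\<lambda>x. G x (i, j)) \<in> borel_measurable M"
    and "\<And>i l. i < r \<Longrightarrow> l < k \<Longrightarrow> (\<lambda>x. H x (i, l)) \<in> borel_measurable M"
    and "\<theta> \<in> borel_measurable M"
  shows "(\<lambda>x. indicator {x. dominates r n k (H x) (\<theta> x) (G x)} x :: ennreal) \<in> borel_measurable M"
proof (rule borel_measurable_indicator')
  show "{x \<in> space M. x \<in> {x. dominates r n k (H x) (\<theta> x) (G x)}} \<in> sets M"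
    using sets_dominates[where G=G and H=H and r=r and n=n and k=k and \<theta>=\<theta>, OF assms(1) assms(2) assms(3)] by simp
qed

lemma dominates_cong:
  assumes "\<And>i j. i < r \<Longrightarrow> j < n \<Longrightarrow> G (i, j) = G' (i, j)" "\<And>i l. i < r \<Longrightarrow> l < k \<Longrightarrow> H (i, l) = H' (i, l)"
  shows "dominates r n k H \<theta> G \<longleftrightarrow> dominates r n k H' \<theta> G'"
  unfolding dominates_def using assms by simp

definition transp :: "(nat \<times> nat) set \<Rightarrow> (nat \<times> nat \<Rightarrow> complex) \<Rightarrow> (nat \<times> nat \<Rightarrow> complex)" where
  "transp I x = restrict (\<lambda>p. x (prod.swap p)) I"

lemma measurable_transp [measurable]: "transp (K \<times> J) \<in> measurable (gauss (J \<times> K)) (gauss (K \<times> J))"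
  unfolding transp_def by (intro measurable_restrict) auto

lemma nn_integral_transp:
  assumes "finite J" "finite K" and f: "f \<in> borel_measurable (gauss (K \<times> J))"
  shows "(\<integral>\<^sup>+x. f (transp (K \<times> J) x) \<partial>gauss (J \<times> K)) = (\<integral>\<^sup>+x. f x \<partial>gauss (K \<times> J))"
proof -
  have "distr (gauss (J \<times> K)) (gauss (K \<times> J)) (transp (K \<times> J)) = gauss (K \<times> J)"
    unfolding transp_def
    by (rule distr_PiM_reindex[of "J \<times> K" "\<lambda>_. cgauss" prod.swap "K \<times> J"]) (auto simp: prob_space_cgauss inj_on_def)
  then show ?thesis
    using nn_integral_distr[of "transp (K \<times> J)" "gauss (J \<times> K)" "gauss (K \<times> J)" f] f by simp
qed

text \<open>Multiplication from the left by \<open>U\<close>, written through transposition so that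
  its invariance is inherited from \<open>row_app\<close>.\<close>

definition col_app :: "nat \<Rightarrow> nat set \<Rightarrow> complex mat \<Rightarrow> (nat \<times> nat \<Rightarrow> complex) \<Rightarrow> (nat \<times> nat \<Rightarrow> complex)" where
  "col_app n K U x = transp ({..<n} \<times> K) (row_app K n U (transp (K \<times> {..<n}) x))"

lemma col_app_apply: "i < n \<Longrightarrow> k \<in> K \<Longrightarrow> col_app n K U x (i, k) = (\<Sum>j<n. U $$ (i, j) * x (j, k))"
  by (simp add: col_app_def transp_def)

lemma nn_integral_col_app:
  assumes U: "gauss_unitary n U" and K: "finite K" and f: "f \<in> borel_measurable (gauss ({..<n} \<times> K))"
  shows "(\<integral>\<^sup>+x. f (col_app n K U x) \<partial>gauss ({..<n} \<times> K)) = (\<integral>\<^sup>+x. f x \<partial>gauss ({..<n} \<times> K))"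
proof -
  have m: "(\<lambda>y. f (transp ({..<n} \<times> K) y)) \<in> borel_measurable (gauss (K \<times> {..<n}))"
    using measurable_compose[OF measurable_transp f] by simp
  then have m': "(\<lambda>y. f (transp ({..<n} \<times> K) (row_app K n U y))) \<in> borel_measurable (gauss (K \<times> {..<n}))"
    using measurable_compose[OF measurable_row_app] by simp
  have "(\<integral>\<^sup>+x. f (col_app n K U x) \<partial>gauss ({..<n} \<times> K))
      = (\<integral>\<^sup>+y. f (transp ({..<n} \<times> K) (row_app K n U y)) \<partial>gauss (K \<times> {..<n}))"
    unfolding col_app_def using nn_integral_transp[OF _ K m'] by simp
  also have "\<dots> = (\<integral>\<^sup>+y. f (transp ({..<n} \<times> K) y) \<partial>gauss (K \<times> {..<n}))"
    by (rule nn_integral_row_app[OF U K m])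
  also have "\<dots> = (\<integral>\<^sup>+x. f x \<partial>gauss ({..<n} \<times> K))"
    using nn_integral_transp[OF K _ f] by simp
  finally show ?thesis .
qed

lemma nn_integral_gauss_const: "(\<integral>\<^sup>+x. c \<partial>gauss I) = c"
  by (simp add: cgauss_PiM.emeasure_space_1)

text \<open>Lack of memory of the exponential law of |z|^2: on the part where it exceeds \<theta>,
  the excess has the original law with total mass exp (-\<theta>). The remaining part contributes a
  nonnegative amount on the right.\<close>

lemma nn_integral_cgauss_shift_le:
  assumes [measurable]: "f \<in> borel_measurable borel" and "0 \<le> \<theta>"
  shows "ennreal (exp (- \<theta>)) * (\<integral>\<^sup>+z. f ((cmod z)\<^sup>2) \<partial>cgauss) \<le> (\<integral>\<^sup>+z. f ((cmod z)\<^sup>2 - \<theta>) \<partial>cgauss)"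
proof -
  have "ennreal (exp (- \<theta>)) * (\<integral>\<^sup>+z. f ((cmod z)\<^sup>2) \<partial>cgauss)
      = (\<integral>\<^sup>+r. ennreal (exp (- \<theta>)) * (ennreal (exponential_density 1 r) * f r) \<partial>lborel)"
    by (simp add: nn_integral_cgauss_cmod_square nn_integral_cmult)
  also have "\<dots> \<le> (\<integral>\<^sup>+r. ennreal (exponential_density 1 (\<theta> + r)) * f r \<partial>lborel)"
  proof (rule nn_integral_mono)
    fix r :: real
    have "ennreal (exp (- \<theta>)) * ennreal (exponential_density 1 r) \<le> ennreal (exponential_density 1 (\<theta> + r))"
      using assms(2) by (auto simp: erlang_density_def ennreal_mult[symmetric] exp_add[symmetric] intro!: ennreal_leI)
    then show "ennreal (exp (- \<theta>)) * (ennreal (exponential_density 1 r) * f r) \<le> ennreal (exponential_density 1 (\<theta> + r)) * f r"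
      unfolding mult.assoc[symmetric] by (rule mult_right_mono) simp
  qed
  also have "\<dots> = (\<integral>\<^sup>+r. ennreal (exponential_density 1 r) * f (r - \<theta>) \<partial>lborel)"
    using nn_integral_real_affine[of "\<lambda>r. ennreal (exponential_density 1 r) * f (r - \<theta>)" 1 \<theta>] by simp
  also have "\<dots> = (\<integral>\<^sup>+z. f ((cmod z)\<^sup>2 - \<theta>) \<partial>cgauss)"
    using nn_integral_cgauss_cmod_square[of "\<lambda>r. f (r - \<theta>)"] by simp
  finally show ?thesis .
qed

subsection \<open>The rank-one shift\<close>

definition glue :: "(nat \<times> nat \<Rightarrow> complex) \<Rightarrow> (nat \<times> nat \<Rightarrow> complex) \<Rightarrow> (nat \<times> nat \<Rightarrow> complex)" where
  "glue y X = (\<lambda>(i, j). if i = 0 then y (0, j) else X (i, j))"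

text \<open>With the last column of the rows \<open>1, \<dots>, r - 1\<close> equal to zero, the last entry \<open>h\<close> of row \<open>0\<close>
  enters \<open>G G\<^sup>*\<close> only through \<open>|h|\<^sup>2 e\<^sub>0 e\<^sub>0\<^sup>*\<close>.\<close>

lemma dominates_shift_reduced:
  assumes X: "\<And>i. 0 < i \<Longrightarrow> i < Suc r \<Longrightarrow> X (i, r) = 0" and "0 \<le> \<theta>"
  shows "ennreal (exp (- \<theta>)) * (\<integral>\<^sup>+y. indicator {y. dominates (Suc r) (Suc r) k H 0 (glue y X)} y \<partial>gauss ({0} \<times> {..<Suc r}))
    \<le> (\<integral>\<^sup>+y. indicator {y. dominates (Suc r) (Suc r) k H \<theta> (glue y X)} y \<partial>gauss ({0} \<times> {..<Suc r}))"
proof -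
  have ins: "{0::nat} \<times> {..<Suc r} = insert (0, r) ({0} \<times> {..<r})" by auto
  have fin: "finite ({0::nat} \<times> {..<r})" "(0, r) \<notin> {0::nat} \<times> {..<r}" by auto
  have meas: "(\<lambda>y. indicator {y. dominates (Suc r) (Suc r) k H t (glue y X)} y :: ennreal)
      \<in> borel_measurable (gauss ({0} \<times> {..<Suc r}))" for t
  proof (rule measurable_indicator_dominates)
    fix i j assume "i < Suc r" "j < Suc r"
    then show "(\<lambda>y. glue y X (i, j)) \<in> borel_measurable (gauss ({0} \<times> {..<Suc r}))"
      by (cases "i = 0") (auto simp: glue_def)
  qed auto
  \<comment> \<open>\<open>B y s\<close> replaces the contribution of the last entry of row 0 by a
    coefficient \<open>s\<close> of the rank-one term, possibly negative. The modulus of that entry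
    and \<theta> then enter only through the difference |h|^2 - \<theta>, to which the lack of
    memory applies.\<close>
  define B where "B y s \<longleftrightarrow> (\<forall>w. (\<Sum>l<k. (cmod (\<Sum>i<Suc r. w i * H (i, l)))\<^sup>2)
      \<le> (\<Sum>j<r. (cmod (\<Sum>i<Suc r. w i * glue y X (i, j)))\<^sup>2) + s * (cmod (w 0))\<^sup>2)" for y :: "nat \<times> nat \<Rightarrow> complex" and s :: real
  have dom: "dominates (Suc r) (Suc r) k H t (glue (y((0, r) := h)) X) \<longleftrightarrow> B y ((cmod h)\<^sup>2 - t)" for y h t
  proof -
    have "(\<Sum>j<Suc r. (cmod (\<Sum>i<Suc r. w i * glue (y((0, r) := h)) X (i, j)))\<^sup>2)
        = (\<Sum>j<r. (cmod (\<Sum>i<Suc r. w i * glue y X (i, j)))\<^sup>2) + (cmod h)\<^sup>2 * (cmod (w 0))\<^sup>2" for w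
    proof -
      have "(\<Sum>i<Suc r. w i * glue (y((0, r) := h)) X (i, r)) = (\<Sum>i<Suc r. if i = 0 then w 0 * h else 0)"
        using X by (intro sum.cong) (auto simp: glue_def)
      then have last: "(\<Sum>i<Suc r. w i * glue (y((0, r) := h)) X (i, r)) = w 0 * h" by simp
      have "(\<Sum>j<r. (cmod (\<Sum>i<Suc r. w i * glue (y((0, r) := h)) X (i, j)))\<^sup>2)
         = (\<Sum>j<r. (cmod (\<Sum>i<Suc r. w i * glue y X (i, j)))\<^sup>2)"
        by (intro sum.cong refl arg_cong[where f="\<lambda>u. (cmod u)\<^sup>2"]) (auto simp: glue_def)
      then show ?thesis
        unfolding sum.lessThan_Suc[where g="\<lambda>j. (cmod (\<Sum>i<Suc r. w i * glue (y((0, r) := h)) X (i, j)))\<^sup>2"] last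
        by (simp add: norm_mult power_mult_distrib mult.commute)
    qed
    then show ?thesis unfolding dominates_def B_def by (simp add: algebra_simps)
  qed
  have Bm: "(\<lambda>s. indicator {s. B y s} s :: ennreal) \<in> borel_measurable borel" for y
  proof (rule borel_measurable_indicator')
    define q where "q s w = (\<Sum>j<r. (cmod (\<Sum>i<Suc r. w i * glue y X (i, j)))\<^sup>2) + s * (cmod (w 0))\<^sup>2
      - (\<Sum>l<k. (cmod (\<Sum>i<Suc r. w i * H (i, l)))\<^sup>2)" for s and w :: "nat \<Rightarrow> complex"
    have "{s \<in> space borel. \<forall>w. 0 \<le> q s w} \<in> sets borel"
      by (rule sets_Collect_all_nonneg) (auto simp: q_def intro!: continuous_intros)
    then show "{x \<in> space borel. x \<in> {s. B y s}} \<in> sets borel" by (simp add: q_def B_def)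
  qed
  have eq: "(\<integral>\<^sup>+y. indicator {y. dominates (Suc r) (Suc r) k H t (glue y X)} y \<partial>gauss ({0} \<times> {..<Suc r}))
     = (\<integral>\<^sup>+y. \<integral>\<^sup>+h. indicator {s. B y s} ((cmod h)\<^sup>2 - t) \<partial>cgauss \<partial>gauss ({0} \<times> {..<r}))" for t
    unfolding ins
    by (subst cgauss_PiM.product_nn_integral_insert[OF fin meas[unfolded ins]])
       (simp add: indicator_def dom)
  have meas': "(\<lambda>y. \<integral>\<^sup>+h. indicator {s. B y s} ((cmod h)\<^sup>2 - 0) \<partial>cgauss) \<in> borel_measurable (gauss ({0} \<times> {..<r}))"
  proof -
    have [measurable]: "(\<lambda>(y, h). indicator {y. dominates (Suc r) (Suc r) k H 0 (glue y X)} (y((0, r) := h)) :: ennreal)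
       \<in> borel_measurable (gauss ({0} \<times> {..<r}) \<Otimes>\<^sub>M cgauss)"
      using measurable_compose[OF measurable_add_dim meas[unfolded ins, of 0]] by (simp add: split_def)
    have "(\<lambda>y. \<integral>\<^sup>+h. indicator {y. dominates (Suc r) (Suc r) k H 0 (glue y X)} (y((0, r) := h)) \<partial>cgauss)
       \<in> borel_measurable (gauss ({0} \<times> {..<r}))" by measurable
    then show ?thesis by (simp add: indicator_def dom)
  qed
  have "ennreal (exp (- \<theta>)) * (\<integral>\<^sup>+y. indicator {y. dominates (Suc r) (Suc r) k H 0 (glue y X)} y \<partial>gauss ({0} \<times> {..<Suc r}))
    = (\<integral>\<^sup>+y. ennreal (exp (- \<theta>)) * (\<integral>\<^sup>+h. indicator {s. B y s} ((cmod h)\<^sup>2 - 0) \<partial>cgauss) \<partial>gauss ({0} \<times> {..<r}))"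
    unfolding eq by (rule nn_integral_cmult[symmetric, OF meas'])
  also have "\<dots> \<le> (\<integral>\<^sup>+y. \<integral>\<^sup>+h. indicator {s. B y s} ((cmod h)\<^sup>2 - \<theta>) \<partial>cgauss \<partial>gauss ({0} \<times> {..<r}))"
    using nn_integral_cgauss_shift_le[OF Bm assms(2)] by (intro nn_integral_mono) simp
  finally show ?thesis unfolding eq .
qed

text \<open>The rows 1, ..., r span at most \<open>r\<close> of the \<open>r + 1\<close> dimensions,
  so a rotation of the columns, chosen from these rows alone, makes their last entries vanish. It
  does not change the Gram matrix, and row 0, independent of the others, stays Gaussian under
  it.\<close>

lemma dominates_shift_row:
  assumes "0 \<le> \<theta>"
  shows "ennreal (exp (- \<theta>)) * (\<integral>\<^sup>+y. indicator {y. dominates (Suc r) (Suc r) k H 0 (glue y x)} y \<partial>gauss ({0} \<times> {..<Suc r}))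
    \<le> (\<integral>\<^sup>+y. indicator {y. dominates (Suc r) (Suc r) k H \<theta> (glue y x)} y \<partial>gauss ({0} \<times> {..<Suc r}))"
proof -
  define M where "M = mat (Suc r) r (\<lambda>(j, l). x (Suc l, j))"
  have M: "M \<in> carrier_mat (Suc r) r" by (simp add: M_def)
  from gauss_unitary_QR[OF M] obtain V where V: "gauss_unitary (Suc r) V"
    and V0: "\<And>l. l < r \<Longrightarrow> (V * M) $$ (r, l) = 0" by auto
  have Vc: "V \<in> carrier_mat (Suc r) (Suc r)" using V by (rule gauss_unitary_carrier)
  define X where "X = (\<lambda>(i, j'). \<Sum>j<Suc r. V $$ (j', j) * x (i, j))"
  have X0: "X (i, r) = 0" if "0 < i" "i < Suc r" for i
  proof -
    obtain l where l: "i = Suc l" "l < r" using \<open>0 < i\<close> \<open>i < Suc r\<close> by (cases i) auto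
    have "(V * M) $$ (r, l) = (\<Sum>j<Suc r. V $$ (r, j) * x (i, j))"
      using l Vc M by (auto simp: scalar_prod_def lessThan_atLeast0 M_def intro!: sum.cong)
    then show ?thesis using V0 l by (simp add: X_def)
  qed
  have dom: "dominates (Suc r) (Suc r) k H t (glue y x) \<longleftrightarrow> dominates (Suc r) (Suc r) k H t (glue (row_app {0} (Suc r) V y) X)" for y t
  proof -
    have "(\<Sum>j<Suc r. (cmod (\<Sum>i<Suc r. w i * glue y x (i, j)))\<^sup>2)
        = (\<Sum>j'<Suc r. (cmod (\<Sum>i<Suc r. w i * glue (row_app {0} (Suc r) V y) X (i, j')))\<^sup>2)" for w
    proof -
      have "(\<Sum>i<Suc r. w i * glue (row_app {0} (Suc r) V y) X (i, j'))
          = (\<Sum>j<Suc r. V $$ (j', j) * (\<Sum>i<Suc r. w i * glue y x (i, j)))" if "j' < Suc r" for j'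
      proof -
        have g: "glue (row_app {0} (Suc r) V y) X (i, j') = (\<Sum>j<Suc r. V $$ (j', j) * glue y x (i, j))" for i
          using that by (auto simp: glue_def X_def simp del: sum.lessThan_Suc)
        have "(\<Sum>i<Suc r. w i * glue (row_app {0} (Suc r) V y) X (i, j'))
          = (\<Sum>i<Suc r. \<Sum>j<Suc r. V $$ (j', j) * (w i * glue y x (i, j)))"
          unfolding g by (simp add: sum_distrib_left mult_ac del: sum.lessThan_Suc)
        also have "\<dots> = (\<Sum>j<Suc r. V $$ (j', j) * (\<Sum>i<Suc r. w i * glue y x (i, j)))"
          by (subst sum.swap) (simp only: sum_distrib_left)
        finally show ?thesis .
      qed
      then show ?thesis
        using gauss_unitary_norm[OF V, of "\<lambda>j. \<Sum>i<Suc r. w i * glue y x (i, j)"]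
        by (simp del: sum.lessThan_Suc)
    qed
    then show ?thesis unfolding dominates_def by (simp del: sum.lessThan_Suc)
  qed
  have meas: "(\<lambda>y. indicator {y. dominates (Suc r) (Suc r) k H t (glue y X)} y :: ennreal)
      \<in> borel_measurable (gauss ({0} \<times> {..<Suc r}))" for t
  proof (rule measurable_indicator_dominates)
    fix i j assume "i < Suc r" "j < Suc r"
    then show "(\<lambda>y. glue y X (i, j)) \<in> borel_measurable (gauss ({0} \<times> {..<Suc r}))"
      by (cases "i = 0") (auto simp: glue_def)
  qed auto
  have eq: "(\<integral>\<^sup>+y. indicator {y. dominates (Suc r) (Suc r) k H t (glue y x)} y \<partial>gauss ({0} \<times> {..<Suc r}))
     = (\<integral>\<^sup>+y. indicator {y. dominates (Suc r) (Suc r) k H t (glue y X)} y \<partial>gauss ({0} \<times> {..<Suc r}))" for t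
    using nn_integral_row_app[OF V _ meas[of t]] by (simp add: indicator_def dom)
  show ?thesis unfolding eq by (rule dominates_shift_reduced[where X=X, OF X0 assms])
qed

text \<open>Fubini over the rows 1, ..., r; the rotation of the previous lemma may depend on
  them.\<close>

lemma dominates_shift:
  assumes "0 \<le> \<theta>"
  shows "ennreal (exp (- \<theta>)) * (\<integral>\<^sup>+G. indicator {G. dominates (Suc r) (Suc r) k H 0 G} G \<partial>gauss ({..<Suc r} \<times> {..<Suc r}))
    \<le> (\<integral>\<^sup>+G. indicator {G. dominates (Suc r) (Suc r) k H \<theta> G} G \<partial>gauss ({..<Suc r} \<times> {..<Suc r}))"
proof -
  let ?A = "{1..<Suc r} \<times> {..<Suc r}" and ?R = "{0::nat} \<times> {..<Suc r}"
  have un: "{..<Suc r} \<times> {..<Suc r} = ?A \<union> ?R" by auto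
  have dis: "?A \<inter> ?R = {}" "finite ?A" "finite ?R" by auto
  have meas: "(\<lambda>G. indicator {G. dominates (Suc r) (Suc r) k H t G} G :: ennreal) \<in> borel_measurable (gauss (?A \<union> ?R))" for t
    unfolding un[symmetric] by (rule measurable_indicator_dominates) auto
  have mg: "dominates (Suc r) (Suc r) k H t (merge ?A ?R (x, y)) \<longleftrightarrow> dominates (Suc r) (Suc r) k H t (glue y x)" for t x y
    by (rule dominates_cong) (auto simp: merge_def glue_def)
  have eq: "(\<integral>\<^sup>+G. indicator {G. dominates (Suc r) (Suc r) k H t G} G \<partial>gauss ({..<Suc r} \<times> {..<Suc r}))
     = (\<integral>\<^sup>+x. \<integral>\<^sup>+y. indicator {y. dominates (Suc r) (Suc r) k H t (glue y x)} y \<partial>gauss ?R \<partial>gauss ?A)" for t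
    unfolding un by (subst cgauss_PiM.product_nn_integral_fold[OF dis meas])
      (intro nn_integral_cong, simp add: indicator_def mg del: One_nat_def)
  have [measurable]: "(\<lambda>(x, y). indicator {G. dominates (Suc r) (Suc r) k H 0 G} (merge ?A ?R (x, y)) :: ennreal)
     \<in> borel_measurable (gauss ?A \<Otimes>\<^sub>M gauss ?R)"
    using measurable_compose[OF measurable_merge meas[of 0]] by (simp add: split_def)
  interpret R: prob_space "gauss ?R" by (intro prob_space_PiM prob_space_cgauss)
  have "(\<lambda>x. \<integral>\<^sup>+y. indicator {G. dominates (Suc r) (Suc r) k H 0 G} (merge ?A ?R (x, y)) \<partial>gauss ?R) \<in> borel_measurable (gauss ?A)"
    by measurable
  then have meas': "(\<lambda>x. \<integral>\<^sup>+y. indicator {y. dominates (Suc r) (Suc r) k H 0 (glue y x)} y \<partial>gauss ?R) \<in> borel_measurable (gauss ?A)"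
    by (simp add: indicator_def mg del: One_nat_def)
  show ?thesis
    unfolding eq nn_integral_cmult[symmetric, OF meas']
    by (intro nn_integral_mono dominates_shift_row assms)
qed

text \<open>The law of \<open>G G\<^sup>*\<close> for square \<open>G\<close> has density proportional to \<open>exp (- tr W)\<close> on the cone of positive
  matrices, so \<open>G G\<^sup>* \<ge> B\<close> has probability \<open>exp (- tr B)\<close>; only one inequality is needed. The columns
  of \<open>H\<close> are split off one at a time.\<close>

lemma dominates_gauss:
  "ennreal (exp (- (\<Sum>i<r. \<Sum>l<k. (cmod (H (i, l)))\<^sup>2)))
    \<le> (\<integral>\<^sup>+G. indicator {G. dominates r r k H 0 G} G \<partial>gauss ({..<r} \<times> {..<r}))"
proof (induction k arbitrary: H)
  case 0
  have "dominates r r 0 H 0 G" for G by (auto simp: dominates_def intro!: sum_nonneg)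
  then show ?case by (simp add: cgauss_PiM.emeasure_space_1)
next
  case (Suc k)
  show ?case
  proof (cases r)
    case 0
    have "dominates 0 0 (Suc k) H 0 G" for G by (auto simp: dominates_def)
    then show ?thesis by (simp add: 0 cgauss_PiM.emeasure_space_1)
  next
    case r: (Suc r')
    have r0: "0 < r" using r by simp
    \<comment> \<open>A rotation of the rows turns column \<open>k\<close> of \<open>H\<close> into
      a multiple of the first basis vector, so that this column contributes exactly the term with
      \<theta> in \<open>dominates\<close>, and the induction hypothesis covers the other rotated
      columns.\<close>
    from gauss_unitary_align[OF this, of "\<lambda>i. H (i, k)"] obtain W where W: "gauss_unitary r W"
      and W0: "\<And>i. i < r \<Longrightarrow> i \<noteq> 0 \<Longrightarrow> (\<Sum>j<r. W $$ (i, j) * H (j, k)) = 0" by auto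
    define H' where "H' = (\<lambda>(i, l). \<Sum>j<r. W $$ (i, j) * H (j, l))"
    define \<theta> where "\<theta> = (cmod (H' (0, k)))\<^sup>2"
    have col: "(\<Sum>i<r. (cmod (H' (i, l)))\<^sup>2) = (\<Sum>i<r. (cmod (H (i, l)))\<^sup>2)" for l
      using gauss_unitary_norm[OF W, of "\<lambda>j. H (j, l)"] by (simp add: H'_def)
    have "(\<Sum>i<r. (cmod (H' (i, k)))\<^sup>2) = (\<Sum>i<r. if i = 0 then \<theta> else 0)"
      using W0 by (intro sum.cong) (auto simp: \<theta>_def H'_def)
    then have colk: "(\<Sum>i<r. (cmod (H (i, k)))\<^sup>2) = \<theta>" using r0 col by simp
    have "(\<Sum>i<r. \<Sum>l<Suc k. (cmod (H (i, l)))\<^sup>2) = (\<Sum>l<Suc k. \<Sum>i<r. (cmod (H (i, l)))\<^sup>2)"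
      by (rule sum.swap)
    also have "\<dots> = (\<Sum>l<k. \<Sum>i<r. (cmod (H' (i, l)))\<^sup>2) + \<theta>"
      by (simp add: colk col)
    also have "(\<Sum>l<k. \<Sum>i<r. (cmod (H' (i, l)))\<^sup>2) = (\<Sum>i<r. \<Sum>l<k. (cmod (H' (i, l)))\<^sup>2)"
      by (rule sum.swap)
    finally have tot: "(\<Sum>i<r. \<Sum>l<Suc k. (cmod (H (i, l)))\<^sup>2) = (\<Sum>i<r. \<Sum>l<k. (cmod (H' (i, l)))\<^sup>2) + \<theta>" .
    have "ennreal (exp (- (\<Sum>i<r. \<Sum>l<Suc k. (cmod (H (i, l)))\<^sup>2)))
       = ennreal (exp (- \<theta>)) * ennreal (exp (- (\<Sum>i<r. \<Sum>l<k. (cmod (H' (i, l)))\<^sup>2)))"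
      unfolding tot by (simp add: ennreal_mult[symmetric] exp_add[symmetric])
    also have "\<dots> \<le> ennreal (exp (- \<theta>)) * (\<integral>\<^sup>+G. indicator {G. dominates r r k H' 0 G} G \<partial>gauss ({..<r} \<times> {..<r}))"
      by (intro mult_left_mono Suc.IH) simp
    also have "\<dots> \<le> (\<integral>\<^sup>+G. indicator {G. dominates r r k H' \<theta> G} G \<partial>gauss ({..<r} \<times> {..<r}))"
      unfolding r by (rule dominates_shift) (simp add: \<theta>_def)
    also have "\<dots> = (\<integral>\<^sup>+G. indicator {G. dominates r r k H' \<theta> G} (col_app r {..<r} W G) \<partial>gauss ({..<r} \<times> {..<r}))"
    proof (rule nn_integral_col_app[OF W, symmetric])
      show "(\<lambda>G. indicator {G. dominates r r k H' \<theta> G} G :: ennreal) \<in> borel_measurable (gauss ({..<r} \<times> {..<r}))"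
        by (rule measurable_indicator_dominates) auto
    qed simp
    also have "\<dots> \<le> (\<integral>\<^sup>+G. indicator {G. dominates r r (Suc k) H 0 G} G \<partial>gauss ({..<r} \<times> {..<r}))"
    proof (rule nn_integral_mono)
      fix G :: "nat \<times> nat \<Rightarrow> complex"
      have "dominates r r (Suc k) H 0 G" if dom: "dominates r r k H' \<theta> (col_app r {..<r} W G)"
        unfolding dominates_def
      proof
        fix w :: "nat \<Rightarrow> complex"
        \<comment> \<open>The test vector in rotated coordinates, the row vector \<open>w\<close>
          times the adjoint of \<open>W\<close>; hence \<open>w'\<close> times \<open>W\<close>
          gives back \<open>w\<close>.\<close>
        define w' where "w' i = (\<Sum>l<r. w l * cnj (W $$ (i, l)))" for i
        have recover: "(\<Sum>i<r. w' i * W $$ (i, j)) = w j" if "j < r" for j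
        proof -
          have "(\<Sum>i<r. w' i * W $$ (i, j)) = (\<Sum>i<r. \<Sum>l<r. w l * (cnj (W $$ (i, l)) * W $$ (i, j)))"
            by (simp add: w'_def sum_distrib_right mult.assoc)
          also have "\<dots> = (\<Sum>l<r. w l * (\<Sum>i<r. cnj (W $$ (i, l)) * W $$ (i, j)))"
            by (subst sum.swap) (simp add: sum_distrib_left)
          also have "\<dots> = (\<Sum>l<r. if l = j then w l else 0)"
            using that by (intro sum.cong) (auto simp: gauss_unitary_cols[OF W])
          finally show ?thesis using that by simp
        qed
        have lin: "(\<Sum>i<r. w' i * (\<Sum>j<r. W $$ (i, j) * z j)) = (\<Sum>j<r. w j * z j)" for z
        proof -
          have "(\<Sum>i<r. w' i * (\<Sum>j<r. W $$ (i, j) * z j)) = (\<Sum>i<r. \<Sum>j<r. w' i * W $$ (i, j) * z j)"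
            by (simp add: sum_distrib_left mult.assoc)
          also have "\<dots> = (\<Sum>j<r. (\<Sum>i<r. w' i * W $$ (i, j)) * z j)"
            by (subst sum.swap) (simp add: sum_distrib_right)
          also have "\<dots> = (\<Sum>j<r. w j * z j)" by (intro sum.cong) (auto simp: recover)
          finally show ?thesis .
        qed
        have H: "(\<Sum>i<r. w' i * H' (i, l)) = (\<Sum>i<r. w i * H (i, l))" for l
          using lin[of "\<lambda>j. H (j, l)"] by (simp add: H'_def)
        have G: "(\<Sum>i<r. w' i * col_app r {..<r} W G (i, j)) = (\<Sum>i<r. w i * G (i, j))" if "j < r" for j
          using lin[of "\<lambda>i. G (i, j)"] that by (simp add: col_app_apply)
        have "(\<Sum>i<r. w' i * H' (i, k)) = (\<Sum>i<r. if i = 0 then w' 0 * H' (0, k) else 0)"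
          using W0 by (intro sum.cong) (auto simp: H'_def)
        then have Hk: "(\<Sum>i<r. w i * H (i, k)) = w' 0 * H' (0, k)" using H r0 by simp
        have "(\<Sum>l<k. (cmod (\<Sum>i<r. w' i * H' (i, l)))\<^sup>2) + \<theta> * (cmod (w' 0))\<^sup>2
           \<le> (\<Sum>j<r. (cmod (\<Sum>i<r. w' i * col_app r {..<r} W G (i, j)))\<^sup>2)"
          using dom unfolding dominates_def by blast
        then show "(\<Sum>l<Suc k. (cmod (\<Sum>i<r. w i * H (i, l)))\<^sup>2) + 0 * (cmod (w 0))\<^sup>2
           \<le> (\<Sum>j<r. (cmod (\<Sum>i<r. w i * G (i, j)))\<^sup>2)"
          by (simp add: H G Hk \<theta>_def norm_mult power_mult_distrib mult.commute)
      qed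
      then show "(indicator {G. dominates r r k H' \<theta> G} (col_app r {..<r} W G) :: ennreal) \<le> indicator {G. dominates r r (Suc k) H 0 G} G"
        by (auto simp: indicator_def)
    qed
    finally show ?thesis .
  qed
qed

lemma nn_integral_cgauss_exp:
  assumes "0 \<le> c"
  shows "(\<integral>\<^sup>+z. ennreal (exp (- c * (cmod z)\<^sup>2)) \<partial>cgauss) = ennreal (1 / (1 + c))"
proof -
  have "(\<integral>\<^sup>+z. ennreal (exp (- c * (cmod z)\<^sup>2)) \<partial>cgauss)
      = (\<integral>\<^sup>+r. ennreal (exponential_density 1 r) * ennreal (exp (- c * r)) \<partial>lborel)"
    by (rule nn_integral_cgauss_cmod_square) measurable
  also have "\<dots> = (\<integral>\<^sup>+r. ennreal (1 / (1 + c)) * ennreal (exponential_density (1 + c) r) \<partial>lborel)"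
  proof (rule nn_integral_cong)
    fix r :: real
    have "exponential_density 1 r * exp (- c * r) = 1 / (1 + c) * exponential_density (1 + c) r"
      using assms by (auto simp: erlang_density_def exp_add[symmetric] eq_divide_eq algebra_simps)
    then show "ennreal (exponential_density 1 r) * ennreal (exp (- c * r))
        = ennreal (1 / (1 + c)) * ennreal (exponential_density (1 + c) r)"
      using assms by (simp add: ennreal_mult[symmetric])
  qed
  also have "\<dots> = ennreal (1 / (1 + c)) * (\<integral>\<^sup>+r. ennreal (exponential_density (1 + c) r) \<partial>lborel)"
    by (rule nn_integral_cmult) measurable
  also have "(\<integral>\<^sup>+r. ennreal (exponential_density (1 + c) r) \<partial>lborel) = 1"
    using prob_space.emeasure_space_1[OF prob_space_exponential_density[of "1 + c"]] assms
    by (simp add: emeasure_density)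
  finally show ?thesis by simp
qed

text \<open>Given the last \<open>k\<close> columns, \<open>dominates_gauss\<close> yields the
  exponential of \<open>- c\<close> times their squared norm. Its mean factors over the
  \<open>r * k\<close> entries into Laplace transforms 1 / (1 + c) of the exponential law.\<close>

lemma dominates_gauss_block:
  assumes c: "0 \<le> c"
  shows "ennreal ((1 / (1 + c)) ^ (r * k))
    \<le> (\<integral>\<^sup>+G. indicator {G. dominates r r k (\<lambda>(i, l). of_real (sqrt c) * G (i, r + l)) 0 G} G \<partial>gauss ({..<r} \<times> {..<r + k}))"
proof -
  let ?I = "{..<r} \<times> {r..<r + k}" and ?J = "{..<r} \<times> {..<r}"
  define H where "H x = (\<lambda>(i, l). of_real (sqrt c) * x (i, r + l))" for x :: "nat \<times> nat \<Rightarrow> complex"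
  have un: "{..<r} \<times> {..<r + k} = ?I \<union> ?J" by auto
  have expm: "(\<lambda>z. ennreal (exp (- c * (cmod z)\<^sup>2))) \<in> borel_measurable cgauss"
    unfolding cgauss_def by simp
  have dis: "?I \<inter> ?J = {}" "finite ?I" "finite ?J" by auto
  have meas: "(\<lambda>G. indicator {G. dominates r r k (H G) 0 G} G :: ennreal) \<in> borel_measurable (gauss (?I \<union> ?J))"
    unfolding un[symmetric] by (rule measurable_indicator_dominates) (auto simp: H_def)
  have mg: "dominates r r k (H (merge ?I ?J (x, y))) 0 (merge ?I ?J (x, y)) \<longleftrightarrow> dominates r r k (H x) 0 y" for x y
    by (rule dominates_cong) (auto simp: merge_def H_def)
  have "(\<Sum>i<r. \<Sum>l<k. (cmod (H x (i, l)))\<^sup>2) = c * (\<Sum>p\<in>?I. (cmod (x p))\<^sup>2)" for x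
  proof -
    have "(\<Sum>l<k. (cmod (H x (i, l)))\<^sup>2) = c * (\<Sum>j\<in>{r..<r+k}. (cmod (x (i, j)))\<^sup>2)" for i
    proof -
      have "(\<Sum>j\<in>{r..<r+k}. (cmod (x (i, j)))\<^sup>2) = (\<Sum>l<k. (cmod (x (i, r + l)))\<^sup>2)"
        using sum.shift_bounds_nat_ivl[of "\<lambda>j. (cmod (x (i, j)))\<^sup>2" 0 r k]
        by (simp add: add.commute lessThan_atLeast0)
      then show ?thesis using c by (simp add: H_def norm_mult power_mult_distrib sum_distrib_left)
    qed
    then show ?thesis by (simp add: sum_distrib_left sum.cartesian_product)
  qed
  then have "ennreal (exp (- c * (\<Sum>p\<in>?I. (cmod (x p))\<^sup>2)))
      \<le> (\<integral>\<^sup>+y. indicator {y. dominates r r k (H x) 0 y} y \<partial>gauss ?J)" for x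
    using dominates_gauss[where r=r and k=k and H="H x"] by simp
  then have "(\<integral>\<^sup>+x. ennreal (exp (- c * (\<Sum>p\<in>?I. (cmod (x p))\<^sup>2))) \<partial>gauss ?I)
      \<le> (\<integral>\<^sup>+x. \<integral>\<^sup>+y. indicator {y. dominates r r k (H x) 0 y} y \<partial>gauss ?J \<partial>gauss ?I)"
    by (intro nn_integral_mono)
  also have "\<dots> = (\<integral>\<^sup>+G. indicator {G. dominates r r k (H G) 0 G} G \<partial>gauss ({..<r} \<times> {..<r + k}))"
    unfolding un by (subst cgauss_PiM.product_nn_integral_fold[OF dis meas])
      (intro nn_integral_cong, simp add: indicator_def mg)
  also have "(\<integral>\<^sup>+x. ennreal (exp (- c * (\<Sum>p\<in>?I. (cmod (x p))\<^sup>2))) \<partial>gauss ?I)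
      = (\<integral>\<^sup>+x. (\<Prod>p\<in>?I. ennreal (exp (- c * (cmod (x p))\<^sup>2))) \<partial>gauss ?I)"
    by (simp add: prod_ennreal exp_sum[symmetric] sum_negf sum_distrib_left)
  also have "\<dots> = (\<Prod>p\<in>?I. \<integral>\<^sup>+z. ennreal (exp (- c * (cmod z)\<^sup>2)) \<partial>cgauss)"
    by (rule cgauss_PiM.product_nn_integral_prod[where f="\<lambda>_ z. ennreal (exp (- c * (cmod z)\<^sup>2))"]) (simp, rule expm)
  also have "\<dots> = ennreal ((1 / (1 + c)) ^ (r * k))"
    unfolding nn_integral_cgauss_exp[OF c] using c by (simp add: ennreal_power)
  finally show ?thesis by (simp add: H_def)
qed

subsection \<open>The smallest singular value\<close>

lemma nn_integral_cgauss_uminus: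
  fixes f :: "complex \<Rightarrow> ennreal"
  assumes "f \<in> borel_measurable borel"
  shows "(\<integral>\<^sup>+z. f (- z) \<partial>cgauss) = (\<integral>\<^sup>+z. f z \<partial>cgauss)"
  using nn_integral_cgauss_phase[OF assms, of "-1"] by simp

lemma exp_add_exp_uminus_mono:
  fixes a b u :: real
  assumes "0 \<le> a" "a \<le> b"
  shows "exp (a * u) + exp (- (a * u)) \<le> exp (b * u) + exp (- (b * u))"
proof -
  have "cosh (a * u) \<le> cosh (b * u)"
  proof -
    have "cosh \<bar>a * u\<bar> \<le> cosh \<bar>b * u\<bar>"
      using assms by (subst cosh_real_nonneg_le_iff) (auto simp: abs_mult intro!: mult_right_mono)
    then show ?thesis by simp
  qed
  then show ?thesis by (simp add: cosh_field_def)
qed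

text \<open>The mean of exp (2 Re (\<kappa> z)) over the circle |z|^2 = r, that is, the modified
  Bessel function I_0 at 2 |\<kappa>| sqrt r.\<close>

definition angular_mean :: "complex \<Rightarrow> real \<Rightarrow> ennreal" where
  "angular_mean \<kappa> r = (\<integral>\<^sup>+w. ennreal (exp (sqrt r * (2 * Re (\<kappa> * sgn w)))) \<partial>cgauss)"

lemma measurable_angular_mean [measurable]: "angular_mean \<kappa> \<in> borel_measurable borel"
  unfolding angular_mean_def by measurable

text \<open>Averaging over \<open>w\<close> and \<open>- w\<close> replaces the exponential by a
  hyperbolic cosine, which grows with the absolute value of its argument.\<close>

lemma angular_mean_mono:
  assumes "0 \<le> r" "r \<le> s"
  shows "angular_mean \<kappa> r \<le> angular_mean \<kappa> s"
proof -
  define F where "F a w = ennreal (exp (a * (2 * Re (\<kappa> * sgn w))))" for a :: real and w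
  have [measurable]: "F a \<in> borel_measurable borel" for a unfolding F_def by measurable
  have e: "2 * (\<integral>\<^sup>+w. F a w \<partial>cgauss) = (\<integral>\<^sup>+w. ennreal (exp (a * (2 * Re (\<kappa> * sgn w))) + exp (- (a * (2 * Re (\<kappa> * sgn w))))) \<partial>cgauss)" for a
  proof -
    have "2 * (\<integral>\<^sup>+w. F a w \<partial>cgauss) = (\<integral>\<^sup>+w. F a w \<partial>cgauss) + (\<integral>\<^sup>+w. F a (- w) \<partial>cgauss)"
      by (subst nn_integral_cgauss_uminus) (auto simp: mult_2)
    also have "\<dots> = (\<integral>\<^sup>+w. F a w + F a (- w) \<partial>cgauss)"
      by (rule nn_integral_add[symmetric]) (simp_all add: measurable_cong_sets[OF sets_cgauss refl])
    also have "\<dots> = (\<integral>\<^sup>+w. ennreal (exp (a * (2 * Re (\<kappa> * sgn w))) + exp (- (a * (2 * Re (\<kappa> * sgn w))))) \<partial>cgauss)"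
      by (intro nn_integral_cong) (simp add: F_def sgn_minus algebra_simps)
    finally show ?thesis .
  qed
  have "2 * (\<integral>\<^sup>+w. F (sqrt r) w \<partial>cgauss) \<le> 2 * (\<integral>\<^sup>+w. F (sqrt s) w \<partial>cgauss)"
    unfolding e using assms by (intro nn_integral_mono ennreal_leI exp_add_exp_uminus_mono) auto
  then have "(\<integral>\<^sup>+w. F (sqrt r) w \<partial>cgauss) \<le> (\<integral>\<^sup>+w. F (sqrt s) w \<partial>cgauss)"
    by (subst (asm) ennreal_mult_le_mult_iff) auto
  then show ?thesis by (simp add: F_def angular_mean_def)
qed

text \<open>In polar form the factor exp (|z|^2) cancels the exponential density, so |z|^2 is left
  with Lebesgue measure on the half-line. This is the purpose of that factor: a shift of
  \<open>r\<close> becomes a translation.\<close>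

lemma nn_integral_cgauss_angular_mean:
  assumes [measurable]: "g \<in> borel_measurable borel"
  shows "(\<integral>\<^sup>+z. g ((cmod z)\<^sup>2) * ennreal (exp ((cmod z)\<^sup>2)) * ennreal (exp (d * (cmod z)\<^sup>2 + 2 * Re (\<kappa> * z))) \<partial>cgauss)
    = (\<integral>\<^sup>+r. indicator {0..} r * (g r * (ennreal (exp (d * r)) * angular_mean \<kappa> r)) \<partial>lborel)"
proof -
  define f where "f z = g ((cmod z)\<^sup>2) * ennreal (exp ((cmod z)\<^sup>2)) * ennreal (exp (d * (cmod z)\<^sup>2 + 2 * Re (\<kappa> * z)))" for z
  have [measurable]: "f \<in> borel_measurable borel" unfolding f_def by measurable
  have nz: "AE w in cgauss. w \<noteq> (0::complex)"
    unfolding cgauss_def by (subst AE_density) (auto intro: AE_lborel_singleton)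
  have "(\<integral>\<^sup>+z. f z \<partial>cgauss)
    = (\<integral>\<^sup>+r. ennreal (exponential_density 1 r) * (\<integral>\<^sup>+w. f (of_real (sqrt r) * sgn w) \<partial>cgauss) \<partial>lborel)"
    by (rule nn_integral_cgauss_polar) measurable
  also have "\<dots> = (\<integral>\<^sup>+r. indicator {0..} r * (g r * (ennreal (exp (d * r)) * angular_mean \<kappa> r)) \<partial>lborel)"
  proof (rule nn_integral_cong)
    fix r :: real
    show "ennreal (exponential_density 1 r) * (\<integral>\<^sup>+w. f (of_real (sqrt r) * sgn w) \<partial>cgauss)
      = indicator {0..} r * (g r * (ennreal (exp (d * r)) * angular_mean \<kappa> r))"
    proof (cases "0 \<le> r")
      case True
      have "(\<integral>\<^sup>+w. f (of_real (sqrt r) * sgn w) \<partial>cgauss)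
         = (\<integral>\<^sup>+w. (g r * ennreal (exp r) * ennreal (exp (d * r))) * ennreal (exp (sqrt r * (2 * Re (\<kappa> * sgn w)))) \<partial>cgauss)"
      proof (rule nn_integral_cong_AE, use nz in eventually_elim)
        fix w :: complex assume w: "w \<noteq> 0"
        have n: "(cmod (of_real (sqrt r) * sgn w))\<^sup>2 = r"
          using w True by (simp add: norm_mult norm_sgn)
        have re: "Re (\<kappa> * (of_real (sqrt r) * sgn w)) = sqrt r * Re (\<kappa> * sgn w)"
          by (simp add: algebra_simps)
        show "f (of_real (sqrt r) * sgn w)
          = g r * ennreal (exp r) * ennreal (exp (d * r)) * ennreal (exp (sqrt r * (2 * Re (\<kappa> * sgn w))))"
          unfolding f_def n re by (simp add: exp_add ennreal_mult mult.assoc mult.left_commute)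
      qed
      also have "\<dots> = (g r * ennreal (exp r) * ennreal (exp (d * r))) * angular_mean \<kappa> r"
        unfolding angular_mean_def by (rule nn_integral_cmult) (simp add: measurable_cong_sets[OF sets_cgauss refl])
      finally have *: "(\<integral>\<^sup>+w. f (of_real (sqrt r) * sgn w) \<partial>cgauss) = ennreal (exp r) * (g r * (ennreal (exp (d * r)) * angular_mean \<kappa> r))"
        by (simp add: mult_ac)
      have "ennreal (exponential_density 1 r) * ennreal (exp r) = 1"
        using True by (simp add: erlang_density_def ennreal_mult[symmetric] exp_add[symmetric])
      then show ?thesis unfolding * mult.assoc[symmetric] using True by simp
    qed (simp add: erlang_density_def)
  qed
  finally show ?thesis by (simp add: f_def)
qed

text \<open>After the reduction to a flat measure in r = |z|^2, translation by \<delta> moves mass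
  to points where both exp (d r), with \<open>d\<close> nonnegative, and the angular mean are
  larger.\<close>

lemma nn_integral_cgauss_radial_shift:
  assumes [measurable]: "\<eta> \<in> borel_measurable borel" and d: "0 \<le> d" and \<delta>: "0 \<le> \<delta>"
  shows "(\<integral>\<^sup>+z. \<eta> ((cmod z)\<^sup>2) * ennreal (exp ((cmod z)\<^sup>2)) * ennreal (exp (d * (cmod z)\<^sup>2 + 2 * Re (\<kappa> * z))) \<partial>cgauss)
    \<le> (\<integral>\<^sup>+z. \<eta> ((cmod z)\<^sup>2 - \<delta>) * ennreal (exp ((cmod z)\<^sup>2)) * ennreal (exp (d * (cmod z)\<^sup>2 + 2 * Re (\<kappa> * z))) \<partial>cgauss)"
proof -
  let ?\<Psi> = "\<lambda>r. ennreal (exp (d * r)) * angular_mean \<kappa> r"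
  have mono: "?\<Psi> r \<le> ?\<Psi> (\<delta> + r)" if "0 \<le> r" for r
    using that d \<delta> by (intro mult_mono ennreal_leI angular_mean_mono) (auto intro: mult_left_mono)
  have "(\<integral>\<^sup>+r. indicator {0..} r * (\<eta> r * ?\<Psi> r) \<partial>lborel) \<le> (\<integral>\<^sup>+r. indicator {0..} r * (\<eta> r * ?\<Psi> (\<delta> + r)) \<partial>lborel)"
    using mono by (intro nn_integral_mono) (auto simp: indicator_def intro!: mult_left_mono)
  also have "\<dots> = (\<integral>\<^sup>+r. indicator {0..} (r - \<delta>) * (\<eta> (r - \<delta>) * ?\<Psi> r) \<partial>lborel)"
    using nn_integral_real_affine[of "\<lambda>r. indicator {0..} (r - \<delta>) * (\<eta> (r - \<delta>) * ?\<Psi> r)" 1 \<delta>] by simp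
  also have "\<dots> \<le> (\<integral>\<^sup>+r. indicator {0..} r * (\<eta> (r - \<delta>) * ?\<Psi> r) \<partial>lborel)"
    using \<delta> by (intro nn_integral_mono) (auto simp: indicator_def)
  finally show ?thesis
    using nn_integral_cgauss_angular_mean[of \<eta> d \<kappa>] nn_integral_cgauss_angular_mean[of "\<lambda>r. \<eta> (r - \<delta>)" d \<kappa>] by simp
qed

section \<open>Contraction of some vector by a rectangular Gaussian matrix\<close>

definition sqnorm :: "nat \<Rightarrow> (nat \<Rightarrow> complex) \<Rightarrow> real" where
  "sqnorm n v = (\<Sum>j<n. (cmod (v j))\<^sup>2)"

definition apply_mat :: "nat \<Rightarrow> (nat \<times> nat \<Rightarrow> complex) \<Rightarrow> (nat \<Rightarrow> complex) \<Rightarrow> nat \<Rightarrow> complex" where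
  "apply_mat n G v i = (\<Sum>j<n. G (i, j) * v j)"

lemma sqnorm_nonneg [simp]: "0 \<le> sqnorm n v"
  by (auto simp: sqnorm_def intro!: sum_nonneg)

text \<open>For positive \<open>n\<close>, the event that the least eigenvalue of
  \<open>G\<^sup>* G\<close> lies below \<open>t\<close>. The strict inequality for some
  \<open>v\<close> makes the complement a family of nonnegativity conditions.\<close>

definition contracts :: "nat \<Rightarrow> nat \<Rightarrow> real \<Rightarrow> (nat \<times> nat \<Rightarrow> complex) \<Rightarrow> bool" where
  "contracts m n t G \<longleftrightarrow> (\<exists>v. sqnorm m (apply_mat n G v) < t * sqnorm n v)"

text \<open>A random vector is stored as a matrix with the single row 0, so that
  \<open>row_app\<close> and its invariance apply to it.\<close>

abbreviation vec0 :: "(nat \<times> nat \<Rightarrow> complex) \<Rightarrow> nat \<Rightarrow> complex" where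
  "vec0 z \<equiv> \<lambda>j. z (0, j)"

lemma insert_last_row: "{0::nat} \<times> {..<Suc n} = insert (0, n) ({0} \<times> {..<n})"
  by auto

lemma measurable_sqnorm_vec0 [measurable]: "(\<lambda>z. sqnorm n (vec0 z)) \<in> borel_measurable (gauss ({0} \<times> {..<n}))"
  unfolding sqnorm_def
  by (intro borel_measurable_sum borel_measurable_power borel_measurable_norm measurable_gauss_component) auto

text \<open>The squared norm is a sum of \<open>n + 1\<close> independent exponentials of rate 1;
  the induction step is the convolution of Erlang densities.\<close>

lemma nn_integral_gauss_sqnorm:
  assumes [measurable]: "\<phi> \<in> borel_measurable borel"
  shows "(\<integral>\<^sup>+z. \<phi> (sqnorm (Suc n) (vec0 z)) \<partial>gauss ({0} \<times> {..<Suc n}))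
    = (\<integral>\<^sup>+r. ennreal (erlang_density n 1 r) * \<phi> r \<partial>lborel)"
  using assms
proof (induction n arbitrary: \<phi>)
  case 0
  note [measurable] = 0
  have I: "{0::nat} \<times> {..<Suc 0} = {(0, 0)}" by auto
  have "(\<integral>\<^sup>+z. \<phi> ((cmod (z (0, 0)))\<^sup>2) \<partial>gauss {(0, 0)}) = (\<integral>\<^sup>+z. \<phi> ((cmod z)\<^sup>2) \<partial>cgauss)"
    by (rule cgauss_PiM.product_nn_integral_singleton) (simp add: measurable_cong_sets[OF sets_cgauss refl])
  then show ?case unfolding I by (simp add: sqnorm_def nn_integral_cgauss_cmod_square)
next
  case (Suc n)
  note [measurable] = Suc.prems
  have fin: "finite ({0::nat} \<times> {..<Suc n})" "(0, Suc n) \<notin> {0::nat} \<times> {..<Suc n}" by auto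
  have m: "(\<lambda>z. \<phi> (sqnorm (Suc (Suc n)) (vec0 z))) \<in> borel_measurable (gauss (insert (0, Suc n) ({0} \<times> {..<Suc n})))"
    unfolding insert_last_row[symmetric] by measurable
  have s: "sqnorm (Suc (Suc n)) (vec0 (z((0, Suc n) := h))) = sqnorm (Suc n) (vec0 z) + (cmod h)\<^sup>2" for z h
    by (simp add: sqnorm_def)
  have "(\<integral>\<^sup>+z. \<phi> (sqnorm (Suc (Suc n)) (vec0 z)) \<partial>gauss ({0} \<times> {..<Suc (Suc n)}))
     = (\<integral>\<^sup>+z. \<integral>\<^sup>+h. \<phi> (sqnorm (Suc n) (vec0 z) + (cmod h)\<^sup>2) \<partial>cgauss \<partial>gauss ({0} \<times> {..<Suc n}))"
    unfolding insert_last_row[of "Suc n"] cgauss_PiM.product_nn_integral_insert[OF fin m] s ..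
  also have "\<dots> = (\<integral>\<^sup>+z. (\<integral>\<^sup>+u. ennreal (exponential_density 1 u) * \<phi> (sqnorm (Suc n) (vec0 z) + u) \<partial>lborel) \<partial>gauss ({0} \<times> {..<Suc n}))"
    by (intro nn_integral_cong nn_integral_cgauss_cmod_square[of "\<lambda>u. \<phi> (_ + u)"]) measurable
  also have "\<dots> = (\<integral>\<^sup>+r. ennreal (erlang_density n 1 r) * (\<integral>\<^sup>+u. ennreal (exponential_density 1 u) * \<phi> (r + u) \<partial>lborel) \<partial>lborel)"
    by (rule Suc.IH) measurable
  also have "\<dots> = (\<integral>\<^sup>+r. ennreal (erlang_density n 1 r) * (\<integral>\<^sup>+u. ennreal (exponential_density 1 (u - r)) * \<phi> u \<partial>lborel) \<partial>lborel)"
  proof (rule nn_integral_cong)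
    fix r :: real
    have "(\<integral>\<^sup>+u. ennreal (exponential_density 1 u) * \<phi> (r + u) \<partial>lborel) = (\<integral>\<^sup>+u. ennreal (exponential_density 1 (u - r)) * \<phi> u \<partial>lborel)"
      using nn_integral_real_affine[of "\<lambda>u. ennreal (exponential_density 1 (u - r)) * \<phi> u" 1 r] by simp
    then show "ennreal (erlang_density n 1 r) * (\<integral>\<^sup>+u. ennreal (exponential_density 1 u) * \<phi> (r + u) \<partial>lborel)
      = ennreal (erlang_density n 1 r) * (\<integral>\<^sup>+u. ennreal (exponential_density 1 (u - r)) * \<phi> u \<partial>lborel)"
      by (simp only:)
  qed
  also have "\<dots> = (\<integral>\<^sup>+r. \<integral>\<^sup>+u. ennreal (exponential_density 1 (u - r)) * ennreal (erlang_density n 1 r) * \<phi> u \<partial>lborel \<partial>lborel)"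
    by (intro nn_integral_cong) (simp add: nn_integral_cmult[symmetric] mult_ac)
  also have "\<dots> = (\<integral>\<^sup>+u. \<integral>\<^sup>+r. ennreal (exponential_density 1 (u - r)) * ennreal (erlang_density n 1 r) * \<phi> u \<partial>lborel \<partial>lborel)"
    by (rule lborel_pair.Fubini') measurable
  also have "\<dots> = (\<integral>\<^sup>+u. (\<integral>\<^sup>+r. ennreal (exponential_density 1 (u - r)) * ennreal (erlang_density n 1 r) \<partial>lborel) * \<phi> u \<partial>lborel)"
    by (rule nn_integral_cong, rule nn_integral_multc) measurable
  also have "\<dots> = (\<integral>\<^sup>+u. ennreal (erlang_density (Suc n) 1 u) * \<phi> u \<partial>lborel)"
    using convolution_erlang_density[of 1 0 n, THEN fun_cong] by (intro nn_integral_cong) simp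
  finally show ?case .
qed

lemma measurable_apply_mat_vec0 [measurable]:
  "(\<lambda>z. sqnorm m (apply_mat n G (vec0 z))) \<in> borel_measurable (gauss ({0} \<times> {..<n}))"
  unfolding sqnorm_def apply_mat_def
  by (intro borel_measurable_sum borel_measurable_power borel_measurable_norm borel_measurable_times
      measurable_gauss_component) auto

lemma cmod_square_add: "(cmod (a + b))\<^sup>2 = (cmod a)\<^sup>2 + 2 * Re (a * cnj b) + (cmod b)\<^sup>2"
  unfolding cmod_power2 by (simp add: power2_eq_square algebra_simps)

text \<open>Along a direction in which \<open>t |z|\<^sup>2 - |G z|\<^sup>2\<close> is nonnegative, mass may be moved outwards.\<close>

lemma nn_integral_radial_shift_le:
  assumes [measurable]: "\<eta> \<in> borel_measurable borel" and \<delta>: "0 \<le> \<delta>"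
    and c: "contracts m (Suc n) t G"
  shows "(\<integral>\<^sup>+z. \<eta> (sqnorm (Suc n) (vec0 z)) * ennreal (exp (sqnorm (Suc n) (vec0 z))) *
        ennreal (exp (t * sqnorm (Suc n) (vec0 z) - sqnorm m (apply_mat (Suc n) G (vec0 z)))) \<partial>gauss ({0} \<times> {..<Suc n}))
    \<le> (\<integral>\<^sup>+z. \<eta> (sqnorm (Suc n) (vec0 z) - \<delta>) * ennreal (exp (sqnorm (Suc n) (vec0 z))) *
        ennreal (exp (t * sqnorm (Suc n) (vec0 z) - sqnorm m (apply_mat (Suc n) G (vec0 z)))) \<partial>gauss ({0} \<times> {..<Suc n}))"
proof -
  obtain v where v: "sqnorm m (apply_mat (Suc n) G v) < t * sqnorm (Suc n) v"
    using c by (auto simp: contracts_def)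
  \<comment> \<open>The contracted direction \<open>v\<close> is turned into the last coordinate
    axis, so that moving along it concerns a single Gaussian coordinate.\<close>
  obtain W where W: "gauss_unitary (Suc n) W"
    and W0: "\<And>i. i < Suc n \<Longrightarrow> i \<noteq> n \<Longrightarrow> (\<Sum>j<Suc n. W $$ (i, j) * v j) = 0"
    using gauss_unitary_align[of n "Suc n" v] by auto
  define \<mu> where "\<mu> = (\<Sum>j<Suc n. W $$ (n, j) * v j)"
  have Wc: "W \<in> carrier_mat (Suc n) (Suc n)" using W by (rule gauss_unitary_carrier)
  have vj: "v j = cnj (W $$ (n, j)) * \<mu>" if "j < Suc n" for j
  proof -
    have "v j = (\<Sum>i<Suc n. cnj (W $$ (i, j)) * (\<Sum>l<Suc n. W $$ (i, l) * v l))"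
      by (rule gauss_unitary_inverse(1)[OF W that, symmetric])
    also have "\<dots> = (\<Sum>i<Suc n. if i = n then cnj (W $$ (n, j)) * \<mu> else 0)"
      using W0 by (intro sum.cong) (auto simp: \<mu>_def)
    finally show ?thesis by simp
  qed
  have v\<mu>: "sqnorm (Suc n) v = (cmod \<mu>)\<^sup>2"
  proof -
    have "sqnorm (Suc n) v = (\<Sum>i<Suc n. (cmod (\<Sum>j<Suc n. W $$ (i, j) * v j))\<^sup>2)"
      unfolding sqnorm_def by (rule gauss_unitary_norm[OF W, symmetric])
    also have "\<dots> = (\<Sum>i<Suc n. if i = n then (cmod \<mu>)\<^sup>2 else 0)"
      using W0 by (intro sum.cong) (auto simp: \<mu>_def)
    finally show ?thesis by simp
  qed
  define U where "U = mat_adjoint W"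
  have U: "gauss_unitary (Suc n) U" unfolding U_def by (rule gauss_unitary_adjoint[OF W])
  define G' where "G' = (\<lambda>(i, l). \<Sum>j<Suc n. G (i, j) * U $$ (j, l))"
  have nz: "sqnorm (Suc n) (vec0 (row_app {0} (Suc n) U z)) = sqnorm (Suc n) (vec0 z)" for z
    using gauss_unitary_norm[OF U, of "vec0 z"] by (simp add: sqnorm_def del: sum.lessThan_Suc)
  have Gz: "apply_mat (Suc n) G (vec0 (row_app {0} (Suc n) U z)) i = apply_mat (Suc n) G' (vec0 z) i" for z i
  proof -
    have "apply_mat (Suc n) G (vec0 (row_app {0} (Suc n) U z)) i = (\<Sum>j<Suc n. \<Sum>l<Suc n. G (i, j) * U $$ (j, l) * z (0, l))"
      unfolding apply_mat_def by (intro sum.cong refl) (simp add: sum_distrib_left mult.assoc del: sum.lessThan_Suc)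
    also have "\<dots> = (\<Sum>l<Suc n. \<Sum>j<Suc n. G (i, j) * U $$ (j, l) * z (0, l))"
      by (rule sum.swap)
    finally show ?thesis by (simp add: apply_mat_def G'_def sum_distrib_right del: sum.lessThan_Suc)
  qed
  \<comment> \<open>The coefficient of |h|^2 in t |z|^2 - |G' z|^2, where \<open>h\<close> is the
    last coordinate of \<open>z\<close>. It is nonnegative because that axis is the contracted
    direction.\<close>
  define d where "d = t - (\<Sum>i<m. (cmod (G' (i, n)))\<^sup>2)"
  have "0 \<le> d"
  proof -
    have "apply_mat (Suc n) G v i = G' (i, n) * \<mu>" for i
      using Wc vj by (auto simp: apply_mat_def G'_def U_def sum_distrib_right mult.assoc simp del: sum.lessThan_Suc intro!: sum.cong)
    then have "sqnorm m (apply_mat (Suc n) G v) = (\<Sum>i<m. (cmod (G' (i, n)))\<^sup>2) * (cmod \<mu>)\<^sup>2"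
      by (simp add: sqnorm_def norm_mult power_mult_distrib sum_distrib_right)
    with v have "0 < d * (cmod \<mu>)\<^sup>2" unfolding v\<mu> d_def by (simp add: algebra_simps)
    then show ?thesis by (simp add: zero_less_mult_iff not_less)
  qed
  have fin: "finite ({0::nat} \<times> {..<n})" "(0, n) \<notin> {0::nat} \<times> {..<n}" by auto
  \<comment> \<open>The cross term and the constant term of the same quadratic form in
    \<open>h\<close>, for fixed other coordinates \<open>x\<close>.\<close>
  define \<kappa> where "\<kappa> x = - (\<Sum>i<m. G' (i, n) * cnj (apply_mat n G' (vec0 x) i))" for x
  define c0 where "c0 x = t * sqnorm n (vec0 x) - sqnorm m (apply_mat n G' (vec0 x))" for x
  have quad: "t * sqnorm (Suc n) (vec0 (x((0, n) := h))) - sqnorm m (apply_mat (Suc n) G' (vec0 (x((0, n) := h))))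
      = d * (cmod h)\<^sup>2 + 2 * Re (\<kappa> x * h) + c0 x" for x h
  proof -
    have "apply_mat (Suc n) G' (vec0 (x((0, n) := h))) i = G' (i, n) * h + apply_mat n G' (vec0 x) i" for i
      by (simp add: apply_mat_def)
    then have "sqnorm m (apply_mat (Suc n) G' (vec0 (x((0, n) := h))))
      = (\<Sum>i<m. (cmod (G' (i, n)))\<^sup>2 * (cmod h)\<^sup>2 + 2 * Re (h * (G' (i, n) * cnj (apply_mat n G' (vec0 x) i)))
          + (cmod (apply_mat n G' (vec0 x) i))\<^sup>2)"
      unfolding sqnorm_def by (simp add: cmod_square_add norm_mult power_mult_distrib mult_ac)
    also have "\<dots> = (\<Sum>i<m. (cmod (G' (i, n)))\<^sup>2) * (cmod h)\<^sup>2 - 2 * Re (\<kappa> x * h) + sqnorm m (apply_mat n G' (vec0 x))"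
      by (simp only: sum.distrib sum_distrib_right[symmetric] sum_distrib_left[symmetric] Re_sum[symmetric] \<kappa>_def sqnorm_def)
         (simp add: mult.commute)
    finally show ?thesis by (simp add: d_def c0_def sqnorm_def algebra_simps)
  qed
  define F where "F \<zeta> z = \<zeta> (sqnorm (Suc n) (vec0 z)) * ennreal (exp (sqnorm (Suc n) (vec0 z))) *
        ennreal (exp (t * sqnorm (Suc n) (vec0 z) - sqnorm m (apply_mat (Suc n) G' (vec0 z))))" for \<zeta> :: "real \<Rightarrow> ennreal" and z
  have Fm: "F \<zeta> \<in> borel_measurable (gauss ({0} \<times> {..<Suc n}))" if [measurable]: "\<zeta> \<in> borel_measurable borel" for \<zeta>
    unfolding F_def by measurable
  have red: "(\<integral>\<^sup>+z. \<zeta> (sqnorm (Suc n) (vec0 z)) * ennreal (exp (sqnorm (Suc n) (vec0 z))) *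
        ennreal (exp (t * sqnorm (Suc n) (vec0 z) - sqnorm m (apply_mat (Suc n) G (vec0 z)))) \<partial>gauss ({0} \<times> {..<Suc n}))
     = (\<integral>\<^sup>+x. ennreal (exp (sqnorm n (vec0 x) + c0 x)) *
          (\<integral>\<^sup>+h. \<zeta> ((cmod h)\<^sup>2 + sqnorm n (vec0 x)) * ennreal (exp ((cmod h)\<^sup>2)) * ennreal (exp (d * (cmod h)\<^sup>2 + 2 * Re (\<kappa> x * h))) \<partial>cgauss)
        \<partial>gauss ({0} \<times> {..<n}))"
    if \<zeta>[measurable]: "\<zeta> \<in> borel_measurable borel" for \<zeta>
  proof -
    have m: "(\<lambda>z. \<zeta> (sqnorm (Suc n) (vec0 z)) * ennreal (exp (sqnorm (Suc n) (vec0 z))) *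
        ennreal (exp (t * sqnorm (Suc n) (vec0 z) - sqnorm m (apply_mat (Suc n) G (vec0 z))))) \<in> borel_measurable (gauss ({0} \<times> {..<Suc n}))"
      by measurable
    have "sqnorm m (apply_mat (Suc n) G (vec0 (row_app {0} (Suc n) U z))) = sqnorm m (apply_mat (Suc n) G' (vec0 z))" for z
      unfolding sqnorm_def Gz ..
    then have "(\<integral>\<^sup>+z. \<zeta> (sqnorm (Suc n) (vec0 z)) * ennreal (exp (sqnorm (Suc n) (vec0 z))) *
        ennreal (exp (t * sqnorm (Suc n) (vec0 z) - sqnorm m (apply_mat (Suc n) G (vec0 z)))) \<partial>gauss ({0} \<times> {..<Suc n}))
      = (\<integral>\<^sup>+z. F \<zeta> z \<partial>gauss ({0} \<times> {..<Suc n}))"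
      using nn_integral_row_app[OF U _ m] by (simp add: nz F_def)
    also have "\<dots> = (\<integral>\<^sup>+x. \<integral>\<^sup>+h. F \<zeta> (x((0, n) := h)) \<partial>cgauss \<partial>gauss ({0} \<times> {..<n}))"
      unfolding insert_last_row
      by (rule cgauss_PiM.product_nn_integral_insert[OF fin Fm[OF \<zeta>, unfolded insert_last_row]])
    also have "\<dots> = (\<integral>\<^sup>+x. ennreal (exp (sqnorm n (vec0 x) + c0 x)) *
          (\<integral>\<^sup>+h. \<zeta> ((cmod h)\<^sup>2 + sqnorm n (vec0 x)) * ennreal (exp ((cmod h)\<^sup>2)) * ennreal (exp (d * (cmod h)\<^sup>2 + 2 * Re (\<kappa> x * h))) \<partial>cgauss)
        \<partial>gauss ({0} \<times> {..<n}))"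
    proof (rule nn_integral_cong)
      fix x :: "nat \<times> nat \<Rightarrow> complex"
      have Fx: "F \<zeta> (x((0, n) := h)) = ennreal (exp (sqnorm n (vec0 x) + c0 x)) *
          (\<zeta> ((cmod h)\<^sup>2 + sqnorm n (vec0 x)) * ennreal (exp ((cmod h)\<^sup>2)) * ennreal (exp (d * (cmod h)\<^sup>2 + 2 * Re (\<kappa> x * h))))" for h
      proof -
        have s: "sqnorm (Suc n) (vec0 (x((0, n) := h))) = (cmod h)\<^sup>2 + sqnorm n (vec0 x)"
          by (simp add: sqnorm_def)
        show ?thesis
          unfolding F_def quad unfolding s
          by (simp add: exp_add ennreal_mult mult_ac)
      qed
      have "(\<lambda>h. \<zeta> ((cmod h)\<^sup>2 + sqnorm n (vec0 x)) * ennreal (exp ((cmod h)\<^sup>2)) * ennreal (exp (d * (cmod h)\<^sup>2 + 2 * Re (\<kappa> x * h)))) \<in> borel_measurable borel"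
        by measurable
      then show "(\<integral>\<^sup>+h. F \<zeta> (x((0, n) := h)) \<partial>cgauss) = ennreal (exp (sqnorm n (vec0 x) + c0 x)) *
          (\<integral>\<^sup>+h. \<zeta> ((cmod h)\<^sup>2 + sqnorm n (vec0 x)) * ennreal (exp ((cmod h)\<^sup>2)) * ennreal (exp (d * (cmod h)\<^sup>2 + 2 * Re (\<kappa> x * h))) \<partial>cgauss)"
        unfolding Fx by (intro nn_integral_cmult) (simp add: measurable_cong_sets[OF sets_cgauss refl])
    qed
    finally show ?thesis .
  qed
  have e2: "(\<lambda>r. \<eta> (r - \<delta>)) \<in> borel_measurable borel" by measurable
  show ?thesis
    unfolding red[OF assms(1)] red[OF e2]
  proof (rule nn_integral_mono, rule mult_left_mono)
    fix x :: "nat \<times> nat \<Rightarrow> complex"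
    \<comment> \<open>With \<open>x\<close> fixed, |z|^2 is |h|^2 plus a constant, so shifting the
      argument of \<eta> by \<delta> is a shift of |h|^2 alone.\<close>
    have [measurable]: "(\<lambda>r. \<eta> (r + sqnorm n (vec0 x))) \<in> borel_measurable borel" by measurable
    show "(\<integral>\<^sup>+h. \<eta> ((cmod h)\<^sup>2 + sqnorm n (vec0 x)) * ennreal (exp ((cmod h)\<^sup>2)) * ennreal (exp (d * (cmod h)\<^sup>2 + 2 * Re (\<kappa> x * h))) \<partial>cgauss)
      \<le> (\<integral>\<^sup>+h. \<eta> ((cmod h)\<^sup>2 + sqnorm n (vec0 x) - \<delta>) * ennreal (exp ((cmod h)\<^sup>2)) * ennreal (exp (d * (cmod h)\<^sup>2 + 2 * Re (\<kappa> x * h))) \<partial>cgauss)"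
      using nn_integral_cgauss_radial_shift[of "\<lambda>r. \<eta> (r + sqnorm n (vec0 x))" d \<delta> "\<kappa> x"] \<open>0 \<le> d\<close> \<delta>
      by (simp add: algebra_simps)
  qed simp
qed

text \<open>Once \<open>z\<close> is turned to the last axis, |G z|^2 is \<rho> times the squared
  norm of the last column. The rotation stays visible in the argument of \<open>f\<close>, so that
  rotation-invariant events can be inserted there.\<close>

lemma nn_integral_gauss_rotate_column:
  assumes z: "\<rho> = sqnorm (Suc n) z"
  shows "\<exists>V. gauss_unitary (Suc n) V \<and> (\<forall>f\<in>borel_measurable (gauss ({..<m} \<times> {..<Suc n})).
    (\<integral>\<^sup>+G. ennreal (exp (- sqnorm m (apply_mat (Suc n) G z))) * f (row_app {..<m} (Suc n) V G) \<partial>gauss ({..<m} \<times> {..<Suc n}))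
    = (\<integral>\<^sup>+G. ennreal (exp (- \<rho> * (\<Sum>i<m. (cmod (G (i, n)))\<^sup>2))) * f G \<partial>gauss ({..<m} \<times> {..<Suc n})))"
proof -
  \<comment> \<open>The conjugate of \<open>z\<close> is aligned because \<open>row_app\<close>
    multiplies by the transpose of \<open>V\<close>.\<close>
  obtain V where V: "gauss_unitary (Suc n) V"
    and V0: "\<And>i. i < Suc n \<Longrightarrow> i \<noteq> n \<Longrightarrow> (\<Sum>j<Suc n. V $$ (i, j) * cnj (z j)) = 0"
    using gauss_unitary_align[of n "Suc n" "\<lambda>j. cnj (z j)"] by auto
  define \<mu> where "\<mu> = (\<Sum>j<Suc n. V $$ (n, j) * cnj (z j))"
  have zj: "z j = V $$ (n, j) * cnj \<mu>" if "j < Suc n" for j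
  proof -
    have "cnj (z j) = (\<Sum>i<Suc n. cnj (V $$ (i, j)) * (\<Sum>l<Suc n. V $$ (i, l) * cnj (z l)))"
      by (rule gauss_unitary_inverse(1)[OF V that, symmetric])
    also have "\<dots> = (\<Sum>i<Suc n. if i = n then cnj (V $$ (n, j)) * \<mu> else 0)"
      using V0 by (intro sum.cong) (auto simp: \<mu>_def)
    finally have "cnj (z j) = cnj (V $$ (n, j)) * \<mu>" by simp
    then have "cnj (cnj (z j)) = cnj (cnj (V $$ (n, j)) * \<mu>)" by simp
    then show ?thesis by simp
  qed
  have \<rho>: "\<rho> = (cmod \<mu>)\<^sup>2"
  proof -
    have "\<rho> = (\<Sum>j<Suc n. (cmod (cnj (z j)))\<^sup>2)" by (simp add: z sqnorm_def)
    also have "\<dots> = (\<Sum>i<Suc n. (cmod (\<Sum>j<Suc n. V $$ (i, j) * cnj (z j)))\<^sup>2)"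
      by (rule gauss_unitary_norm[OF V, symmetric])
    also have "\<dots> = (\<Sum>i<Suc n. if i = n then (cmod \<mu>)\<^sup>2 else 0)"
      using V0 by (intro sum.cong) (auto simp: \<mu>_def)
    finally show ?thesis by simp
  qed
  have "(\<integral>\<^sup>+G. ennreal (exp (- sqnorm m (apply_mat (Suc n) G z))) * f (row_app {..<m} (Suc n) V G) \<partial>gauss ({..<m} \<times> {..<Suc n}))
    = (\<integral>\<^sup>+G. ennreal (exp (- \<rho> * (\<Sum>i<m. (cmod (G (i, n)))\<^sup>2))) * f G \<partial>gauss ({..<m} \<times> {..<Suc n}))"
    if f[measurable]: "f \<in> borel_measurable (gauss ({..<m} \<times> {..<Suc n}))" for f
  proof -
    define F where "F G = ennreal (exp (- \<rho> * (\<Sum>i<m. (cmod (G (i, n)))\<^sup>2))) * f G" for G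
    have "(\<lambda>G. \<Sum>i<m. (cmod (G (i, n)))\<^sup>2) \<in> borel_measurable (gauss ({..<m} \<times> {..<Suc n}))"
      by (intro borel_measurable_sum borel_measurable_power borel_measurable_norm measurable_gauss_component) auto
    then have F: "F \<in> borel_measurable (gauss ({..<m} \<times> {..<Suc n}))"
      unfolding F_def by measurable
    have "sqnorm m (apply_mat (Suc n) G z) = \<rho> * (\<Sum>i<m. (cmod (row_app {..<m} (Suc n) V G (i, n)))\<^sup>2)" for G
    proof -
      have "apply_mat (Suc n) G z i = row_app {..<m} (Suc n) V G (i, n) * cnj \<mu>" if "i < m" for i
        using that zj by (auto simp: apply_mat_def sum_distrib_left sum_distrib_right mult_ac simp del: sum.lessThan_Suc intro!: sum.cong)
      then show ?thesis
        by (simp add: sqnorm_def \<rho> norm_mult power_mult_distrib sum_distrib_left mult.commute)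
    qed
    then have "ennreal (exp (- sqnorm m (apply_mat (Suc n) G z))) * f (row_app {..<m} (Suc n) V G) = F (row_app {..<m} (Suc n) V G)" for G
      by (simp add: F_def)
    then show ?thesis
      using nn_integral_row_app[OF V _ F] by (simp add: F_def)
  qed
  with V show ?thesis by blast
qed

lemma measurable_indicator_contracts:
  assumes "n \<le> n'"
  shows "(\<lambda>G. indicator {G. contracts m n t G} G :: ennreal) \<in> borel_measurable (gauss ({..<m} \<times> {..<n'}))"
proof (rule borel_measurable_indicator')
  let ?M = "gauss ({..<m} \<times> {..<n'})"
  define q where "q G v = sqnorm m (apply_mat n G v) - t * sqnorm n v" for G and v :: "nat \<Rightarrow> complex"
  have iff: "(\<forall>v. 0 \<le> q G v) \<longleftrightarrow> \<not> contracts m n t G" for G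
    unfolding q_def contracts_def by (simp add: not_less)
  have "{G \<in> space ?M. \<forall>v. 0 \<le> q G v} \<in> sets ?M"
  proof (rule sets_Collect_all_nonneg)
    fix v :: "nat \<Rightarrow> complex"
    have "(\<lambda>G. \<Sum>j<n. G (i, j) * v j) \<in> borel_measurable ?M" if "i < m" for i
      using that assms by (intro borel_measurable_sum borel_measurable_times measurable_gauss_component) auto
    then show "(\<lambda>G. q G v) \<in> borel_measurable ?M"
      unfolding q_def sqnorm_def apply_mat_def
      by (intro borel_measurable_diff borel_measurable_sum borel_measurable_power borel_measurable_norm) auto
  next
    fix G show "continuous_on UNIV (q G)"
      unfolding q_def sqnorm_def apply_mat_def by (intro continuous_intros)
  qed
  then have "space ?M - {G \<in> space ?M. \<not> contracts m n t G} \<in> sets ?M"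
    unfolding iff by (rule sets.compl_sets)
  also have "space ?M - {G \<in> space ?M. \<not> contracts m n t G} = {x \<in> space ?M. x \<in> {G. contracts m n t G}}"
    by auto
  finally show "{x \<in> space ?M. x \<in> {G. contracts m n t G}} \<in> sets ?M" .
qed

text \<open>The transpose of \<open>V\<close> carries a contracted vector of the rotated matrix to
  one of \<open>G\<close> with the same norm and the same image.\<close>

lemma contracts_row_app:
  assumes V: "gauss_unitary n V" and c: "contracts m n t (row_app {..<m} n V G)"
  shows "contracts m n t G"
proof -
  obtain v where v: "sqnorm m (apply_mat n (row_app {..<m} n V G) v) < t * sqnorm n v"
    using c by (auto simp: contracts_def)
  define v' where "v' l = (\<Sum>j<n. V $$ (j, l) * v j)" for l
  have Vc: "V \<in> carrier_mat n n" using V by (rule gauss_unitary_carrier)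
  have "apply_mat n (row_app {..<m} n V G) v i = apply_mat n G v' i" if "i < m" for i
  proof -
    have "apply_mat n (row_app {..<m} n V G) v i = (\<Sum>j<n. \<Sum>l<n. G (i, l) * (V $$ (j, l) * v j))"
      using that unfolding apply_mat_def by (intro sum.cong refl) (simp add: sum_distrib_left sum_distrib_right mult_ac)
    also have "\<dots> = (\<Sum>l<n. \<Sum>j<n. G (i, l) * (V $$ (j, l) * v j))" by (rule sum.swap)
    finally show ?thesis by (simp add: apply_mat_def v'_def sum_distrib_left)
  qed
  moreover have "sqnorm n v' = sqnorm n v"
  proof -
    have "(\<Sum>l<n. mat_adjoint V $$ (i, l) * cnj (v l)) = cnj (v' i)" if "i < n" for i
      using that Vc by (auto simp: v'_def intro!: sum.cong)
    then have "sqnorm n v' = (\<Sum>i<n. (cmod (\<Sum>l<n. mat_adjoint V $$ (i, l) * cnj (v l)))\<^sup>2)"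
      by (simp add: sqnorm_def)
    also have "\<dots> = sqnorm n v"
      using gauss_unitary_norm[OF gauss_unitary_adjoint[OF V], of "\<lambda>l. cnj (v l)"] by (simp add: sqnorm_def)
    finally show ?thesis .
  qed
  ultimately show ?thesis using v unfolding contracts_def sqnorm_def by (intro exI[of _ v']) simp
qed

lemma nn_integral_exp_column:
  assumes f: "f \<in> borel_measurable (gauss ({..<m} \<times> {..<n}))" and \<rho>: "0 \<le> \<rho>"
    and h: "h \<in> borel_measurable (gauss ({..<m} \<times> {..<Suc n}))"
    and hf: "\<And>x y. h (merge ({..<m} \<times> {..<n}) ({..<m} \<times> {n}) (x, y)) = f x"
  shows "(\<integral>\<^sup>+G. ennreal (exp (- \<rho> * (\<Sum>i<m. (cmod (G (i, n)))\<^sup>2))) * h G \<partial>gauss ({..<m} \<times> {..<Suc n}))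
    = (\<integral>\<^sup>+G. f G \<partial>gauss ({..<m} \<times> {..<n})) * ennreal ((1 / (1 + \<rho>)) ^ m)"
proof -
  let ?I = "{..<m} \<times> {..<n}" and ?J = "{..<m} \<times> {n}"
  have un: "{..<m} \<times> {..<Suc n} = ?I \<union> ?J" by auto
  have dis: "?I \<inter> ?J = {}" "finite ?I" "finite ?J" by auto
  have "(\<lambda>G. \<Sum>i<m. (cmod (G (i, n)))\<^sup>2) \<in> borel_measurable (gauss ({..<m} \<times> {..<Suc n}))"
    by (intro borel_measurable_sum borel_measurable_power borel_measurable_norm measurable_gauss_component) auto
  then have m: "(\<lambda>G. ennreal (exp (- \<rho> * (\<Sum>i<m. (cmod (G (i, n)))\<^sup>2))) * h G) \<in> borel_measurable (gauss (?I \<union> ?J))"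
    unfolding un[symmetric] using h by measurable
  have expm: "(\<lambda>z. ennreal (exp (- \<rho> * (cmod z)\<^sup>2))) \<in> borel_measurable cgauss"
    unfolding cgauss_def by simp
  have mg: "(\<Sum>i<m. (cmod (merge ?I ?J (x, y) (i, n)))\<^sup>2) = (\<Sum>p\<in>?J. (cmod (y p))\<^sup>2)" for x y :: "nat \<times> nat \<Rightarrow> complex"
  proof -
    have "(\<Sum>p\<in>?J. (cmod (y p))\<^sup>2) = (\<Sum>i<m. \<Sum>j\<in>{n}. (cmod (y (i, j)))\<^sup>2)"
      by (subst sum.cartesian_product) simp
    then show ?thesis by (simp add: merge_def)
  qed
  have "(\<integral>\<^sup>+y. ennreal (exp (- \<rho> * (\<Sum>p\<in>?J. (cmod (y p))\<^sup>2))) \<partial>gauss ?J)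
      = (\<integral>\<^sup>+y. (\<Prod>p\<in>?J. ennreal (exp (- \<rho> * (cmod (y p))\<^sup>2))) \<partial>gauss ?J)"
    by (simp add: prod_ennreal exp_sum[symmetric] sum_negf sum_distrib_left)
  also have "\<dots> = (\<Prod>p\<in>?J. \<integral>\<^sup>+z. ennreal (exp (- \<rho> * (cmod z)\<^sup>2)) \<partial>cgauss)"
    by (rule cgauss_PiM.product_nn_integral_prod[where f="\<lambda>_ z. ennreal (exp (- \<rho> * (cmod z)\<^sup>2))"]) (simp, rule expm)
  also have "\<dots> = ennreal ((1 / (1 + \<rho>)) ^ m)"
    unfolding nn_integral_cgauss_exp[OF \<rho>] using \<rho> by (simp add: ennreal_power)
  finally have J: "(\<integral>\<^sup>+y. ennreal (exp (- \<rho> * (\<Sum>p\<in>?J. (cmod (y p))\<^sup>2))) \<partial>gauss ?J) = ennreal ((1 / (1 + \<rho>)) ^ m)" .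
  have Jm: "(\<lambda>y. ennreal (exp (- \<rho> * (\<Sum>p\<in>?J. (cmod (y p))\<^sup>2)))) \<in> borel_measurable (gauss ?J)"
  proof -
    have "(\<lambda>y. \<Sum>p\<in>?J. (cmod (y p))\<^sup>2) \<in> borel_measurable (gauss ?J)"
      by (intro borel_measurable_sum borel_measurable_power borel_measurable_norm measurable_gauss_component) auto
    then show ?thesis by measurable
  qed
  have "(\<integral>\<^sup>+G. ennreal (exp (- \<rho> * (\<Sum>i<m. (cmod (G (i, n)))\<^sup>2))) * h G \<partial>gauss ({..<m} \<times> {..<Suc n}))
     = (\<integral>\<^sup>+x. \<integral>\<^sup>+y. ennreal (exp (- \<rho> * (\<Sum>p\<in>?J. (cmod (y p))\<^sup>2))) * f x \<partial>gauss ?J \<partial>gauss ?I)"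
    unfolding un cgauss_PiM.product_nn_integral_fold[OF dis m] mg hf ..
  also have "\<dots> = (\<integral>\<^sup>+x. ennreal ((1 / (1 + \<rho>)) ^ m) * f x \<partial>gauss ?I)"
    unfolding nn_integral_multc[OF Jm] J ..
  also have "\<dots> = (\<integral>\<^sup>+G. f G \<partial>gauss ?I) * ennreal ((1 / (1 + \<rho>)) ^ m)"
    by (subst nn_integral_cmult[OF f]) (simp add: mult.commute)
  finally show ?thesis .
qed

text \<open>A column \<open>z\<close> distributed like the eigenvector of an \<open>m \<times> (n + 1)\<close> matrix is adjoined: averaging over
  its direction turns the extra column into the weight \<open>exp (- |G z|\<^sup>2)\<close>, whose mean is \<open>(1 + |z|\<^sup>2)\<^sup>-\<^sup>m\<close>,
  and on the event that \<open>G\<close> contracts, mass in \<open>|z|\<^sup>2\<close> may be moved outwards by \<open>\<delta>\<close>.\<close>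

lemma nn_integral_contracts_shift:
  assumes [measurable]: "\<eta> \<in> borel_measurable borel" and \<delta>: "0 \<le> \<delta>"
  shows "(\<integral>\<^sup>+G. indicator {G. contracts m n t G} G \<partial>gauss ({..<m} \<times> {..<n})) *
      (\<integral>\<^sup>+r. ennreal (erlang_density n 1 r) * (\<eta> r * ennreal (exp r) * ennreal (exp (t * r)) * ennreal ((1 / (1 + r)) ^ m)) \<partial>lborel)
    \<le> (\<integral>\<^sup>+r. ennreal (erlang_density n 1 r) * (\<eta> (r - \<delta>) * ennreal (exp r) * ennreal (exp (t * r)) * ennreal ((1 / (1 + r)) ^ m)) \<partial>lborel)"
proof -
  let ?Z = "gauss ({0} \<times> {..<Suc n})" and ?M = "gauss ({..<m} \<times> {..<Suc n})"
  define P where "P = (\<integral>\<^sup>+G. indicator {G. contracts m n t G} G \<partial>gauss ({..<m} \<times> {..<n}))"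
  define A where "A G = (indicator {G. contracts m (Suc n) t G} G :: ennreal)" for G
  define h where "h G = (indicator {G. contracts m n t G} G :: ennreal)" for G
  define nz where "nz z = sqnorm (Suc n) (vec0 z)" for z
  define e where "e z G = ennreal (exp (- sqnorm m (apply_mat (Suc n) G (vec0 z))))" for z G
  \<comment> \<open>The factor exp (nz) cancels the decay of the radial law; exp (t nz) combines
    with \<open>e\<close> to the exponential of t |z|^2 - |G z|^2.\<close>
  define wt where "wt \<zeta> z = \<zeta> (nz z) * ennreal (exp (nz z)) * ennreal (exp (t * nz z))" for \<zeta> :: "real \<Rightarrow> ennreal" and z
  have nzm [measurable]: "nz \<in> borel_measurable ?Z" unfolding nz_def by measurable
  have Am [measurable]: "A \<in> borel_measurable ?M"
    unfolding A_def by (rule measurable_indicator_contracts) simp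
  have hm [measurable]: "h \<in> borel_measurable ?M"
    unfolding h_def by (rule measurable_indicator_contracts) simp
  have hm': "h \<in> borel_measurable (gauss ({..<m} \<times> {..<n}))"
    unfolding h_def by (rule measurable_indicator_contracts) simp
  have em: "e z \<in> borel_measurable ?M" for z
  proof -
    have "(\<lambda>G. \<Sum>j<Suc n. G (i, j) * z (0, j)) \<in> borel_measurable ?M" if "i < m" for i
      using that by (intro borel_measurable_sum borel_measurable_times measurable_gauss_component) auto
    then have "(\<lambda>G. sqnorm m (apply_mat (Suc n) G (vec0 z))) \<in> borel_measurable ?M"
      unfolding sqnorm_def apply_mat_def
      by (intro borel_measurable_sum borel_measurable_power borel_measurable_norm) auto
    then show ?thesis unfolding e_def by measurable
  qed
  have eP: "(\<lambda>(z, G). e z G) \<in> borel_measurable (?Z \<Otimes>\<^sub>M ?M)"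
  proof -
    have "(\<lambda>p. \<Sum>j<Suc n. snd p (i, j) * fst p (0, j)) \<in> borel_measurable (?Z \<Otimes>\<^sub>M ?M)" if "i < m" for i
      using that by (intro borel_measurable_sum borel_measurable_times
          measurable_compose[OF measurable_snd measurable_gauss_component]
          measurable_compose[OF measurable_fst measurable_gauss_component]) auto
    then have "(\<lambda>p. sqnorm m (apply_mat (Suc n) (snd p) (vec0 (fst p)))) \<in> borel_measurable (?Z \<Otimes>\<^sub>M ?M)"
      unfolding sqnorm_def apply_mat_def
      by (intro borel_measurable_sum borel_measurable_power borel_measurable_norm) auto
    then show ?thesis unfolding e_def split_def by measurable
  qed
  have rot: "\<exists>V. gauss_unitary (Suc n) V \<and> (\<forall>f\<in>borel_measurable ?M.
    (\<integral>\<^sup>+G. e z G * f (row_app {..<m} (Suc n) V G) \<partial>?M)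
    = (\<integral>\<^sup>+G. ennreal (exp (- nz z * (\<Sum>i<m. (cmod (G (i, n)))\<^sup>2))) * f G \<partial>?M))" for z
    unfolding e_def by (rule nn_integral_gauss_rotate_column) (simp add: nz_def)
  have nz0: "0 \<le> nz z" for z by (simp add: nz_def)
  \<comment> \<open>After the rotation the weight sees only the last column, while the first
    \<open>n\<close> columns keep their law. A vector contracted by these, padded with 0, is
    contracted by all \<open>n + 1\<close> columns, so the probability \<open>P\<close> for
    \<open>n\<close> columns factors out.\<close>
  have lower: "P * ennreal ((1 / (1 + nz z)) ^ m) \<le> (\<integral>\<^sup>+G. e z G * A G \<partial>?M)" for z
  proof -
    obtain V where V: "gauss_unitary (Suc n) V" and Vf: "\<And>f. f \<in> borel_measurable ?M \<Longrightarrow>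
      (\<integral>\<^sup>+G. e z G * f (row_app {..<m} (Suc n) V G) \<partial>?M)
      = (\<integral>\<^sup>+G. ennreal (exp (- nz z * (\<Sum>i<m. (cmod (G (i, n)))\<^sup>2))) * f G \<partial>?M)" using rot by blast
    have "P * ennreal ((1 / (1 + nz z)) ^ m) = (\<integral>\<^sup>+G. h G \<partial>gauss ({..<m} \<times> {..<n})) * ennreal ((1 / (1 + nz z)) ^ m)"
      by (simp add: P_def h_def)
    also have "\<dots> = (\<integral>\<^sup>+G. ennreal (exp (- nz z * (\<Sum>i<m. (cmod (G (i, n)))\<^sup>2))) * h G \<partial>?M)"
    proof (rule nn_integral_exp_column[OF hm' nz0 hm, symmetric])
      fix x y
      have "apply_mat n (merge ({..<m} \<times> {..<n}) ({..<m} \<times> {n}) (x, y)) v i = apply_mat n x v i" if "i < m" for v i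
        using that by (simp add: apply_mat_def merge_def)
      then show "h (merge ({..<m} \<times> {..<n}) ({..<m} \<times> {n}) (x, y)) = h x"
        by (simp add: h_def indicator_def contracts_def sqnorm_def)
    qed
    also have "\<dots> \<le> (\<integral>\<^sup>+G. ennreal (exp (- nz z * (\<Sum>i<m. (cmod (G (i, n)))\<^sup>2))) * A G \<partial>?M)"
    proof (rule nn_integral_mono, rule mult_left_mono)
      fix G :: "nat \<times> nat \<Rightarrow> complex"
      have "contracts m (Suc n) t G" if c: "contracts m n t G"
      proof -
        obtain v where v: "sqnorm m (apply_mat n G v) < t * sqnorm n v"
          using c by (auto simp: contracts_def)
        define v' where "v' j = (if j < n then v j else 0)" for j
        have "apply_mat (Suc n) G v' i = apply_mat n G v i" for i by (simp add: apply_mat_def v'_def)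
        moreover have "sqnorm (Suc n) v' = sqnorm n v" by (simp add: sqnorm_def v'_def)
        ultimately show ?thesis using v unfolding contracts_def sqnorm_def by (intro exI[of _ v']) simp
      qed
      then show "h G \<le> A G" by (simp add: h_def A_def indicator_def)
    qed simp
    also have "\<dots> = (\<integral>\<^sup>+G. e z G * A (row_app {..<m} (Suc n) V G) \<partial>?M)"
      by (rule Vf[symmetric]) measurable
    also have "\<dots> \<le> (\<integral>\<^sup>+G. e z G * A G \<partial>?M)"
      using contracts_row_app[OF V] by (intro nn_integral_mono mult_left_mono) (auto simp: A_def indicator_def)
    finally show ?thesis .
  qed
  \<comment> \<open>The indicator is bounded by 1, which leaves the mean of the weight.\<close>
  have upper: "(\<integral>\<^sup>+G. e z G * A G \<partial>?M) \<le> ennreal ((1 / (1 + nz z)) ^ m)" for z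
  proof -
    obtain V where V: "gauss_unitary (Suc n) V" and Vf: "\<And>f. f \<in> borel_measurable ?M \<Longrightarrow>
      (\<integral>\<^sup>+G. e z G * f (row_app {..<m} (Suc n) V G) \<partial>?M)
      = (\<integral>\<^sup>+G. ennreal (exp (- nz z * (\<Sum>i<m. (cmod (G (i, n)))\<^sup>2))) * f G \<partial>?M)" using rot by blast
    have "(\<integral>\<^sup>+G. e z G * A G \<partial>?M) \<le> (\<integral>\<^sup>+G. e z G * 1 \<partial>?M)"
      by (intro nn_integral_mono mult_left_mono) (auto simp: A_def indicator_def)
    also have "\<dots> = (\<integral>\<^sup>+G. ennreal (exp (- nz z * (\<Sum>i<m. (cmod (G (i, n)))\<^sup>2))) * 1 \<partial>?M)"
      using Vf[of "\<lambda>_. 1"] by simp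
    also have "\<dots> = (\<integral>\<^sup>+G. 1 \<partial>gauss ({..<m} \<times> {..<n})) * ennreal ((1 / (1 + nz z)) ^ m)"
      by (rule nn_integral_exp_column) (auto simp: nz0)
    finally show ?thesis by (simp add: cgauss_PiM.emeasure_space_1)
  qed
  interpret Zp: prob_space ?Z by (intro prob_space_PiM prob_space_cgauss)
  interpret Mp: prob_space ?M by (intro prob_space_PiM prob_space_cgauss)
  interpret ZM: pair_prob_space ?Z ?M ..
  \<comment> \<open>Taking the integral over \<open>z\<close> inside puts the weight into the form
    handled by \<open>nn_integral_radial_shift_le\<close>, for each \<open>G\<close>
    separately.\<close>
  have swap: "(\<integral>\<^sup>+z. wt \<zeta> z * (\<integral>\<^sup>+G. e z G * A G \<partial>?M) \<partial>?Z)
     = (\<integral>\<^sup>+G. A G * (\<integral>\<^sup>+z. \<zeta> (nz z) * ennreal (exp (nz z)) *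
        ennreal (exp (t * nz z - sqnorm m (apply_mat (Suc n) G (vec0 z)))) \<partial>?Z) \<partial>?M)"
    if [measurable]: "\<zeta> \<in> borel_measurable borel" for \<zeta>
  proof -
    note eP[measurable]
    have wm [measurable]: "wt \<zeta> \<in> borel_measurable ?Z" unfolding wt_def by measurable
    have "(\<integral>\<^sup>+z. wt \<zeta> z * (\<integral>\<^sup>+G. e z G * A G \<partial>?M) \<partial>?Z) = (\<integral>\<^sup>+z. \<integral>\<^sup>+G. wt \<zeta> z * (e z G * A G) \<partial>?M \<partial>?Z)"
    proof (rule nn_integral_cong)
      fix z
      have "(\<lambda>G. e z G * A G) \<in> borel_measurable ?M"
        using em Am by (rule borel_measurable_times_ennreal)
      then show "wt \<zeta> z * (\<integral>\<^sup>+G. e z G * A G \<partial>?M) = (\<integral>\<^sup>+G. wt \<zeta> z * (e z G * A G) \<partial>?M)"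
        by (rule nn_integral_cmult[symmetric])
    qed
    also have "\<dots> = (\<integral>\<^sup>+G. \<integral>\<^sup>+z. wt \<zeta> z * (e z G * A G) \<partial>?Z \<partial>?M)"
      by (rule ZM.Fubini'[symmetric]) measurable
    also have "\<dots> = (\<integral>\<^sup>+G. \<integral>\<^sup>+z. A G * (\<zeta> (nz z) * ennreal (exp (nz z)) *
        ennreal (exp (t * nz z - sqnorm m (apply_mat (Suc n) G (vec0 z))))) \<partial>?Z \<partial>?M)"
    proof (rule nn_integral_cong, rule nn_integral_cong)
      fix G z
      have "wt \<zeta> z * (e z G * A G) = A G * (\<zeta> (nz z) * ennreal (exp (nz z)) * (ennreal (exp (t * nz z)) * e z G))"
        by (simp only: wt_def mult_ac)
      also have "ennreal (exp (t * nz z)) * e z G = ennreal (exp (t * nz z - sqnorm m (apply_mat (Suc n) G (vec0 z))))"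
        unfolding e_def by (simp add: ennreal_mult[symmetric] exp_add[symmetric])
      finally show "wt \<zeta> z * (e z G * A G) = A G * (\<zeta> (nz z) * ennreal (exp (nz z)) *
        ennreal (exp (t * nz z - sqnorm m (apply_mat (Suc n) G (vec0 z)))))"
        .
    qed
    also have "\<dots> = (\<integral>\<^sup>+G. A G * (\<integral>\<^sup>+z. \<zeta> (nz z) * ennreal (exp (nz z)) *
        ennreal (exp (t * nz z - sqnorm m (apply_mat (Suc n) G (vec0 z)))) \<partial>?Z) \<partial>?M)"
      by (rule nn_integral_cong, rule nn_integral_cmult) measurable
    finally show ?thesis .
  qed
  have radial: "(\<integral>\<^sup>+r. ennreal (erlang_density n 1 r) * (\<zeta> r * ennreal (exp r) * ennreal (exp (t * r)) * ennreal ((1 / (1 + r)) ^ m)) \<partial>lborel)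
     = (\<integral>\<^sup>+z. wt \<zeta> z * ennreal ((1 / (1 + nz z)) ^ m) \<partial>?Z)" if [measurable]: "\<zeta> \<in> borel_measurable borel" for \<zeta>
    using nn_integral_gauss_sqnorm[of "\<lambda>r. \<zeta> r * ennreal (exp r) * ennreal (exp (t * r)) * ennreal ((1 / (1 + r)) ^ m)" n]
    by (simp add: wt_def nz_def)
  have \<eta>': "(\<lambda>r. \<eta> (r - \<delta>)) \<in> borel_measurable borel" by measurable
  have wm: "(\<lambda>z. wt \<eta> z * ennreal ((1 / (1 + nz z)) ^ m)) \<in> borel_measurable ?Z"
    unfolding wt_def by measurable
  have "P * (\<integral>\<^sup>+z. wt \<eta> z * ennreal ((1 / (1 + nz z)) ^ m) \<partial>?Z) = (\<integral>\<^sup>+z. wt \<eta> z * (P * ennreal ((1 / (1 + nz z)) ^ m)) \<partial>?Z)"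
    using wm by (subst nn_integral_cmult[symmetric]) (auto simp: mult_ac)
  also have "\<dots> \<le> (\<integral>\<^sup>+z. wt \<eta> z * (\<integral>\<^sup>+G. e z G * A G \<partial>?M) \<partial>?Z)"
    by (rule nn_integral_mono, rule mult_left_mono[OF lower]) simp
  also have "\<dots> = (\<integral>\<^sup>+G. A G * (\<integral>\<^sup>+z. \<eta> (nz z) * ennreal (exp (nz z)) *
        ennreal (exp (t * nz z - sqnorm m (apply_mat (Suc n) G (vec0 z)))) \<partial>?Z) \<partial>?M)"
    by (rule swap) measurable
  also have "\<dots> \<le> (\<integral>\<^sup>+G. A G * (\<integral>\<^sup>+z. \<eta> (nz z - \<delta>) * ennreal (exp (nz z)) *
        ennreal (exp (t * nz z - sqnorm m (apply_mat (Suc n) G (vec0 z)))) \<partial>?Z) \<partial>?M)"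
  \<comment> \<open>Only matrices that contract need the shift; for the others
    \<open>A G = 0\<close> annihilates both sides.\<close>
  proof (rule nn_integral_mono)
    fix G :: "nat \<times> nat \<Rightarrow> complex"
    show "A G * (\<integral>\<^sup>+z. \<eta> (nz z) * ennreal (exp (nz z)) *
        ennreal (exp (t * nz z - sqnorm m (apply_mat (Suc n) G (vec0 z)))) \<partial>?Z)
      \<le> A G * (\<integral>\<^sup>+z. \<eta> (nz z - \<delta>) * ennreal (exp (nz z)) *
        ennreal (exp (t * nz z - sqnorm m (apply_mat (Suc n) G (vec0 z)))) \<partial>?Z)"
      using nn_integral_radial_shift_le[OF assms, of m n t G]
      by (cases "contracts m (Suc n) t G") (simp_all add: A_def nz_def)
  qed
  also have "\<dots> = (\<integral>\<^sup>+z. wt (\<lambda>r. \<eta> (r - \<delta>)) z * (\<integral>\<^sup>+G. e z G * A G \<partial>?M) \<partial>?Z)"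
    by (rule swap[OF \<eta>', symmetric])
  also have "\<dots> \<le> (\<integral>\<^sup>+z. wt (\<lambda>r. \<eta> (r - \<delta>)) z * ennreal ((1 / (1 + nz z)) ^ m) \<partial>?Z)"
    by (rule nn_integral_mono, rule mult_left_mono[OF upper]) simp
  finally show ?thesis
    unfolding radial[OF assms(1)] radial[OF \<eta>'] P_def .
qed

text \<open>Here \<open>y\<close> is the double critical point of \<open>z \<mapsto> \<sigma>\<^sup>2 z - a\<^sup>2 ln (1 + z) + b\<^sup>2 ln z\<close> at the edge \<open>\<sigma> = a - b\<close>,
  and \<open>x\<close> is such that \<open>1 + x = a / \<sigma>\<close>.\<close>

lemma exponent_gap:
  fixes a b s :: real
  assumes b: "0 < b" and s: "0 < s" "s < a - b"
  defines "\<sigma> \<equiv> a - b - s"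
  defines "x \<equiv> (b + s) / \<sigma>" and "y \<equiv> b / (a - b)"
  shows "x * \<sigma>\<^sup>2 - a\<^sup>2 * ln (1 + x) + b\<^sup>2 * ln x + s\<^sup>2 < y * \<sigma>\<^sup>2 - a\<^sup>2 * ln (1 + y) + b\<^sup>2 * ln y"
proof -
  define w where "w = a - b"
  have w: "0 < w" "s < w" "a = w + b" "\<sigma> = w - s" "0 < \<sigma>" using s b by (auto simp: w_def \<sigma>_def)
  define L where "L = ln (w / \<sigma>)"
  have x1: "1 + x = a / \<sigma>" and y1: "1 + y = a / w"
    using w by (auto simp: x_def y_def w_def[symmetric] field_simps)
  have ap: "0 < a" using w b by simp
  have lnx1: "ln (1 + x) = ln (1 + y) + L"
    unfolding x1 y1 L_def using ap w by (simp add: ln_div)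
  have lnx: "ln x = ln y + ln (1 + s / b) + L"
  proof -
    have "1 + s / b = (b + s) / b" using b by (simp add: field_simps)
    then show ?thesis unfolding x_def y_def w_def[symmetric] L_def using b s w by (simp add: ln_div)
  qed
  have "ln (\<sigma> / w) \<le> \<sigma> / w - 1" using w by (intro ln_le_minus_one) auto
  moreover have "ln (\<sigma> / w) = - L" unfolding L_def using w(1,5) by (simp add: ln_div)
  moreover have "\<sigma> / w - 1 = - (s / w)" using w(1) unfolding w(4) by (simp add: diff_divide_distrib)
  ultimately have L: "s / w \<le> L" by linarith
  have lb: "ln (1 + s / b) \<le> s / b" using b s by (intro ln_add_one_self_le_self) auto
  have ab: "a\<^sup>2 - b\<^sup>2 = w * (w + 2 * b)" using w by (simp add: power2_eq_square algebra_simps)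
  have 1: "(w + 2 * b) * s \<le> (a\<^sup>2 - b\<^sup>2) * L"
  proof -
    have "(w + 2 * b) * s = w * (w + 2 * b) * (s / w)" using w by simp
    also have "\<dots> \<le> w * (w + 2 * b) * L" using L w b by (intro mult_left_mono) auto
    finally show ?thesis unfolding ab .
  qed
  have 2: "b\<^sup>2 * ln (1 + s / b) \<le> b * s"
  proof -
    have "b\<^sup>2 * ln (1 + s / b) \<le> b\<^sup>2 * (s / b)" using lb by (intro mult_left_mono) auto
    then show ?thesis using b by (simp add: power2_eq_square)
  qed
  have 3: "x * \<sigma>\<^sup>2 = (b + s) * \<sigma>" using w by (simp add: x_def power2_eq_square)
  have 4: "y * \<sigma>\<^sup>2 = b * w - 2 * b * s + b * s\<^sup>2 / w"
    using w(1) unfolding w(4) y_def w_def[symmetric] by (simp add: power2_eq_square field_simps)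
  \<comment> \<open>With \<open>1\<close> and \<open>2\<close> inserted, all terms of the difference
    of the two sides cancel except this one; it gives the strict inequality, which leaves room for a
    continuity argument.\<close>
  have 5: "0 < b * s\<^sup>2 / w" using b s w by simp
  have "a\<^sup>2 * L - b\<^sup>2 * L \<ge> (w + 2 * b) * s" using 1 by (simp add: algebra_simps)
  moreover have "(b + s) * \<sigma> = b * w + w * s - b * s - s\<^sup>2" unfolding w(4) by (simp add: power2_eq_square algebra_simps)
  ultimately show ?thesis unfolding 3 4 lnx1 lnx using 2 5 by (simp add: algebra_simps)
qed

text \<open>\<open>nn_integral_contracts_shift\<close> bounds the probability by the ratio of the
  integrals of one weight over two intervals, one starting at \<open>y\<close> and its translate
  starting at \<open>x\<close>. The ratio of the weights at the starting points is below exp (-s^2)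
  by \<open>exponent_gap\<close>; a short interval replaces the points because the radial law has no
  atoms.\<close>

lemma nn_integral_contracts_le:
  assumes n: "0 < n" and s: "0 < s" "s < sqrt (real m) - sqrt (real n)"
  shows "(\<integral>\<^sup>+G. indicator {G. contracts m n ((sqrt (real m) - sqrt (real n) - s)\<^sup>2) G} G \<partial>gauss ({..<m} \<times> {..<n}))
    \<le> ennreal (exp (- s\<^sup>2))"
proof -
  define a b \<sigma> where "a = sqrt (real m)" and "b = sqrt (real n)" and "\<sigma> = a - b - s"
  define x y where "x = (b + s) / \<sigma>" and "y = b / (a - b)"
  define t where "t = \<sigma>\<^sup>2"
  define \<delta> where "\<delta> = x - y"
  \<comment> \<open>The radial weight up to \<open>n!\<close>: \<open>r ^ n\<close> comes from the
    Erlang density, whose decay is cancelled by exp r, and the last factor is the mean of the weight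
    of the extra column. Its logarithm is the function in \<open>exponent_gap\<close> with a^2 = m
    and b^2 = n.\<close>
  define w where "w r = r ^ n * exp (t * r) * (1 / (1 + r)) ^ m" for r :: real
  have b: "0 < b" using n by (simp add: b_def)
  have s': "s < a - b" using s by (simp add: a_def b_def)
  have \<sigma>: "0 < \<sigma>" "\<sigma> \<le> a - b" using s' s by (auto simp: \<sigma>_def)
  have y: "0 < y" using b s s' by (simp add: y_def)
  have "b / (a - b) < (b + s) / \<sigma>" using b s \<sigma> by (intro frac_less2 frac_less) auto
  then have xy: "y < x" by (simp add: x_def y_def)
  then have \<delta>: "0 \<le> \<delta>" by (simp add: \<delta>_def)
  have wexp: "w r = exp (r * \<sigma>\<^sup>2 - a\<^sup>2 * ln (1 + r) + b\<^sup>2 * ln r)" if "0 < r" for r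
  proof -
    have "exp (b\<^sup>2 * ln r) = r ^ n" using that by (simp add: b_def exp_of_nat_mult)
    moreover have "exp (- (a\<^sup>2 * ln (1 + r))) = (1 / (1 + r)) ^ m"
      using that by (simp add: a_def exp_minus exp_of_nat_mult power_one_over[symmetric] inverse_eq_divide)
    moreover have "exp (r * \<sigma>\<^sup>2 - a\<^sup>2 * ln (1 + r) + b\<^sup>2 * ln r) = exp (b\<^sup>2 * ln r) * exp (r * \<sigma>\<^sup>2) * exp (- (a\<^sup>2 * ln (1 + r)))"
      by (simp add: exp_add[symmetric])
    ultimately show ?thesis by (simp add: w_def t_def mult.commute)
  qed
  have "w x < exp (- s\<^sup>2) * w y"
    using exponent_gap[OF b s(1) s'] y xy
    unfolding wexp[OF y] wexp[OF order_less_trans[OF y xy]]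
    by (simp add: exp_add[symmetric] x_def y_def \<sigma>_def)
  \<comment> \<open>The strict inequality at \<open>y\<close> persists on a neighbourhood, which
    fixes the length \<open>l\<close>.\<close>
  define gap where "gap r = exp (- s\<^sup>2) * w r - w (r + \<delta>)" for r
  have "isCont gap y"
    unfolding gap_def w_def using y \<delta> by (intro continuous_intros) auto
  moreover have "0 < gap y" using \<open>w x < exp (- s\<^sup>2) * w y\<close> by (simp add: gap_def \<delta>_def)
  ultimately have "eventually (\<lambda>r. 0 < gap r) (at y)"
    by (intro order_tendstoD(1)[where y="gap y"]) (auto simp: isCont_def)
  then obtain d where d: "0 < d" "\<And>r. r \<noteq> y \<Longrightarrow> dist r y < d \<Longrightarrow> 0 < gap r"
    unfolding eventually_at by auto
  define l where "l = d / 2"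
  have l: "0 < l" using d by (simp add: l_def)
  have gap: "w (r + \<delta>) \<le> exp (- s\<^sup>2) * w r" if "r \<in> {y..y + l}" for r
    using that d(2)[of r] \<open>0 < gap y\<close> d(1) by (cases "r = y") (auto simp: gap_def l_def dist_real_def)
  define \<eta> where "\<eta> = (indicator {y..y + l} :: real \<Rightarrow> ennreal)"
  have \<eta>m: "\<eta> \<in> borel_measurable borel" by (simp add: \<eta>_def)
  have dens: "ennreal (erlang_density n 1 r) * (c * ennreal (exp r) * ennreal (exp (t * r)) * ennreal ((1 / (1 + r)) ^ m))
     = c * ennreal (w r / fact n)" if "0 \<le> r" for r c
  proof -
    have "erlang_density n 1 r * exp r * exp (t * r) * (1 / (1 + r)) ^ m = w r / fact n"
      using that by (simp add: erlang_density_def w_def exp_minus field_simps)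
    then have "ennreal (erlang_density n 1 r) * ennreal (exp r) * ennreal (exp (t * r)) * ennreal ((1 / (1 + r)) ^ m) = ennreal (w r / fact n)"
      using that by (simp add: ennreal_mult[symmetric])
    then show ?thesis by (metis (no_types, lifting) mult.assoc mult.commute)
  qed
  define I where "I = (\<integral>\<^sup>+r. indicator {y..y + l} r * ennreal (w r / fact n) \<partial>lborel)"
  define P where "P = (\<integral>\<^sup>+G. indicator {G. contracts m n t G} G \<partial>gauss ({..<m} \<times> {..<n}))"
  have L: "(\<integral>\<^sup>+r. ennreal (erlang_density n 1 r) * (\<eta> r * ennreal (exp r) * ennreal (exp (t * r)) * ennreal ((1 / (1 + r)) ^ m)) \<partial>lborel) = I"
    unfolding I_def
  proof (rule nn_integral_cong)
    fix r :: real
    show "ennreal (erlang_density n 1 r) * (\<eta> r * ennreal (exp r) * ennreal (exp (t * r)) * ennreal ((1 / (1 + r)) ^ m))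
      = indicator {y..y + l} r * ennreal (w r / fact n)"
      using dens[of r "\<eta> r"] y by (cases "r \<in> {y..y + l}") (auto simp: \<eta>_def)
  qed
  have wm [measurable]: "w \<in> borel_measurable borel" unfolding w_def by measurable
  have "(\<integral>\<^sup>+r. ennreal (erlang_density n 1 r) * (\<eta> (r - \<delta>) * ennreal (exp r) * ennreal (exp (t * r)) * ennreal ((1 / (1 + r)) ^ m)) \<partial>lborel)
     = (\<integral>\<^sup>+r. indicator {y..y + l} (r - \<delta>) * ennreal (w r / fact n) \<partial>lborel)"
  proof (rule nn_integral_cong)
    fix r :: real
    show "ennreal (erlang_density n 1 r) * (\<eta> (r - \<delta>) * ennreal (exp r) * ennreal (exp (t * r)) * ennreal ((1 / (1 + r)) ^ m))
      = indicator {y..y + l} (r - \<delta>) * ennreal (w r / fact n)"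
      using dens[of r "\<eta> (r - \<delta>)"] y \<delta> by (cases "r - \<delta> \<in> {y..y + l}") (auto simp: \<eta>_def)
  qed
  also have "\<dots> = (\<integral>\<^sup>+r. indicator {y..y + l} r * ennreal (w (\<delta> + r) / fact n) \<partial>lborel)"
    using nn_integral_real_affine[of "\<lambda>r. indicator {y..y + l} (r - \<delta>) * ennreal (w r / fact n)" 1 \<delta>] by simp
  also have "\<dots> \<le> (\<integral>\<^sup>+r. ennreal (exp (- s\<^sup>2)) * (indicator {y..y + l} r * ennreal (w r / fact n)) \<partial>lborel)"
  proof (rule nn_integral_mono)
    fix r :: real
    show "indicator {y..y + l} r * ennreal (w (\<delta> + r) / fact n) \<le> ennreal (exp (- s\<^sup>2)) * (indicator {y..y + l} r * ennreal (w r / fact n))"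
    proof (cases "r \<in> {y..y + l}")
      case True
      then have "w (\<delta> + r) / fact n \<le> exp (- s\<^sup>2) * (w r / fact n)"
        using gap[of r] by (simp add: add.commute divide_right_mono)
      then show ?thesis using True by (simp add: ennreal_mult'[symmetric] ennreal_leI)
    qed simp
  qed
  also have "\<dots> = ennreal (exp (- s\<^sup>2)) * I"
    unfolding I_def by (rule nn_integral_cmult) measurable
  finally have PI: "P * I \<le> ennreal (exp (- s\<^sup>2)) * I"
    using nn_integral_contracts_shift[OF \<eta>m \<delta>, of m n t] unfolding L P_def by (meson order_trans)
  have wpos: "0 < w r" if "0 < r" for r using that by (simp add: w_def)
  \<comment> \<open>Nonzero and finite, so that the common factor \<open>I\<close> may be cancelled
    from \<open>PI\<close>.\<close>
  have I0: "I \<noteq> 0"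
  proof
    assume "I = 0"
    then have "AE r in lborel. indicator {y..y + l} r * ennreal (w r / fact n) = 0"
      unfolding I_def by (subst (asm) nn_integral_0_iff_AE) measurable
    then have "AE r in lborel. r \<notin> {y..y + l}"
    proof eventually_elim
      case (elim r)
      show ?case
      proof
        assume "r \<in> {y..y + l}"
        moreover from this have "0 < w r / fact n" using wpos[of r] y by simp
        ultimately show False using elim by (simp add: ennreal_eq_0_iff)
      qed
    qed
    then have "{y..y + l} \<in> null_sets lborel"
      by (subst AE_iff_null_sets) auto
    then have "emeasure lborel {y..y + l} = 0" by auto
    then show False using l by simp
  qed
  have Ifin: "I \<noteq> \<infinity>"
  proof -
    have "continuous_on {y..y + l} w"
      unfolding w_def using y by (intro continuous_intros) auto
    then obtain B where B: "\<And>r. r \<in> {y..y + l} \<Longrightarrow> w r \<le> B"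
      using continuous_attains_sup[of "{y..y + l}" w] l by fastforce
    have "I \<le> (\<integral>\<^sup>+r. ennreal (B / fact n) * indicator {y..y + l} r \<partial>lborel)"
      unfolding I_def using B by (intro nn_integral_mono) (auto simp: indicator_def divide_right_mono intro!: ennreal_leI)
    also have "\<dots> < \<infinity>" using l by (subst nn_integral_cmult_indicator) (auto simp: ennreal_mult_less_top)
    finally show ?thesis by simp
  qed
  have "P \<le> ennreal (exp (- s\<^sup>2))"
    using PI I0 Ifin by (subst (asm) (1 2) mult.commute) (simp add: ennreal_mult_le_mult_iff)
  then show ?thesis by (simp add: P_def t_def \<sigma>_def a_def b_def)
qed

subsection \<open>The deterministic estimate\<close>

lemma mat_adjoint_minus:
  fixes A B :: "complex mat"
  assumes "A \<in> carrier_mat m n" "B \<in> carrier_mat m n"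
  shows "mat_adjoint (A - B) = mat_adjoint A - mat_adjoint B"
  using assms by (intro eq_matI) auto

lemma mat_adjoint_add:
  fixes A B :: "complex mat"
  assumes "A \<in> carrier_mat m n" "B \<in> carrier_mat m n"
  shows "mat_adjoint (A + B) = mat_adjoint A + mat_adjoint B"
  using assms by (intro eq_matI) auto

definition cip :: "complex Matrix.vec \<Rightarrow> complex Matrix.vec \<Rightarrow> complex" where
  "cip u v = (\<Sum>i<dim_vec v. u $ i * cnj (v $ i))"

lemma vnorm2_L2_set: "vnorm2 v = L2_set (\<lambda>i. cmod (v $ i)) {..<dim_vec v}"
  by (simp add: vnorm2_def L2_set_def)

lemma vnorm2_nonneg [simp]: "0 \<le> vnorm2 v"
  by (simp add: vnorm2_L2_set)

lemma vnorm2_square: "(vnorm2 v)\<^sup>2 = (\<Sum>i<dim_vec v. (cmod (v $ i))\<^sup>2)"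
  by (simp add: vnorm2_def sum_nonneg)

lemma vnorm2_eq_0D: "vnorm2 v = 0 \<Longrightarrow> v = 0\<^sub>v (dim_vec v)"
  by (intro eq_vecI) (auto simp: vnorm2_L2_set L2_set_eq_0_iff)

lemma vnorm2_zero [simp]: "vnorm2 (0\<^sub>v n) = 0"
  by (simp add: vnorm2_def)

lemma cip_self: "cip v v = complex_of_real ((vnorm2 v)\<^sup>2)"
  unfolding cip_def vnorm2_square of_real_sum complex_norm_square ..

lemma cmod_cip_le:
  assumes "dim_vec u = dim_vec v"
  shows "cmod (cip u v) \<le> vnorm2 u * vnorm2 v"
proof -
  have "cmod (cip u v) \<le> (\<Sum>i<dim_vec v. \<bar>cmod (u $ i)\<bar> * \<bar>cmod (v $ i)\<bar>)"
    unfolding cip_def by (rule order_trans[OF norm_sum]) (simp add: norm_mult)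
  also have "\<dots> \<le> vnorm2 u * vnorm2 v"
    unfolding vnorm2_L2_set assms by (rule L2_set_mult_ineq)
  finally show ?thesis .
qed

lemma cip_mult_mat_vec:
  assumes A: "A \<in> carrier_mat m n" and u: "u \<in> carrier_vec n" and v: "v \<in> carrier_vec m"
  shows "cip (A *\<^sub>v u) v = cip u (mat_adjoint A *\<^sub>v v)"
proof -
  have A': "mat_adjoint A \<in> carrier_mat n m" using A by simp
  have "cip (A *\<^sub>v u) v = (\<Sum>i<m. \<Sum>j<n. A $$ (i, j) * u $ j * cnj (v $ i))"
    using v unfolding cip_def by (simp add: index_mult_mat_vec_sum[OF A u] sum_distrib_right)
  also have "\<dots> = (\<Sum>j<n. \<Sum>i<m. A $$ (i, j) * u $ j * cnj (v $ i))" by (rule sum.swap)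
  also have "\<dots> = cip u (mat_adjoint A *\<^sub>v v)"
    using A unfolding cip_def
    by (auto simp: index_mult_mat_vec_sum[OF A' v] sum_distrib_left mult_ac simp del: index_mult_mat_vec intro!: sum.cong)
  finally show ?thesis .
qed

lemma vnorm2_square_add:
  assumes "dim_vec u = dim_vec v"
  shows "(vnorm2 (u + v))\<^sup>2 = (vnorm2 u)\<^sup>2 + 2 * Re (cip u v) + (vnorm2 v)\<^sup>2"
  using assms by (simp add: vnorm2_square cip_def cmod_square_add sum.distrib sum_distrib_left)

lemma vnorm2_uminus [simp]: "vnorm2 (- v) = vnorm2 v"
  by (simp add: vnorm2_def)

lemma spec_norm_le:
  assumes "\<And>v. v \<in> carrier_vec (dim_col A) \<Longrightarrow> vnorm2 (A *\<^sub>v v) \<le> b * vnorm2 v" "0 \<le> b"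
  shows "spec_norm A \<le> b"
  unfolding spec_norm_def
proof (rule cSup_least)
  show "{vnorm2 (A *\<^sub>v v) |v. v \<in> carrier_vec (dim_col A) \<and> vnorm2 v \<le> 1} \<noteq> {}"
    by (auto intro!: exI[of _ "0\<^sub>v (dim_col A)"])
  fix x assume "x \<in> {vnorm2 (A *\<^sub>v v) |v. v \<in> carrier_vec (dim_col A) \<and> vnorm2 v \<le> 1}"
  then obtain v where v: "x = vnorm2 (A *\<^sub>v v)" "v \<in> carrier_vec (dim_col A)" "vnorm2 v \<le> 1" by auto
  have "x \<le> b * vnorm2 v" using assms(1) v by simp
  also have "\<dots> \<le> b * 1" using v assms(2) by (intro mult_left_mono)
  finally show "x \<le> b" by simp
qed

text \<open>|A v|^2 is the inner product of \<open>v\<close> with the adjoint of \<open>A\<close>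
  applied to \<open>A v\<close>; Cauchy-Schwarz lets one factor |A v| cancel.\<close>

lemma vnorm2_adjoint_bound:
  assumes A: "A \<in> carrier_mat m n" and b: "\<And>w. w \<in> carrier_vec m \<Longrightarrow> vnorm2 (mat_adjoint A *\<^sub>v w) \<le> b * vnorm2 w"
    and b0: "0 \<le> b" and v: "v \<in> carrier_vec n"
  shows "vnorm2 (A *\<^sub>v v) \<le> b * vnorm2 v"
proof (cases "vnorm2 (A *\<^sub>v v) = 0")
  case True
  then show ?thesis using b0 by simp
next
  case False
  have Av: "A *\<^sub>v v \<in> carrier_vec m" using A v by simp
  have "(vnorm2 (A *\<^sub>v v))\<^sup>2 = cmod (cip (A *\<^sub>v v) (A *\<^sub>v v))" by (simp add: cip_self norm_power)
  also have "\<dots> = cmod (cip v (mat_adjoint A *\<^sub>v (A *\<^sub>v v)))"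
    by (subst cip_mult_mat_vec[OF A v Av]) simp
  also have "\<dots> \<le> vnorm2 v * vnorm2 (mat_adjoint A *\<^sub>v (A *\<^sub>v v))"
    using A v by (intro cmod_cip_le) auto
  also have "\<dots> \<le> vnorm2 v * (b * vnorm2 (A *\<^sub>v v))"
    using b[OF Av] by (intro mult_left_mono) auto
  finally have "vnorm2 (A *\<^sub>v v) * vnorm2 (A *\<^sub>v v) \<le> (b * vnorm2 v) * vnorm2 (A *\<^sub>v v)"
    by (simp add: power2_eq_square mult_ac)
  then show ?thesis using False vnorm2_nonneg[of "A *\<^sub>v v"] by (auto simp: less_le)
qed

lemma mat_inverse_exists:
  fixes A :: "complex mat"
  assumes A: "A \<in> carrier_mat n n" and inj: "\<And>v. v \<in> carrier_vec n \<Longrightarrow> A *\<^sub>v v = 0\<^sub>v n \<Longrightarrow> v = 0\<^sub>v n"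
  obtains B where "B \<in> carrier_mat n n" "A * B = 1\<^sub>m n" "B * A = 1\<^sub>m n"
proof -
  have "det A \<noteq> 0" using det_0_iff_vec_prod_zero_field[OF A] inj by blast
  from det_non_zero_imp_unit[OF A this, of "()"] that show thesis
    unfolding Units_def by (auto simp: ring_mat_def)
qed

text \<open>Multiplying \<open>A * C * A = A\<close> by \<open>B\<close> from both sides forces
  \<open>C = B\<close>, so the definite description is determined.\<close>

lemma pinv_eq_inverse:
  assumes A: "A \<in> carrier_mat n n" and B: "B \<in> carrier_mat n n" and AB: "A * B = 1\<^sub>m n" "B * A = 1\<^sub>m n"
  shows "pinv A = B"
  unfolding pinv_def
proof (rule the_equality)
  show "B \<in> carrier_mat (dim_col A) (dim_row A) \<and> A * B * A = A \<and> B * A * B = B \<and>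
    mat_adjoint (A * B) = A * B \<and> mat_adjoint (B * A) = B * A"
    using A B AB by simp
next
  fix C assume C: "C \<in> carrier_mat (dim_col A) (dim_row A) \<and> A * C * A = A \<and> C * A * C = C \<and>
    mat_adjoint (A * C) = A * C \<and> mat_adjoint (C * A) = C * A"
  then have Cc: "C \<in> carrier_mat n n" using A by simp
  have "C = (B * A) * C * (A * B)" using Cc AB by simp
  also have "\<dots> = B * (A * C * A) * B"
    using A B Cc by (simp add: assoc_mult_mat[of _ n n _ n _ n])
  also have "\<dots> = B" using A B AB C by (simp add: assoc_mult_mat[of _ n n _ n _ n])
  finally show "C = B" .
qed

text \<open>Here \<open>\<Pi> = Yt\<^sup>* (S Yt\<^sup>*)\<^sup>-\<^sup>1 S\<close> is the projection onto the range of \<open>Yt\<^sup>*\<close> along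
  the kernel of \<open>S\<close>, so \<open>X - X0 = (\<Pi> - 1) X0 + Yt\<^sup>* (S Yt\<^sup>*)\<^sup>-\<^sup>1 Z\<close>, and \<open>(\<Pi> - 1) Yt\<^sup>* = 0\<close> turns
  \<open>(\<Pi> - 1) X0\<close> into \<open>- (\<Pi> - 1) Zt\<^sup>* M\<close> for every \<open>M\<close> with \<open>X0 St\<^sup>* M = X0\<close>.\<close>

lemma double_sketch_bound:
  fixes S St Zt X0 Z V0 :: "complex mat"
  defines "Yt \<equiv> St * mat_adjoint X0 + Zt"
  assumes N: "admissible_norm N"
    and S: "S \<in> carrier_mat r n1" and St: "St \<in> carrier_mat r n2" and X0: "X0 \<in> carrier_mat n1 n2"
    and Z: "Z \<in> carrier_mat r n2" and Zt: "Zt \<in> carrier_mat r n1" and V0: "V0 \<in> carrier_mat n2 r0"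
    and V0_orth: "mat_adjoint V0 * V0 = 1\<^sub>m r0" and V0_X0: "X0 * V0 * mat_adjoint V0 = X0"
    and inj: "\<And>c. c \<in> carrier_vec r \<Longrightarrow> mat_adjoint Yt *\<^sub>v c = 0\<^sub>v n1 \<Longrightarrow> c = 0\<^sub>v r"
    and t: "0 < t" and EA: "\<And>c. c \<in> carrier_vec r \<Longrightarrow>
      t * (vnorm2 (mat_adjoint Yt *\<^sub>v c))\<^sup>2 \<le> (vnorm2 (S *\<^sub>v (mat_adjoint Yt *\<^sub>v c)))\<^sup>2"
    and x: "0 < x" "x < 1" and EB: "\<And>v d. v \<in> carrier_vec r \<Longrightarrow> d \<in> carrier_vec n1 \<Longrightarrow> Yt *\<^sub>v d = 0\<^sub>v r \<Longrightarrow>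
      (cmod (cip (mat_adjoint S *\<^sub>v v) d))\<^sup>2 \<le> (1 - x) * (vnorm2 (mat_adjoint S *\<^sub>v v))\<^sup>2 * (vnorm2 d)\<^sup>2"
    and \<tau>: "0 < \<tau>" and EC: "\<And>c. c \<in> carrier_vec r0 \<Longrightarrow> \<tau> * vnorm2 c \<le> vnorm2 (St *\<^sub>v (V0 *\<^sub>v c))"
  shows "N (mat_adjoint Yt * pinv (S * mat_adjoint Yt) * (S * X0 + Z) - X0)
    \<le> N Zt / (sqrt x * \<tau>) + N Z / sqrt t"
proof -
  have N0: "\<And>m n A. A \<in> carrier_mat m n \<Longrightarrow> 0 \<le> N A"
    and Nadd: "\<And>m n A B. A \<in> carrier_mat m n \<Longrightarrow> B \<in> carrier_mat m n \<Longrightarrow> N (A + B) \<le> N A + N B"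
    and Nsc: "\<And>m n A c. A \<in> carrier_mat m n \<Longrightarrow> N (c \<cdot>\<^sub>m A) = cmod c * N A"
    and Nmul: "\<And>m k l A B. A \<in> carrier_mat m k \<Longrightarrow> B \<in> carrier_mat k l \<Longrightarrow> N (A * B) \<le> spec_norm A * N B"
    and Nadj: "\<And>A. N (mat_adjoint A) = N A"
    using N unfolding admissible_norm_def by metis+
  have left: "N (A * B) \<le> b * N B"
    if "A \<in> carrier_mat m k" "B \<in> carrier_mat k l" "0 \<le> b" "\<And>v. v \<in> carrier_vec k \<Longrightarrow> vnorm2 (A *\<^sub>v v) \<le> b * vnorm2 v"
    for A B :: "complex mat" and m k l b
  proof -
    have "spec_norm A \<le> b" using that by (intro spec_norm_le) auto
    then have "spec_norm A * N B \<le> b * N B" using N0[OF that(2)] by (intro mult_right_mono)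
    then show ?thesis using Nmul[OF that(1,2)] by linarith
  qed
  define Y' where "Y' = mat_adjoint Yt"
  have Yt: "Yt \<in> carrier_mat r n1" using St X0 Zt by (simp add: Yt_def)
  have Y': "Y' \<in> carrier_mat n1 r" using Yt by (simp add: Y'_def)
  define A where "A = S * Y'"
  have A: "A \<in> carrier_mat r r" using S Y' by (simp add: A_def)
  \<comment> \<open>\<open>EA\<close> with positive \<open>t\<close> makes \<open>S\<close>
    injective on the range of \<open>Y'\<close>, and \<open>Y'\<close> is injective, so the square
    product is invertible and the pseudo-inverse is an inverse.\<close>
  obtain Ai where Ai: "Ai \<in> carrier_mat r r" "A * Ai = 1\<^sub>m r" "Ai * A = 1\<^sub>m r"
  proof (rule mat_inverse_exists[OF A])
    fix c assume c: "c \<in> carrier_vec r" "A *\<^sub>v c = 0\<^sub>v r"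
    have "S *\<^sub>v (Y' *\<^sub>v c) = 0\<^sub>v r" using c S Y' by (simp add: A_def)
    then have "t * (vnorm2 (Y' *\<^sub>v c))\<^sup>2 \<le> 0" using EA[OF c(1)] by (simp add: Y'_def)
    then have "vnorm2 (Y' *\<^sub>v c) = 0" using t by (simp add: mult_le_0_iff)
    then have "Y' *\<^sub>v c = 0\<^sub>v n1" using vnorm2_eq_0D[of "Y' *\<^sub>v c"] Y' by simp
    then show "c = 0\<^sub>v r" using inj[OF c(1)] by (simp add: Y'_def)
  qed auto
  have pinv: "pinv (S * mat_adjoint Yt) = Ai"
    using pinv_eq_inverse[OF A Ai(1,2,3)] by (simp add: A_def Y'_def)
  define L where "L = Y' * Ai"
  have L: "L \<in> carrier_mat n1 r" using Y' Ai by (simp add: L_def)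
  define E where "E = L * S - 1\<^sub>m n1"
  have LS: "L * S \<in> carrier_mat n1 n1" using L S by simp
  have E: "E \<in> carrier_mat n1 n1" unfolding E_def by (rule minus_carrier_mat) simp
  have EY: "E * Y' = 0\<^sub>m n1 r"
  proof -
    have "E * Y' = L * S * Y' - 1\<^sub>m n1 * Y'" unfolding E_def by (rule minus_mult_distrib_mat[OF LS _ Y']) simp
    also have "L * S * Y' = Y' * (Ai * A)"
      unfolding L_def A_def using Y' Ai S
      by (simp add: assoc_mult_mat[of Y' n1 r Ai r "S" n1] assoc_mult_mat[of Y' n1 r "Ai * S" n1 Y' r] assoc_mult_mat[of Ai r r S n1 Y' r])
    finally show ?thesis using Ai Y' by (simp add: minus_r_inv_mat)
  qed
  have Lbound: "vnorm2 (L *\<^sub>v w) \<le> (1 / sqrt t) * vnorm2 w" if w: "w \<in> carrier_vec r" for w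
  proof -
    have Aw: "Ai *\<^sub>v w \<in> carrier_vec r" using Ai w by simp
    have "(A * Ai) *\<^sub>v w = A *\<^sub>v (Ai *\<^sub>v w)" by (rule assoc_mult_mat_vec[OF A Ai(1) w])
    also have "\<dots> = S *\<^sub>v (Y' *\<^sub>v (Ai *\<^sub>v w))" unfolding A_def by (rule assoc_mult_mat_vec[OF S Y' Aw])
    finally have "S *\<^sub>v (Y' *\<^sub>v (Ai *\<^sub>v w)) = w" using Ai w by simp
    then have "t * (vnorm2 (L *\<^sub>v w))\<^sup>2 \<le> (vnorm2 w)\<^sup>2"
      using EA[OF Aw] Y' Ai w by (simp add: L_def Y'_def[symmetric])
    then have "(vnorm2 (L *\<^sub>v w))\<^sup>2 \<le> ((1 / sqrt t) * vnorm2 w)\<^sup>2"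
      using t by (simp add: power_mult_distrib power_divide field_simps)
    then show ?thesis by (rule power2_le_imp_le) (use t in simp)
  qed
  \<comment> \<open>The norm of the complement of an oblique projection is governed by an angle. The
    adjoint of \<open>E\<close> sends \<open>u\<close> to \<open>- d\<close>, where
    \<open>u = s + d\<close>, \<open>s\<close> lies in the range of the adjoint of \<open>S\<close>,
    and \<open>Yt\<close> annihilates \<open>d\<close>. By \<open>EB\<close> the squared cosine
    between \<open>s\<close> and \<open>d\<close> is at most 1 - x, which bounds |d| by |u| / sqrt
    x.\<close>
  have E'bound: "vnorm2 (mat_adjoint E *\<^sub>v u) \<le> (1 / sqrt x) * vnorm2 u" if u: "u \<in> carrier_vec n1" for u
  proof -
    have adj: "mat_adjoint E = mat_adjoint S * mat_adjoint L - 1\<^sub>m n1"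
      unfolding E_def mat_adjoint_mult[OF L S, symmetric] using mat_adjoint_minus[OF LS, of "1\<^sub>m n1"] by simp
    define v where "v = mat_adjoint L *\<^sub>v u"
    define s where "s = mat_adjoint S *\<^sub>v v"
    define d where "d = u - s"
    have c1: "mat_adjoint L \<in> carrier_mat r n1" "mat_adjoint S \<in> carrier_mat n1 r" using L S by auto
    have c2: "v \<in> carrier_vec r" unfolding v_def by (rule mult_mat_vec_carrier[OF c1(1) u])
    have c3: "s \<in> carrier_vec n1" unfolding s_def by (rule mult_mat_vec_carrier[OF c1(2) c2])
    have c4: "d \<in> carrier_vec n1" using u c3 by (simp add: d_def)
    note c = c1 c2 c3 c4
    have Eu: "mat_adjoint E *\<^sub>v u = - d"
    proof -
      have "mat_adjoint E *\<^sub>v u = (mat_adjoint S * mat_adjoint L) *\<^sub>v u - 1\<^sub>m n1 *\<^sub>v u"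
        unfolding adj using c u by (intro minus_mult_distrib_mat_vec) auto
      also have "(mat_adjoint S * mat_adjoint L) *\<^sub>v u = s"
        unfolding s_def v_def by (rule assoc_mult_mat_vec[OF c(2,1) u])
      finally show ?thesis using c u by (auto simp: d_def)
    qed
    have "Yt *\<^sub>v s = Yt *\<^sub>v u"
    proof -
      have SY: "S * Y' \<in> carrier_mat r r" using S Y' by simp
      have Y'': "mat_adjoint Y' = Yt" by (simp add: Y'_def)
      have "Yt * (mat_adjoint S * mat_adjoint L) = mat_adjoint (L * (S * Y'))"
        unfolding mat_adjoint_mult[OF L SY] mat_adjoint_mult[OF S Y'] Y''
        by (rule assoc_mult_mat[OF Yt c(2) c(1), symmetric])
      also have "L * (S * Y') = Y' * (Ai * A)"
        unfolding A_def[symmetric] L_def by (rule assoc_mult_mat[OF Y' Ai(1) A])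
      also have "\<dots> = Y'" using Ai Y' by simp
      finally have "Yt * (mat_adjoint S * mat_adjoint L) = Yt" by (simp only: Y'')
      moreover have "Yt *\<^sub>v s = (Yt * (mat_adjoint S * mat_adjoint L)) *\<^sub>v u"
        by (simp only: s_def v_def assoc_mult_mat_vec[OF Yt mult_carrier_mat[OF c(2,1)] u] assoc_mult_mat_vec[OF c(2,1) u])
      ultimately show ?thesis by simp
    qed
    then have "Yt *\<^sub>v d = 0\<^sub>v r"
      unfolding d_def using Yt u c by (simp add: mult_minus_distrib_mat_vec[of Yt r n1])
    from EB[OF c(3,5) this] have eb: "(cmod (cip s d))\<^sup>2 \<le> (1 - x) * (vnorm2 s)\<^sup>2 * (vnorm2 d)\<^sup>2"
      by (simp add: s_def)
    have us: "u = s + d" using u c by (auto simp: d_def)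
    have "(vnorm2 u)\<^sup>2 = (vnorm2 s)\<^sup>2 + 2 * Re (cip s d) + (vnorm2 d)\<^sup>2"
      unfolding us using c by (intro vnorm2_square_add) auto
    moreover have "- Re (cip s d) \<le> sqrt (1 - x) * vnorm2 s * vnorm2 d"
    proof -
      have "(cmod (cip s d))\<^sup>2 \<le> (sqrt (1 - x) * vnorm2 s * vnorm2 d)\<^sup>2"
        using eb x by (simp add: power_mult_distrib)
      then have "cmod (cip s d) \<le> sqrt (1 - x) * vnorm2 s * vnorm2 d"
        by (rule power2_le_imp_le) (use x in simp)
      then show ?thesis using abs_Re_le_cmod[of "cip s d"] by linarith
    qed
    \<comment> \<open>This square absorbs the cross term: |s|^2 and (1 - x) |d|^2 are spent on it,
      and x |d|^2 remains below |u|^2.\<close>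
    moreover have "0 \<le> (vnorm2 s - sqrt (1 - x) * vnorm2 d)\<^sup>2" by simp
    then have "2 * (sqrt (1 - x) * vnorm2 s * vnorm2 d) \<le> (vnorm2 s)\<^sup>2 + (1 - x) * (vnorm2 d)\<^sup>2"
      using x by (simp add: power2_diff power_mult_distrib mult_ac)
    ultimately have "x * (vnorm2 d)\<^sup>2 \<le> (vnorm2 u)\<^sup>2" by (simp add: algebra_simps)
    then have "(vnorm2 d)\<^sup>2 \<le> ((1 / sqrt x) * vnorm2 u)\<^sup>2"
      using x by (simp add: power_mult_distrib power_divide field_simps)
    then have "vnorm2 d \<le> (1 / sqrt x) * vnorm2 u" by (rule power2_le_imp_le) (use x in simp)
    then show ?thesis by (simp add: Eu)
  qed
  have Ebound: "vnorm2 (E *\<^sub>v v) \<le> (1 / sqrt x) * vnorm2 v" if "v \<in> carrier_vec n1" for v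
    using vnorm2_adjoint_bound[OF E E'bound _ that] x by simp

  define V' where "V' = mat_adjoint V0"
  have V': "V' \<in> carrier_mat r0 n2" using V0 by (simp add: V'_def)
  define T where "T = St * V0"
  have T1: "T \<in> carrier_mat r r0" using St V0 by (simp add: T_def)
  note T = T1 carrier_mat_adjoint[OF T1]
  have TT: "mat_adjoint T * T \<in> carrier_mat r0 r0" by (rule mult_carrier_mat[OF T(2,1)])
  have Tb: "\<tau> * vnorm2 c \<le> vnorm2 (T *\<^sub>v c)" if "c \<in> carrier_vec r0" for c
    using EC[OF that] St V0 that by (simp add: T_def)
  have Tself: "(vnorm2 (T *\<^sub>v c))\<^sup>2 = Re (cip c ((mat_adjoint T * T) *\<^sub>v c))" if "c \<in> carrier_vec r0" for c
  proof -
    have "cip (T *\<^sub>v c) (T *\<^sub>v c) = cip c (mat_adjoint T *\<^sub>v (T *\<^sub>v c))"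
      using T that by (intro cip_mult_mat_vec) auto
    also have "mat_adjoint T *\<^sub>v (T *\<^sub>v c) = (mat_adjoint T * T) *\<^sub>v c"
      by (rule assoc_mult_mat_vec[OF T(2,1) that, symmetric])
    finally have "complex_of_real ((vnorm2 (T *\<^sub>v c))\<^sup>2) = cip c ((mat_adjoint T * T) *\<^sub>v c)" by (simp only: cip_self)
    then show ?thesis by (metis Re_complex_of_real)
  qed
  obtain Ti where Ti: "Ti \<in> carrier_mat r0 r0" "mat_adjoint T * T * Ti = 1\<^sub>m r0" "Ti * (mat_adjoint T * T) = 1\<^sub>m r0"
  proof (rule mat_inverse_exists[OF TT])
    fix c assume c: "c \<in> carrier_vec r0" "mat_adjoint T * T *\<^sub>v c = 0\<^sub>v r0"
    have "(vnorm2 (T *\<^sub>v c))\<^sup>2 = 0" unfolding Tself[OF c(1)] c(2) by (simp add: cip_def)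
    then have "\<tau> * vnorm2 c \<le> 0" using Tb[OF c(1)] by simp
    then have "vnorm2 c = 0" using \<tau> vnorm2_nonneg[of c] by (simp add: mult_le_0_iff)
    then show "c = 0\<^sub>v r0" using vnorm2_eq_0D[of c] c by simp
  qed auto
  \<comment> \<open>The matrix \<open>M\<close> of the identity
    \<open>X0 * mat_adjoint St * M = X0\<close>. The adjoint of \<open>T\<close> times
    \<open>M\<close> equals \<open>V'\<close>, since \<open>Ti\<close> inverts the Gram matrix of
    \<open>T\<close>, and \<open>X0 * V0 * V' = X0\<close>. Its norm is at most 1 / \<tau>, the
    inverse of the lower bound for \<open>St\<close> on the row space of \<open>X0\<close>.\<close>
  define M where "M = T * (Ti * V')"
  have TiV: "Ti * V' \<in> carrier_mat r0 n2" using Ti V' by simp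
  have M: "M \<in> carrier_mat r n2" using T TiV by (simp add: M_def)
  have XM: "X0 * mat_adjoint St * M = X0"
  proof -
    have St': "mat_adjoint St \<in> carrier_mat n2 r" using St by simp
    have "X0 * mat_adjoint St = X0 * V0 * V' * mat_adjoint St" using V0_X0 by (simp add: V'_def)
    also have "\<dots> = X0 * V0 * (V' * mat_adjoint St)"
      using X0 V0 V' St' by (intro assoc_mult_mat[of _ n1 r0 _ n2 _ r]) auto
    also have "V' * mat_adjoint St = mat_adjoint T"
      by (simp only: T_def V'_def mat_adjoint_mult[OF St V0])
    finally have "X0 * mat_adjoint St * M = X0 * V0 * mat_adjoint T * M" by simp
    also have "\<dots> = X0 * V0 * (mat_adjoint T * M)"
      using X0 V0 T M by (intro assoc_mult_mat[of _ n1 r0 _ r _ n2]) auto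
    also have "mat_adjoint T * M = mat_adjoint T * T * Ti * V'"
      by (simp only: M_def assoc_mult_mat[OF T(2) T(1) TiV, symmetric] assoc_mult_mat[OF TT Ti(1) V', symmetric])
    also have "\<dots> = V'" using Ti V' by simp
    finally show ?thesis using V0_X0 by (simp add: V'_def)
  qed
  have V'b: "vnorm2 (V' *\<^sub>v w) \<le> vnorm2 w" if w: "w \<in> carrier_vec n2" for w
  proof -
    have Vc: "vnorm2 (V0 *\<^sub>v c) \<le> 1 * vnorm2 c" if c: "c \<in> carrier_vec r0" for c
    proof -
      have "cip (V0 *\<^sub>v c) (V0 *\<^sub>v c) = cip c (mat_adjoint V0 *\<^sub>v (V0 *\<^sub>v c))"
        using V0 c by (intro cip_mult_mat_vec) auto
      also have "mat_adjoint V0 *\<^sub>v (V0 *\<^sub>v c) = (mat_adjoint V0 * V0) *\<^sub>v c"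
        by (rule assoc_mult_mat_vec[OF carrier_mat_adjoint[OF V0] V0 c, symmetric])
      finally have "complex_of_real ((vnorm2 (V0 *\<^sub>v c))\<^sup>2) = complex_of_real ((vnorm2 c)\<^sup>2)"
        using c by (simp only: cip_self V0_orth one_mult_mat_vec)
      then have "(vnorm2 (V0 *\<^sub>v c))\<^sup>2 = (vnorm2 c)\<^sup>2" by (simp only: of_real_eq_iff)
      then have "vnorm2 (V0 *\<^sub>v c) = vnorm2 c" by (rule power2_eq_imp_eq) simp_all
      then show ?thesis by simp
    qed
    have "vnorm2 (V' *\<^sub>v w) \<le> 1 * vnorm2 w"
      using Vc V0 by (intro vnorm2_adjoint_bound[OF V' _ _ w]) (simp_all add: V'_def)
    then show ?thesis by simp
  qed
  have Mbound: "vnorm2 (M *\<^sub>v w) \<le> (1 / \<tau>) * vnorm2 w" if w: "w \<in> carrier_vec n2" for w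
  proof -
    define c where "c = (Ti * V') *\<^sub>v w"
    have c: "c \<in> carrier_vec r0" using TiV w by (simp add: c_def)
    have V'w: "V' *\<^sub>v w \<in> carrier_vec r0" using V' w by simp
    have Mw: "M *\<^sub>v w = T *\<^sub>v c" unfolding M_def c_def using T TiV w by (intro assoc_mult_mat_vec) auto
    have "(mat_adjoint T * T) *\<^sub>v c = (mat_adjoint T * T * Ti) *\<^sub>v (V' *\<^sub>v w)"
      by (simp only: c_def assoc_mult_mat_vec[OF Ti(1) V' w] assoc_mult_mat_vec[OF TT Ti(1) V'w])
    then have "(mat_adjoint T * T) *\<^sub>v c = V' *\<^sub>v w" using Ti V'w by simp
    then have "(vnorm2 (T *\<^sub>v c))\<^sup>2 = Re (cip c (V' *\<^sub>v w))" using Tself[OF c] by simp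
    also have "\<dots> \<le> cmod (cip c (V' *\<^sub>v w))" by (rule complex_Re_le_cmod)
    also have "\<dots> \<le> vnorm2 c * vnorm2 (V' *\<^sub>v w)" using c V' by (intro cmod_cip_le) auto
    also have "\<dots> \<le> (vnorm2 (T *\<^sub>v c) / \<tau>) * vnorm2 w"
      using Tb[OF c] \<tau> V'b[OF w] by (intro mult_mono) (auto simp: field_simps)
    finally have *: "vnorm2 (T *\<^sub>v c) * vnorm2 (T *\<^sub>v c) \<le> (1 / \<tau>) * vnorm2 w * vnorm2 (T *\<^sub>v c)"
      by (simp add: power2_eq_square mult_ac)
    show ?thesis
    proof (cases "vnorm2 (T *\<^sub>v c) = 0")
      case True
      then show ?thesis unfolding Mw using \<tau> by simp
    next
      case False
      then have "0 < vnorm2 (T *\<^sub>v c)" by (simp add: less_le)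
      then show ?thesis unfolding Mw by (rule mult_right_le_imp_le[OF *])
    qed
  qed

  have Zt': "mat_adjoint Zt \<in> carrier_mat n1 r" using Zt by simp
  have Y'eq: "Y' = X0 * mat_adjoint St + mat_adjoint Zt"
  proof -
    have "mat_adjoint (St * mat_adjoint X0) = X0 * mat_adjoint St"
      using mat_adjoint_mult[OF St carrier_mat_adjoint[OF X0]] by simp
    moreover have "mat_adjoint (St * mat_adjoint X0 + Zt) = mat_adjoint (St * mat_adjoint X0) + mat_adjoint Zt"
      using mat_adjoint_add[OF mult_carrier_mat[OF St carrier_mat_adjoint[OF X0]] Zt] .
    ultimately show ?thesis by (simp only: Y'_def Yt_def)
  qed
  define ZM where "ZM = mat_adjoint Zt * M"
  have ZM: "ZM \<in> carrier_mat n1 n2" using Zt' M by (simp add: ZM_def)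
  have EX: "E * X0 = - (E * ZM)"
  proof -
    have XS: "X0 * mat_adjoint St \<in> carrier_mat n1 r"
      by (rule mult_carrier_mat[OF X0]) (use St in simp)
    have "Y' * M = X0 + ZM"
      by (simp only: Y'eq ZM_def add_mult_distrib_mat[OF XS Zt' M] XM)
    moreover have "E * (Y' * M) = 0\<^sub>m n1 n2"
      by (simp only: assoc_mult_mat[OF E Y' M, symmetric] EY left_mult_zero_mat[OF M])
    ultimately have "E * X0 + E * ZM = 0\<^sub>m n1 n2"
      using E X0 ZM by (simp add: mult_add_distrib_mat[of E n1 n1])
    then have s: "(E * X0 + E * ZM) $$ (i, j) = 0" if "i < n1" "j < n2" for i j using that by simp
    show ?thesis
    proof (rule eq_matI)
      fix i j assume ij: "i < dim_row (- (E * ZM))" "j < dim_col (- (E * ZM))"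
      then have "i < n1" "j < n2" using E ZM by auto
      from s[OF this] show "(E * X0) $$ (i, j) = (- (E * ZM)) $$ (i, j)"
        using E X0 ZM \<open>i < n1\<close> \<open>j < n2\<close> by (simp add: eq_neg_iff_add_eq_0 del: index_mult_mat(1))
    qed (use E X0 ZM in auto)
  qed
  have NE: "N (E * X0) \<le> N Zt / (sqrt x * \<tau>)"
  proof -
    have EZ: "E * ZM \<in> carrier_mat n1 n2" using E ZM by simp
    have "- (E * ZM) = (-1) \<cdot>\<^sub>m (E * ZM)" by (intro eq_matI) auto
    then have "N (E * X0) = N (E * ZM)" unfolding EX using Nsc[OF EZ, of "-1"] by simp
    also have "\<dots> \<le> (1 / sqrt x) * N ZM" using x Ebound by (intro left[OF E ZM]) auto
    \<comment> \<open>An admissible norm bounds a product by the spectral norm of the left factor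
      only; passing to the adjoint moves \<open>M\<close> to the left.\<close>
    also have "N ZM = N (mat_adjoint M * Zt)"
      using Nadj[of ZM] by (simp add: ZM_def mat_adjoint_mult[OF Zt' M])
    also have "N (mat_adjoint M * Zt) \<le> (1 / \<tau>) * N Zt"
    proof (rule left[OF _ Zt])
      show "mat_adjoint M \<in> carrier_mat n2 r" using M by simp
      fix v :: "complex Matrix.vec" assume v: "v \<in> carrier_vec r"
      show "vnorm2 (mat_adjoint M *\<^sub>v v) \<le> 1 / \<tau> * vnorm2 v"
      proof (rule vnorm2_adjoint_bound[OF carrier_mat_adjoint[OF M] _ _ v])
        show "0 \<le> 1 / \<tau>" using \<tau> by simp
        fix w :: "complex Matrix.vec" assume "w \<in> carrier_vec n2"
        then show "vnorm2 (mat_adjoint (mat_adjoint M) *\<^sub>v w) \<le> 1 / \<tau> * vnorm2 w"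
          unfolding mat_adjoint_adjoint by (rule Mbound)
      qed
    qed (use \<tau> in auto)
    finally show ?thesis using x by (simp add: mult_left_mono field_simps)
  qed
  have NZ: "N (L * Z) \<le> N Z / sqrt t"
    using left[OF L Z _ Lbound] t by simp
  have "Y' * Ai * (S * X0 + Z) - X0 = E * X0 + L * Z"
  proof -
    have SX: "S * X0 \<in> carrier_mat r n2" using S X0 by simp
    have "Y' * Ai * (S * X0 + Z) = L * (S * X0) + L * Z"
      unfolding L_def[symmetric] by (rule mult_add_distrib_mat[OF L SX Z])
    moreover have "L * (S * X0) = L * S * X0" using L S X0 by (simp add: assoc_mult_mat[of L n1 r S n1 X0 n2])
    moreover have "E * X0 = L * S * X0 - X0"
      unfolding E_def using LS X0 by (simp add: minus_mult_distrib_mat[of _ n1 n1])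
    moreover have "L * S * X0 + L * Z - X0 = (L * S * X0 - X0) + L * Z"
      using L S X0 Z by (intro eq_matI) auto
    ultimately show ?thesis by simp
  qed
  then have "N (Y' * Ai * (S * X0 + Z) - X0) \<le> N (E * X0) + N (L * Z)"
    using Nadd[of "E * X0" n1 n2 "L * Z"] E X0 L Z by simp
  with NE NZ show ?thesis unfolding pinv unfolding Y'_def[symmetric] by linarith
qed

section \<open>Rank in coordinates\<close>

text \<open>A maximal independent set of columns spans all columns and has \<open>mrank A\<close>
  elements; listing it as a matrix \<open>B\<close> turns the abstract rank into sums and an
  injectivity statement.\<close>

lemma column_basis:
  fixes A :: "complex mat"
  assumes A: "A \<in> carrier_mat m k"
  obtains B where "B \<in> carrier_mat m (mrank A)"
    "\<And>j. j < k \<Longrightarrow> \<exists>a. \<forall>i<m. A $$ (i, j) = (\<Sum>l<mrank A. a l * B $$ (i, l))"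
    "\<And>l. l < mrank A \<Longrightarrow> \<exists>j<k. col B l = col A j"
    "\<And>v. v \<in> carrier_vec (mrank A) \<Longrightarrow> B *\<^sub>v v = 0\<^sub>v m \<Longrightarrow> v = 0\<^sub>v (mrank A)"
proof -
  interpret vec_space "TYPE(complex)" m .
  let ?P = "\<lambda>T. T \<subseteq> set (cols A) \<and> lin_indpt T"
  have cA: "set (cols A) \<subseteq> carrier_vec m" using A cols_dim by blast
  obtain U where U: "finite U" "maximal U ?P"
    using maximal_exists_superset[of "set (cols A)" ?P "{}"] finite_lin_indpt2[of "{}"] by auto
  then have Us: "U \<subseteq> set (cols A)" "lin_indpt U" by (auto simp: maximal_def)
  have cU: "U \<subseteq> carrier_vec m" using Us cA by blast
  have rk: "mrank A = card U"
    using rank_card_indpt[OF A U(2)] A by (simp add: mrank_def)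
  have span: "w \<in> span U" if "w \<in> set (cols A)" for w
  proof (rule ccontr)
    assume w: "w \<notin> span U"
    then have "w \<notin> U" using span_mem[OF cU] by blast
    then have "lin_indpt (U \<union> {w})"
      using lin_dep_iff_in_span[OF cU Us(2) _ \<open>w \<notin> U\<close>] w cA that by blast
    then have "U = U \<union> {w}" using U(2) Us that unfolding maximal_def by blast
    then show False using \<open>w \<notin> U\<close> by blast
  qed
  obtain bs where bs: "set bs = U" "distinct bs" using finite_distinct_list[OF U(1)] by auto
  have len: "length bs = mrank A" using bs rk distinct_card by metis
  define B where "B = mat_of_cols m bs"
  have B: "B \<in> carrier_mat m (mrank A)" by (simp add: B_def len[symmetric])
  have colsB: "cols B = bs" unfolding B_def using bs cU by (intro cols_mat_of_cols) auto
  have Bi: "B $$ (i, l) = (bs ! l) $ i" if "i < m" "l < mrank A" for i l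
    using that len by (simp add: B_def mat_of_cols_index)
  show thesis
  proof (rule that[OF B])
    fix j assume j: "j < k"
    have "col A j \<in> span U" using span A j by (simp add: cols_def)
    then obtain a where a: "lincomb a U = col A j" using finite_in_span[OF U(1) cU] by auto
    have "A $$ (i, j) = (\<Sum>l<mrank A. a (bs ! l) * B $$ (i, l))" if i: "i < m" for i
    proof -
      have "A $$ (i, j) = lincomb a U $ i" unfolding a using A i j by simp
      also have "\<dots> = (\<Sum>x\<in>U. a x * x $ i)" by (rule lincomb_index[OF i cU])
      also have "\<dots> = (\<Sum>l<mrank A. a (bs ! l) * (bs ! l) $ i)"
        using bs len by (intro sum.reindex_bij_betw[symmetric, of "nth bs"] bij_betw_nth) auto
      finally show ?thesis using i by (simp add: Bi)
    qed
    then show "\<exists>a. \<forall>i<m. A $$ (i, j) = (\<Sum>l<mrank A. a l * B $$ (i, l))"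
      by (intro exI[of _ "\<lambda>l. a (bs ! l)"]) simp
  next
    fix l assume l: "l < mrank A"
    have "bs ! l \<in> set (cols A)" using l len bs Us by (metis nth_mem subsetD)
    then obtain j where "j < k" "bs ! l = col A j" using A by (auto simp: cols_def)
    moreover have "col B l = bs ! l" using colsB l B by (metis carrier_matD(2) cols_nth)
    ultimately show "\<exists>j<k. col B l = col A j" by auto
  next
    fix v assume v: "v \<in> carrier_vec (mrank A)" "B *\<^sub>v v = 0\<^sub>v m"
    show "v = 0\<^sub>v (mrank A)"
      using lin_depI[OF B v(1) _ v(2)] Us(2) bs by (auto simp: colsB)
  qed
qed

text \<open>With full row rank the basis \<open>B\<close> of \<open>column_basis\<close> is square
  and invertible. Its columns are columns of \<open>A\<close>, so every entry of the adjoint of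
  \<open>B\<close> applied to \<open>c\<close> is an entry of the adjoint of \<open>A\<close>
  applied to \<open>c\<close>.\<close>

lemma adjoint_injective_of_full_row_rank:
  fixes A :: "complex mat"
  assumes A: "A \<in> carrier_mat m k" and rk: "mrank A = m"
    and c: "c \<in> carrier_vec m" and 0: "mat_adjoint A *\<^sub>v c = 0\<^sub>v k"
  shows "c = 0\<^sub>v m"
proof -
  obtain B where B: "B \<in> carrier_mat m m" "\<And>l. l < m \<Longrightarrow> \<exists>j<k. col B l = col A j"
    "\<And>v. v \<in> carrier_vec m \<Longrightarrow> B *\<^sub>v v = 0\<^sub>v m \<Longrightarrow> v = 0\<^sub>v m"
    using column_basis[OF A] unfolding rk by metis
  obtain C where C: "C \<in> carrier_mat m m" "B * C = 1\<^sub>m m"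
    using mat_inverse_exists[OF B(1,3)] by metis
  have Ac: "mat_adjoint A \<in> carrier_mat k m" "mat_adjoint B \<in> carrier_mat m m" using A B by auto
  have "mat_adjoint B *\<^sub>v c = 0\<^sub>v m"
  proof (rule eq_vecI)
    fix l assume "l < dim_vec (0\<^sub>v m :: complex Matrix.vec)"
    then have l: "l < m" by simp
    then obtain j where j: "j < k" "col B l = col A j" using B(2) by blast
    have "B $$ (i, l) = A $$ (i, j)" if "i < m" for i
      using j l that A B by (metis carrier_matD(1) carrier_matD(2) index_col)
    then have "(mat_adjoint B *\<^sub>v c) $ l = (mat_adjoint A *\<^sub>v c) $ j"
      using l j A B c index_mult_mat_vec_sum[OF Ac(1) c j(1)] index_mult_mat_vec_sum[OF Ac(2) c l] by simp
    then show "(mat_adjoint B *\<^sub>v c) $ l = 0\<^sub>v m $ l" using 0 j l by simp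
  qed (use B in simp)
  moreover have "mat_adjoint C * mat_adjoint B = 1\<^sub>m m"
    using B C by (simp add: mat_adjoint_mult[symmetric, of B m m C m])
  ultimately have "1\<^sub>m m *\<^sub>v c = mat_adjoint C *\<^sub>v 0\<^sub>v m"
    using assoc_mult_mat_vec[of "mat_adjoint C" m m "mat_adjoint B" m c] B C c by simp
  also have "\<dots> = 0\<^sub>v m" using C(1) by (intro eq_vecI) (auto simp: scalar_prod_def)
  finally show ?thesis using c by simp
qed

text \<open>\<open>X0\<close> factors as \<open>B\<close> times the transpose of a matrix
  \<open>C\<close> with \<open>mrank X0\<close> columns. The QR step empties the rows of
  \<open>V * C\<close> from the rank on, hence those of \<open>V\<close> times the transpose of
  \<open>X0\<close>.\<close>

lemma gauss_unitary_row_space: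
  assumes X0: "X0 \<in> carrier_mat n1 n2" and rk: "mrank X0 \<le> n2"
  shows "\<exists>V. gauss_unitary n2 V \<and>
    (\<forall>a l. a < n1 \<longrightarrow> mrank X0 \<le> l \<longrightarrow> l < n2 \<longrightarrow> (\<Sum>j<n2. V $$ (l, j) * X0 $$ (a, j)) = 0)"
proof -
  let ?r = "mrank X0"
  obtain B where B: "B \<in> carrier_mat n1 ?r"
    "\<And>j. j < n2 \<Longrightarrow> \<exists>a. \<forall>i<n1. X0 $$ (i, j) = (\<Sum>l<?r. a l * B $$ (i, l))"
    using column_basis[OF X0] by metis
  then obtain a where a: "\<And>i j. i < n1 \<Longrightarrow> j < n2 \<Longrightarrow> X0 $$ (i, j) = (\<Sum>l<?r. a j l * B $$ (i, l))"
    by metis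
  define C where "C = mat n2 ?r (\<lambda>(j, l). a j l)"
  have C: "C \<in> carrier_mat n2 ?r" by (simp add: C_def)
  obtain V where V: "gauss_unitary n2 V" "\<And>i l. ?r \<le> i \<Longrightarrow> i < n2 \<Longrightarrow> l < ?r \<Longrightarrow> (V * C) $$ (i, l) = 0"
    using gauss_unitary_QR[OF C rk] by blast
  have Vc: "V \<in> carrier_mat n2 n2" using V(1) by (rule gauss_unitary_carrier)
  have "(\<Sum>j<n2. V $$ (l, j) * X0 $$ (i, j)) = 0" if "i < n1" "?r \<le> l" "l < n2" for i l
  proof -
    have VC: "(\<Sum>j<n2. V $$ (l, j) * a j p) = 0" if "p < ?r" for p
    proof -
      have "(V * C) $$ (l, p) = (\<Sum>j<n2. V $$ (l, j) * a j p)"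
        using that \<open>l < n2\<close> Vc by (auto simp: scalar_prod_def lessThan_atLeast0 C_def intro!: sum.cong)
      then show ?thesis using V(2)[of l p] that \<open>?r \<le> l\<close> \<open>l < n2\<close> by simp
    qed
    have "(\<Sum>j<n2. V $$ (l, j) * X0 $$ (i, j)) = (\<Sum>j<n2. \<Sum>p<?r. V $$ (l, j) * a j p * B $$ (i, p))"
      using that by (intro sum.cong) (auto simp: a sum_distrib_left mult.assoc)
    also have "\<dots> = (\<Sum>p<?r. (\<Sum>j<n2. V $$ (l, j) * a j p) * B $$ (i, p))"
      by (subst sum.swap) (simp add: sum_distrib_right)
    also have "\<dots> = 0" using VC by simp
    finally show ?thesis .
  qed
  with V(1) show ?thesis by blast
qed

lemma nn_integral_contracts_restrict:
  assumes "n \<le> n'"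
  shows "(\<integral>\<^sup>+G. indicator {G. contracts m n t G} G \<partial>gauss ({..<m} \<times> {..<n'}))
    = (\<integral>\<^sup>+G. indicator {G. contracts m n t G} G \<partial>gauss ({..<m} \<times> {..<n}))"
proof -
  let ?I = "{..<m} \<times> {..<n}" and ?J = "{..<m} \<times> {n..<n'}"
  have un: "{..<m} \<times> {..<n'} = ?I \<union> ?J" using assms by auto
  have dis: "?I \<inter> ?J = {}" "finite ?I" "finite ?J" by auto
  have m: "(\<lambda>G. indicator {G. contracts m n t G} G :: ennreal) \<in> borel_measurable (gauss (?I \<union> ?J))"
    unfolding un[symmetric] by (rule measurable_indicator_contracts[OF assms])
  have mg: "contracts m n t (merge ?I ?J (x, y)) = contracts m n t x" for x y
  proof -
    have "apply_mat n (merge ?I ?J (x, y)) v i = apply_mat n x v i" if "i < m" for v i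
      using that by (simp add: apply_mat_def merge_def)
    then show ?thesis by (simp add: contracts_def sqnorm_def)
  qed
  have "(\<integral>\<^sup>+G. indicator {G. contracts m n t G} G \<partial>gauss ({..<m} \<times> {..<n'}))
     = (\<integral>\<^sup>+x. \<integral>\<^sup>+y. indicator {G. contracts m n t G} (merge ?I ?J (x, y)) \<partial>gauss ?J \<partial>gauss ?I)"
    unfolding un by (rule cgauss_PiM.product_nn_integral_fold[OF dis m])
  also have "\<dots> = (\<integral>\<^sup>+x. \<integral>\<^sup>+y. indicator {G. contracts m n t G} x \<partial>gauss ?J \<partial>gauss ?I)"
    by (rule nn_integral_cong, rule nn_integral_cong) (simp add: indicator_def mg)
  finally show ?thesis unfolding nn_integral_gauss_const .
qed

lemma ennreal_le_one_minus:
  fixes a b :: ennreal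
  assumes "a + b = 1" "ennreal q \<le> b" "0 \<le> q"
  shows "a \<le> ennreal (1 - q)"
proof -
  have "b \<le> 1" using assms(1) by (metis le_iff_add add.commute)
  then have "b \<noteq> \<top>" using neq_top_trans by force
  then have "a = 1 - b" using assms(1) by (metis ennreal_add_diff_cancel_right)
  also have "\<dots> \<le> 1 - ennreal q" using assms(2) by (rule ennreal_minus_mono[OF order_refl])
  also have "\<dots> = ennreal (1 - q)" using assms(3) by (simp add: ennreal_minus ennreal_1[symmetric] del: ennreal_1)
  finally show ?thesis .
qed

text \<open>Take \<open>H\<close> to be \<open>sqrt t\<close> times the identity, whose squared norm
  is \<open>r * t\<close>. \<open>dominates\<close> tests row combinations and
  \<open>contracts\<close> tests column combinations, so contraction is the failure of domination
  for the transposed matrix.\<close>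

lemma nn_integral_square_contracts_le:
  assumes t: "0 \<le> t"
  shows "(\<integral>\<^sup>+G. indicator {G. contracts r r t G} G \<partial>gauss ({..<r} \<times> {..<r})) \<le> ennreal (1 - exp (- (real r * t)))"
proof -
  let ?M = "gauss ({..<r} \<times> {..<r})"
  define H where "H = (\<lambda>(i :: nat, l). if i = l then complex_of_real (sqrt t) else 0)"
  have dm: "(\<lambda>G. indicator {G. dominates r r r H 0 G} G :: ennreal) \<in> borel_measurable ?M"
    by (rule measurable_indicator_dominates) auto
  have iff: "contracts r r t G \<longleftrightarrow> \<not> dominates r r r H 0 (transp ({..<r} \<times> {..<r}) G)" for G
  proof -
    have "(\<Sum>l<r. (cmod (\<Sum>i<r. w i * H (i, l)))\<^sup>2) = t * sqnorm r w" for w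
    proof -
      have "(\<Sum>i<r. w i * H (i, l)) = w l * complex_of_real (sqrt t)" if "l < r" for l
      proof -
        have "(\<Sum>i<r. w i * H (i, l)) = (\<Sum>i<r. if i = l then w l * complex_of_real (sqrt t) else 0)"
          by (intro sum.cong) (auto simp: H_def)
        then show ?thesis using that by simp
      qed
      then show ?thesis using t by (simp add: sqnorm_def norm_mult power_mult_distrib sum_distrib_left mult.commute)
    qed
    moreover have "(\<Sum>j<r. (cmod (\<Sum>i<r. w i * transp ({..<r} \<times> {..<r}) G (i, j)))\<^sup>2) = sqnorm r (apply_mat r G w)" for w
      by (simp add: sqnorm_def apply_mat_def transp_def mult.commute)
    ultimately show ?thesis unfolding contracts_def dominates_def by (simp add: not_le)
  qed
  have tm: "(\<lambda>G. indicator {G. dominates r r r H 0 G} (transp ({..<r} \<times> {..<r}) G) :: ennreal) \<in> borel_measurable ?M"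
    using measurable_compose[OF measurable_transp dm] by simp
  have "(\<integral>\<^sup>+G. indicator {G. contracts r r t G} G \<partial>?M) + (\<integral>\<^sup>+G. indicator {G. dominates r r r H 0 G} (transp ({..<r} \<times> {..<r}) G) \<partial>?M)
     = (\<integral>\<^sup>+G. indicator {G. contracts r r t G} G + indicator {G. dominates r r r H 0 G} (transp ({..<r} \<times> {..<r}) G) \<partial>?M)"
    by (rule nn_integral_add[symmetric, OF measurable_indicator_contracts tm]) simp
  also have "\<dots> = (\<integral>\<^sup>+G. 1 \<partial>?M)" by (intro nn_integral_cong) (auto simp: indicator_def iff)
  also have "\<dots> = 1" by (rule nn_integral_gauss_const)
  finally have sum1: "(\<integral>\<^sup>+G. indicator {G. contracts r r t G} G \<partial>?M)
      + (\<integral>\<^sup>+G. indicator {G. dominates r r r H 0 G} (transp ({..<r} \<times> {..<r}) G) \<partial>?M) = 1" .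
  have "(\<Sum>i<r. \<Sum>l<r. (cmod (H (i, l)))\<^sup>2) = (\<Sum>i<r. \<Sum>l<r. if l = i then t else 0)"
    using t by (intro sum.cong) (auto simp: H_def)
  then have "(\<Sum>i<r. \<Sum>l<r. (cmod (H (i, l)))\<^sup>2) = real r * t" by simp
  then have "ennreal (exp (- (real r * t))) \<le> (\<integral>\<^sup>+G. indicator {G. dominates r r r H 0 G} G \<partial>?M)"
    using dominates_gauss[where r=r and k=r and H=H] by simp
  also have "\<dots> = (\<integral>\<^sup>+G. indicator {G. dominates r r r H 0 G} (transp ({..<r} \<times> {..<r}) G) \<partial>?M)"
    by (rule nn_integral_transp[symmetric, OF _ _ dm]) auto
  finally show ?thesis by (rule ennreal_le_one_minus[OF sum1]) simp
qed

subsection \<open>The two events for a fixed row space\<close>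

text \<open>\<open>s\<close> contracts some vector in the range of the adjoint of \<open>y\<close>.
  The vectors are parametrised by the coefficients \<open>c\<close>, which avoids choosing a basis
  of this range measurably in \<open>y\<close>.\<close>

definition shrinks :: "nat \<Rightarrow> nat \<Rightarrow> real \<Rightarrow> (nat \<times> nat \<Rightarrow> complex) \<Rightarrow> (nat \<times> nat \<Rightarrow> complex) \<Rightarrow> bool" where
  "shrinks r n t s y \<longleftrightarrow> (\<exists>c. sqnorm r (apply_mat n s (\<lambda>j. \<Sum>i<r. cnj (y (i, j)) * c i))
      < t * sqnorm n (\<lambda>j. \<Sum>i<r. cnj (y (i, j)) * c i))"

definition row_comb :: "nat \<Rightarrow> (nat \<times> nat \<Rightarrow> complex) \<Rightarrow> (nat \<Rightarrow> complex) \<Rightarrow> nat \<Rightarrow> complex" where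
  "row_comb r s w j = (\<Sum>i<r. w i * s (i, j))"

text \<open>Every row combination of \<open>s\<close> is, up to the factor \<open>1 - x\<close>, close to the row space of \<open>y\<close>. The
  coefficients run through a dense sequence \<open>e\<close> to make this a measurable event.\<close>

definition aligned :: "(nat \<Rightarrow> nat \<Rightarrow> complex) \<Rightarrow> nat \<Rightarrow> nat \<Rightarrow> real \<Rightarrow> (nat \<times> nat \<Rightarrow> complex) \<Rightarrow> (nat \<times> nat \<Rightarrow> complex) \<Rightarrow> bool" where
  "aligned e r n x s y \<longleftrightarrow> (\<forall>p m. \<exists>q. sqnorm n (\<lambda>j. row_comb r s (e p) j - row_comb r y (e q) j)
      < (1 - x) * sqnorm n (row_comb r s (e p)) + 1 / real (Suc m))"

lemma gauss_unitary_rows_vanish: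
  assumes "r \<le> n"
  shows "\<exists>V. gauss_unitary n V \<and> (\<forall>i l. i < r \<longrightarrow> r \<le> l \<longrightarrow> l < n \<longrightarrow> (\<Sum>j<n. V $$ (l, j) * y (i, j)) = 0)"
proof -
  define A where "A = mat n r (\<lambda>(j, i). y (i, j))"
  have A: "A \<in> carrier_mat n r" by (simp add: A_def)
  from gauss_unitary_QR[OF A assms] obtain V where V: "gauss_unitary n V"
    and V0: "\<And>i l. r \<le> i \<Longrightarrow> i < n \<Longrightarrow> l < r \<Longrightarrow> (V * A) $$ (i, l) = 0" by blast
  have "(\<Sum>j<n. V $$ (l, j) * y (i, j)) = 0" if "i < r" "r \<le> l" "l < n" for i l
  proof -
    have "(V * A) $$ (l, i) = (\<Sum>j<n. V $$ (l, j) * y (i, j))"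
      using that gauss_unitary_carrier[OF V] A by (auto simp: scalar_prod_def lessThan_atLeast0 A_def intro!: sum.cong)
    then show ?thesis using V0[of l i] that by simp
  qed
  with V show ?thesis by blast
qed

lemma sum_vanishing_tail:
  fixes f :: "nat \<Rightarrow> 'a :: comm_monoid_add"
  assumes "r \<le> n" "\<And>l. r \<le> l \<Longrightarrow> l < n \<Longrightarrow> f l = 0"
  shows "(\<Sum>l<n. f l) = (\<Sum>l<r. f l)"
  using assms by (intro sum.mono_neutral_right) auto

text \<open>Since \<open>y\<close> is fixed, a rotation depending on it makes its rows supported in
  the first \<open>r\<close> coordinates. The contraction then concerns only the leading square
  block of the rotated \<open>s\<close>, whose law is unchanged.\<close>

lemma nn_integral_shrinks_le:
  assumes r: "r \<le> n" and t: "0 \<le> t"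
  shows "(\<integral>\<^sup>+s. indicator {s. shrinks r n t s y} s \<partial>gauss ({..<r} \<times> {..<n})) \<le> ennreal (1 - exp (- (real r * t)))"
proof -
  let ?M = "gauss ({..<r} \<times> {..<n})"
  obtain V where V: "gauss_unitary n V"
    and V0: "\<And>i l. i < r \<Longrightarrow> r \<le> l \<Longrightarrow> l < n \<Longrightarrow> (\<Sum>j<n. V $$ (l, j) * y (i, j)) = 0"
    using gauss_unitary_rows_vanish[OF r, of y] by blast
  have "contracts r r t (row_app {..<r} n V s)" if sh: "shrinks r n t s y" for s
  proof -
    obtain c where c: "sqnorm r (apply_mat n s (\<lambda>j. \<Sum>i<r. cnj (y (i, j)) * c i))
      < t * sqnorm n (\<lambda>j. \<Sum>i<r. cnj (y (i, j)) * c i)" using sh by (auto simp: shrinks_def)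
    define u where "u j = (\<Sum>i<r. cnj (y (i, j)) * c i)" for j
    \<comment> \<open>The coordinates of \<open>u\<close> with respect to the rows of
      \<open>V\<close>, so that \<open>u\<close> is the transpose of \<open>V\<close> applied to
      \<eta>; hence the two conjugations.\<close>
    define \<eta> where "\<eta> l = cnj (\<Sum>j<n. V $$ (l, j) * cnj (u j))" for l
    have \<eta>0: "\<eta> l = 0" if "r \<le> l" "l < n" for l
    proof -
      have "(\<Sum>j<n. V $$ (l, j) * cnj (u j)) = (\<Sum>j<n. \<Sum>i<r. V $$ (l, j) * y (i, j) * cnj (c i))"
        by (intro sum.cong refl) (simp add: u_def sum_distrib_left mult.assoc)
      also have "\<dots> = (\<Sum>i<r. (\<Sum>j<n. V $$ (l, j) * y (i, j)) * cnj (c i))"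
        by (subst sum.swap) (simp add: sum_distrib_right)
      also have "\<dots> = 0" using V0 that by simp
      finally show ?thesis by (simp add: \<eta>_def)
    qed
    have uj: "u j = (\<Sum>l<n. V $$ (l, j) * \<eta> l)" if "j < n" for j
    proof -
      have "cnj (u j) = (\<Sum>i<n. cnj (V $$ (i, j)) * (\<Sum>l<n. V $$ (i, l) * cnj (u l)))"
        by (rule gauss_unitary_inverse(1)[OF V that, symmetric])
      then have "cnj (cnj (u j)) = cnj (\<Sum>i<n. cnj (V $$ (i, j)) * (\<Sum>l<n. V $$ (i, l) * cnj (u l)))" by (rule arg_cong)
      then show ?thesis by (simp add: \<eta>_def)
    qed
    have "apply_mat r (row_app {..<r} n V s) \<eta> a = apply_mat n s u a" if "a < r" for a
    proof -
      have "apply_mat r (row_app {..<r} n V s) \<eta> a = (\<Sum>l<r. (\<Sum>j<n. V $$ (l, j) * s (a, j)) * \<eta> l)"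
        using that r unfolding apply_mat_def by (intro sum.cong) auto
      also have "\<dots> = (\<Sum>l<n. (\<Sum>j<n. V $$ (l, j) * s (a, j)) * \<eta> l)"
        using \<eta>0 by (intro sum_vanishing_tail[symmetric] r) simp
      also have "\<dots> = (\<Sum>l<n. \<Sum>j<n. s (a, j) * (V $$ (l, j) * \<eta> l))"
        by (simp add: sum_distrib_left sum_distrib_right mult_ac)
      also have "\<dots> = (\<Sum>j<n. \<Sum>l<n. s (a, j) * (V $$ (l, j) * \<eta> l))" by (rule sum.swap)
      also have "\<dots> = apply_mat n s u a" unfolding apply_mat_def
        by (intro sum.cong refl) (simp add: uj sum_distrib_left)
      finally show ?thesis .
    qed
    then have 1: "sqnorm r (apply_mat r (row_app {..<r} n V s) \<eta>) = sqnorm r (apply_mat n s u)"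
      by (simp add: sqnorm_def)
    have "sqnorm r \<eta> = sqnorm n \<eta>"
      unfolding sqnorm_def using \<eta>0 by (intro sum_vanishing_tail[symmetric] r) simp
    also have "\<dots> = sqnorm n u"
      using gauss_unitary_norm[OF V, of "\<lambda>j. cnj (u j)"] by (simp add: sqnorm_def \<eta>_def del: cnj_sum)
    finally have "sqnorm r \<eta> = sqnorm n u" .
    then show ?thesis unfolding contracts_def using c 1 by (intro exI[of _ \<eta>]) (simp add: u_def[abs_def])
  qed
  then have "(\<integral>\<^sup>+s. indicator {s. shrinks r n t s y} s \<partial>?M)
     \<le> (\<integral>\<^sup>+s. indicator {G. contracts r r t G} (row_app {..<r} n V s) \<partial>?M)"
    by (intro nn_integral_mono) (auto simp: indicator_def)
  also have "\<dots> = (\<integral>\<^sup>+s. indicator {G. contracts r r t G} s \<partial>?M)"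
    by (rule nn_integral_row_app[OF V _ measurable_indicator_contracts[OF r]]) simp
  also have "\<dots> = (\<integral>\<^sup>+s. indicator {G. contracts r r t G} s \<partial>gauss ({..<r} \<times> {..<r}))"
    by (rule nn_integral_contracts_restrict[OF r])
  also have "\<dots> \<le> ennreal (1 - exp (- (real r * t)))" by (rule nn_integral_square_contracts_le[OF t])
  finally show ?thesis .
qed

lemma continuous_on_sqnorm_row_comb:
  "continuous_on UNIV (\<lambda>c. sqnorm n (\<lambda>j. p j - row_comb r y c j))"
  unfolding sqnorm_def row_comb_def by (intro continuous_intros)

text \<open>In rotated coordinates the row space of \<open>y\<close> consists of the vectors
  supported in the first \<open>r\<close> coordinates, by the independence of the rows. The residual
  of a row combination of \<open>s\<close> is then its part \<open>R\<close> in the last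
  \<open>k\<close> coordinates, and domination of the trailing block by the leading one bounds
  \<open>R\<close> by \<open>1 - x\<close> times the total.\<close>

lemma nn_integral_not_aligned_le:
  fixes e :: "nat \<Rightarrow> nat \<Rightarrow> complex"
  assumes dense: "\<And>X. open X \<Longrightarrow> X \<noteq> {} \<Longrightarrow> \<exists>q. e q \<in> X"
    and x: "0 < x" "x < 1"
    and indep: "\<And>c. (\<And>j. j < r + k \<Longrightarrow> row_comb r y c j = 0) \<Longrightarrow> (\<And>i. i < r \<Longrightarrow> c i = 0)"
  shows "(\<integral>\<^sup>+s. indicator {s. \<not> aligned e r (r + k) x s y} s \<partial>gauss ({..<r} \<times> {..<r + k}))
    \<le> ennreal (real (r * k) * x)"
proof -
  let ?M = "gauss ({..<r} \<times> {..<r + k})" and ?n = "r + k"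
  \<comment> \<open>Chosen so that 1 / (1 + c) = 1 - x: the bound c R \<le> L for the parts of a row
    is the same as R \<le> (1 - x) (L + R).\<close>
  define c where "c = x / (1 - x)"
  have c: "0 \<le> c" using x by (simp add: c_def)
  have c1: "1 / (1 + c) = 1 - x" using x by (simp add: c_def field_simps)
  define D where "D = (\<lambda>G. dominates r r k (\<lambda>(i, l). of_real (sqrt c) * G (i, r + l)) 0 G)"
  obtain V where V: "gauss_unitary ?n V"
    and V0: "\<And>i l. i < r \<Longrightarrow> r \<le> l \<Longrightarrow> l < ?n \<Longrightarrow> (\<Sum>j<?n. V $$ (l, j) * y (i, j)) = 0"
    using gauss_unitary_rows_vanish[of r ?n y] by auto
  have Dm: "(\<lambda>G. indicator {G. D G} G :: ennreal) \<in> borel_measurable ?M"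
    unfolding D_def by (rule measurable_indicator_dominates) auto
  have lin: "(\<Sum>j<?n. V $$ (l, j) * row_comb r z w j) = (\<Sum>i<r. w i * (\<Sum>j<?n. V $$ (l, j) * z (i, j)))" for l z w
  proof -
    have "(\<Sum>j<?n. V $$ (l, j) * row_comb r z w j) = (\<Sum>j<?n. \<Sum>i<r. w i * (V $$ (l, j) * z (i, j)))"
      by (intro sum.cong refl) (simp add: row_comb_def sum_distrib_left mult_ac)
    also have "\<dots> = (\<Sum>i<r. \<Sum>j<?n. w i * (V $$ (l, j) * z (i, j)))" by (rule sum.swap)
    finally show ?thesis by (simp add: sum_distrib_left)
  qed
  \<comment> \<open>The leading coordinates of the rotated rows of \<open>y\<close>, transposed. Its
    invertibility lets a combination of the rows of \<open>y\<close> match the first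
    \<open>r\<close> coordinates of any vector exactly.\<close>
  define T where "T = mat r r (\<lambda>(l, i). \<Sum>j<?n. V $$ (l, j) * y (i, j))"
  have T: "T \<in> carrier_mat r r" by (simp add: T_def)
  obtain Ti where Ti: "Ti \<in> carrier_mat r r" "T * Ti = 1\<^sub>m r"
  proof (rule mat_inverse_exists[OF T])
    fix v assume v: "v \<in> carrier_vec r" "T *\<^sub>v v = 0\<^sub>v r"
    have zero: "(\<Sum>j<?n. V $$ (l, j) * row_comb r y (\<lambda>i. v $ i) j) = 0" if "l < ?n" for l
    proof (cases "l < r")
      case True
      have "(T *\<^sub>v v) $ l = (\<Sum>i<r. v $ i * (\<Sum>j<?n. V $$ (l, j) * y (i, j)))"
        using index_mult_mat_vec_sum[OF T v(1) True] True by (simp add: T_def mult.commute)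
      then show ?thesis using v True by (simp add: lin)
    next
      case False
      then show ?thesis unfolding lin using V0 that by simp
    qed
    have "row_comb r y (\<lambda>i. v $ i) j = 0" if "j < ?n" for j
      using gauss_unitary_inverse(1)[OF V that, of "row_comb r y (\<lambda>i. v $ i)"] zero by simp
    from indep[OF this] have "v $ i = 0" if "i < r" for i using that by simp
    then show "v = 0\<^sub>v r" using v by (intro eq_vecI) auto
  qed auto
  have "aligned e r ?n x s y" if D: "D (row_app {..<r} ?n V s)" for s
    unfolding aligned_def
  proof (intro allI)
    fix p m
    define w where "w = e p"
    define \<sigma> where "\<sigma> l = (\<Sum>i<r. w i * row_app {..<r} ?n V s (i, l))" for l
    have \<sigma>: "(\<Sum>j<?n. V $$ (l, j) * row_comb r s w j) = \<sigma> l" if "l < ?n" for l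
      unfolding lin \<sigma>_def using that by (intro sum.cong) auto
    define cv where "cv = Ti *\<^sub>v vec r \<sigma>"
    have cv: "cv \<in> carrier_vec r" "T *\<^sub>v cv = vec r \<sigma>"
      using T Ti by (simp_all add: cv_def assoc_mult_mat_vec[symmetric, of T r r Ti r])
    define c0 where "c0 i = cv $ i" for i
    have fit: "(\<Sum>j<?n. V $$ (l, j) * row_comb r y c0 j) = (if l < r then \<sigma> l else 0)" if "l < ?n" for l
    proof (cases "l < r")
      case True
      have "(T *\<^sub>v cv) $ l = (\<Sum>i<r. c0 i * (\<Sum>j<?n. V $$ (l, j) * y (i, j)))"
        using index_mult_mat_vec_sum[OF T cv(1) True] True by (simp add: T_def c0_def mult.commute)
      then show ?thesis using cv True by (simp add: lin)
    next
      case False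
      then show ?thesis unfolding lin using V0 that by simp
    qed
    define R where "R = (\<Sum>l\<in>{r..<?n}. (cmod (\<sigma> l))\<^sup>2)"
    define L where "L = (\<Sum>l<r. (cmod (\<sigma> l))\<^sup>2)"
    have split: "(\<Sum>l<?n. f l) = (\<Sum>l<r. f l) + (\<Sum>l\<in>{r..<?n}. f l)" for f :: "nat \<Rightarrow> real"
      using sum.atLeastLessThan_concat[of 0 r ?n f] by (simp add: lessThan_atLeast0)
    have tot: "sqnorm ?n (row_comb r s w) = L + R"
    proof -
      have "sqnorm ?n (row_comb r s w) = (\<Sum>l<?n. (cmod (\<Sum>j<?n. V $$ (l, j) * row_comb r s w j))\<^sup>2)"
        unfolding sqnorm_def by (rule gauss_unitary_norm[OF V, symmetric])
      also have "\<dots> = (\<Sum>l<?n. (cmod (\<sigma> l))\<^sup>2)" by (intro sum.cong) (auto simp: \<sigma>)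
      finally show ?thesis by (simp add: split L_def R_def)
    qed
    have res: "sqnorm ?n (\<lambda>j. row_comb r s w j - row_comb r y c0 j) = R"
    proof -
      have "sqnorm ?n (\<lambda>j. row_comb r s w j - row_comb r y c0 j)
         = (\<Sum>l<?n. (cmod (\<Sum>j<?n. V $$ (l, j) * (row_comb r s w j - row_comb r y c0 j)))\<^sup>2)"
        unfolding sqnorm_def by (rule gauss_unitary_norm[OF V, symmetric])
      also have "\<dots> = (\<Sum>l<?n. (cmod (\<sigma> l - (if l < r then \<sigma> l else 0)))\<^sup>2)"
        by (intro sum.cong refl) (simp add: right_diff_distrib sum_subtractf \<sigma> fit)
      also have "\<dots> = R" unfolding split R_def by simp
      finally show ?thesis .
    qed
    have "c * R \<le> L"
    proof -
      have "(\<Sum>l<k. (cmod (\<Sum>i<r. w i * (of_real (sqrt c) * row_app {..<r} ?n V s (i, r + l))))\<^sup>2) \<le> L"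
        using D unfolding D_def dominates_def L_def \<sigma>_def by simp
      moreover have "(cmod (\<Sum>i<r. w i * (of_real (sqrt c) * row_app {..<r} ?n V s (i, r + l))))\<^sup>2 = c * (cmod (\<sigma> (r + l)))\<^sup>2" for l
      proof -
        have "(\<Sum>i<r. w i * (of_real (sqrt c) * row_app {..<r} ?n V s (i, r + l))) = of_real (sqrt c) * \<sigma> (r + l)"
          by (simp add: \<sigma>_def sum_distrib_left mult_ac)
        then show ?thesis using c by (simp add: norm_mult power_mult_distrib)
      qed
      moreover have "R = (\<Sum>l<k. (cmod (\<sigma> (r + l)))\<^sup>2)"
        using sum.shift_bounds_nat_ivl[of "\<lambda>j. (cmod (\<sigma> j))\<^sup>2" 0 r k]
        by (simp add: R_def add.commute lessThan_atLeast0)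
      ultimately show ?thesis by (simp only: sum_distrib_left)
    qed
    then have "x * R \<le> (1 - x) * L" using x by (simp add: c_def field_simps)
    then have "R \<le> (1 - x) * (L + R)" by (simp add: algebra_simps)
    moreover have "0 < 1 / real (Suc m)" by simp
    \<comment> \<open>The slack 1 / (m + 1) makes the inequality strict, so the admissible
      coefficients form a nonempty open set, which the dense sequence meets.\<close>
    ultimately have "c0 \<in> {c. sqnorm ?n (\<lambda>j. row_comb r s w j - row_comb r y c j)
        < (1 - x) * sqnorm ?n (row_comb r s w) + 1 / real (Suc m)}"
      unfolding mem_Collect_eq res tot by linarith
    moreover have "open {c. sqnorm ?n (\<lambda>j. row_comb r s w j - row_comb r y c j)
        < (1 - x) * sqnorm ?n (row_comb r s w) + 1 / real (Suc m)}"
      by (intro open_Collect_less continuous_on_sqnorm_row_comb continuous_on_const)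
    ultimately obtain q where "e q \<in> {c. sqnorm ?n (\<lambda>j. row_comb r s w j - row_comb r y c j)
        < (1 - x) * sqnorm ?n (row_comb r s w) + 1 / real (Suc m)}" using dense by blast
    then show "\<exists>q. sqnorm ?n (\<lambda>j. row_comb r s (e p) j - row_comb r y (e q) j)
        < (1 - x) * sqnorm ?n (row_comb r s (e p)) + 1 / real (Suc m)"
      by (auto simp: w_def)
  qed
  then have "(\<integral>\<^sup>+s. indicator {s. \<not> aligned e r ?n x s y} s \<partial>?M) \<le> (\<integral>\<^sup>+s. indicator {s. \<not> D s} (row_app {..<r} ?n V s) \<partial>?M)"
    by (intro nn_integral_mono) (auto simp: indicator_def)
  also have "\<dots> = (\<integral>\<^sup>+s. indicator {s. \<not> D s} s \<partial>?M)"
  proof (rule nn_integral_row_app[OF V])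
    have "(\<lambda>s. 1 - indicator {G. D G} s :: ennreal) \<in> borel_measurable ?M" using Dm by measurable
    then show "(\<lambda>s. indicator {s. \<not> D s} s :: ennreal) \<in> borel_measurable ?M"
      by (rule measurable_cong[THEN iffD1, rotated]) (auto simp: indicator_def)
  qed simp
  also have "\<dots> \<le> ennreal (1 - (1 / (1 + c)) ^ (r * k))"
  proof (rule ennreal_le_one_minus)
    have "(\<lambda>s. 1 - indicator {G. D G} s :: ennreal) \<in> borel_measurable ?M" using Dm by measurable
    then have nm: "(\<lambda>s. indicator {s. \<not> D s} s :: ennreal) \<in> borel_measurable ?M"
      by (rule measurable_cong[THEN iffD1, rotated]) (auto simp: indicator_def)
    have "(\<integral>\<^sup>+s. indicator {s. \<not> D s} s \<partial>?M) + (\<integral>\<^sup>+s. indicator {s. D s} s \<partial>?M)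
       = (\<integral>\<^sup>+s. indicator {s. \<not> D s} s + indicator {s. D s} s \<partial>?M)"
      by (rule nn_integral_add[symmetric, OF nm Dm])
    also have "\<dots> = (\<integral>\<^sup>+s. 1 \<partial>?M)" by (intro nn_integral_cong) (auto simp: indicator_def)
    finally show "(\<integral>\<^sup>+s. indicator {s. \<not> D s} s \<partial>?M) + (\<integral>\<^sup>+s. indicator {s. D s} s \<partial>?M) = 1"
      by (simp only: nn_integral_gauss_const)
    show "ennreal ((1 / (1 + c)) ^ (r * k)) \<le> (\<integral>\<^sup>+s. indicator {s. D s} s \<partial>?M)"
      unfolding D_def by (rule dominates_gauss_block[OF c])
    show "0 \<le> (1 / (1 + c)) ^ (r * k)" using c by simp
  qed
  also have "\<dots> \<le> ennreal (real (r * k) * x)"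
    unfolding c1 using Bernoulli_inequality[of "- x" "r * k"] x by (intro ennreal_leI) simp
  finally show ?thesis .
qed

text \<open>\<open>d\<close> annihilates every combination of the rows of \<open>y\<close>, so one
  may be subtracted from the row combination of \<open>s\<close> before Cauchy-Schwarz. Letting
  \<open>m\<close> grow removes the slack, and continuity in the coefficients passes from the dense
  sequence to all \<open>w\<close>.\<close>

lemma aligned_orthogonal_bound:
  fixes e :: "nat \<Rightarrow> nat \<Rightarrow> complex"
  assumes dense: "\<And>X. open X \<Longrightarrow> X \<noteq> {} \<Longrightarrow> \<exists>q. e q \<in> X"
    and al: "aligned e r n x s y" and d: "\<And>i. i < r \<Longrightarrow> (\<Sum>j<n. y (i, j) * d j) = 0"
  shows "(cmod (\<Sum>j<n. row_comb r s w j * d j))\<^sup>2 \<le> (1 - x) * sqnorm n (row_comb r s w) * sqnorm n d"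
proof -
  define g where "g w = (1 - x) * sqnorm n (row_comb r s w) * sqnorm n d - (cmod (\<Sum>j<n. row_comb r s w j * d j))\<^sup>2" for w
  have "0 \<le> g (e p)" for p
  proof -
    have "(cmod (\<Sum>j<n. row_comb r s (e p) j * d j))\<^sup>2 \<le> (1 - x) * sqnorm n (row_comb r s (e p)) * sqnorm n d + sqnorm n d / real (Suc m)" for m
    proof -
      obtain q where q: "sqnorm n (\<lambda>j. row_comb r s (e p) j - row_comb r y (e q) j)
        < (1 - x) * sqnorm n (row_comb r s (e p)) + 1 / real (Suc m)" using al by (auto simp: aligned_def)
      define z where "z j = row_comb r s (e p) j - row_comb r y (e q) j" for j
      have "(\<Sum>j<n. row_comb r y (e q) j * d j) = (\<Sum>j<n. \<Sum>i<r. e q i * (y (i, j) * d j))"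
        by (simp add: row_comb_def sum_distrib_right mult.assoc)
      also have "\<dots> = (\<Sum>i<r. e q i * (\<Sum>j<n. y (i, j) * d j))"
        by (subst sum.swap) (simp add: sum_distrib_left)
      also have "\<dots> = 0" using d by simp
      finally have "(\<Sum>j<n. row_comb r s (e p) j * d j) = (\<Sum>j<n. z j * d j)"
        by (simp add: z_def left_diff_distrib sum_subtractf)
      then have "cmod (\<Sum>j<n. row_comb r s (e p) j * d j) \<le> (\<Sum>j<n. \<bar>cmod (z j)\<bar> * \<bar>cmod (d j)\<bar>)"
        using norm_sum[of "\<lambda>j. z j * d j" "{..<n}"] by (simp add: norm_mult)
      also have "\<dots> \<le> L2_set (\<lambda>j. cmod (z j)) {..<n} * L2_set (\<lambda>j. cmod (d j)) {..<n}"
        by (rule L2_set_mult_ineq)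
      also have "\<dots> = sqrt (sqnorm n z * sqnorm n d)"
        by (simp add: L2_set_def sqnorm_def real_sqrt_mult)
      finally have "(cmod (\<Sum>j<n. row_comb r s (e p) j * d j))\<^sup>2 \<le> (sqrt (sqnorm n z * sqnorm n d))\<^sup>2"
        by (rule power_mono) simp
      also have "\<dots> = sqnorm n z * sqnorm n d" by simp
      also have "\<dots> \<le> ((1 - x) * sqnorm n (row_comb r s (e p)) + 1 / real (Suc m)) * sqnorm n d"
        using q by (intro mult_right_mono) (auto simp: z_def[abs_def])
      finally show ?thesis by (simp add: algebra_simps)
    qed
    moreover have "(\<lambda>m. (1 - x) * sqnorm n (row_comb r s (e p)) * sqnorm n d + sqnorm n d / real (Suc m))
        \<longlonglongrightarrow> (1 - x) * sqnorm n (row_comb r s (e p)) * sqnorm n d + 0"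
      by (intro tendsto_intros LIMSEQ_Suc[OF lim_const_over_n])
    ultimately have "(cmod (\<Sum>j<n. row_comb r s (e p) j * d j))\<^sup>2 \<le> (1 - x) * sqnorm n (row_comb r s (e p)) * sqnorm n d + 0"
      by (intro LIMSEQ_le_const) auto
    then show ?thesis by (simp add: g_def)
  qed
  moreover have "open {w. g w < 0}"
    unfolding g_def sqnorm_def row_comb_def
    by (intro open_Collect_less continuous_intros)
  ultimately have "{w. g w < 0} = {}" using dense[of "{w. g w < 0}"] by (metis mem_Collect_eq not_less)
  then have "0 \<le> g w" by (metis empty_iff mem_Collect_eq not_less)
  then show ?thesis by (simp add: g_def)
qed

subsection \<open>Laws of the random matrices\<close>

lemma lborel_complex: "distr (lborel \<Otimes>\<^sub>M lborel) borel (\<lambda>(x, y). Complex x y) = (lborel :: complex measure)"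
proof (rule lborel_eqI[symmetric])
  have m: "(\<lambda>(x, y). Complex x y) \<in> measurable (lborel \<Otimes>\<^sub>M lborel) borel"
    unfolding Complex_eq by measurable
  fix l u :: complex assume le: "\<And>b. b \<in> Basis \<Longrightarrow> l \<bullet> b \<le> u \<bullet> b"
  from le[of 1] le[of \<i>] have le': "Re l \<le> Re u" "Im l \<le> Im u"
    by (auto simp: Basis_complex_def inner_complex_def)
  have "(\<lambda>(x, y). Complex x y) -` box l u \<inter> space (lborel \<Otimes>\<^sub>M lborel) = box (Re l) (Re u) \<times> box (Im l) (Im u)"
    by (auto simp: box_def Basis_complex_def space_pair_measure)
  then have "emeasure (distr (lborel \<Otimes>\<^sub>M lborel) borel (\<lambda>(x, y). Complex x y)) (box l u)
      = emeasure (lborel \<Otimes>\<^sub>M lborel) (box (Re l) (Re u) \<times> box (Im l) (Im u))"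
    by (subst emeasure_distr[OF m]) auto
  also have "\<dots> = ennreal (Re u - Re l) * ennreal (Im u - Im l)"
    using le' by (subst lborel.emeasure_pair_measure_Times) auto
  also have "\<dots> = ennreal (\<Prod>b\<in>Basis. (u - l) \<bullet> b)"
    using le' by (simp add: Basis_complex_def ennreal_mult[symmetric] del: ennreal_mult'')
  finally show "emeasure (distr (lborel \<Otimes>\<^sub>M lborel) borel (\<lambda>(x, y). Complex x y)) (box l u) = ennreal (\<Prod>b\<in>Basis. (u - l) \<bullet> b)" .
qed simp

lemma distr_normal_pair:
  defines "\<nu> \<equiv> density lborel (\<lambda>x. ennreal (normal_density 0 (sqrt (1/2)) x))"
  shows "distr (\<nu> \<Otimes>\<^sub>M \<nu>) borel (\<lambda>(x, y). Complex x y) = cgauss"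
proof -
  have m: "(\<lambda>(x, y). Complex x y) \<in> measurable (lborel \<Otimes>\<^sub>M lborel) borel"
    unfolding Complex_eq by measurable
  have "prob_space \<nu>" unfolding \<nu>_def by (rule prob_space_normal_density) simp
  then have sf: "sigma_finite_measure \<nu>" using prob_space_imp_sigma_finite by blast
  have "\<nu> \<Otimes>\<^sub>M \<nu> = density (lborel \<Otimes>\<^sub>M lborel)
      (\<lambda>(x, y). ennreal (normal_density 0 (sqrt (1/2)) x) * ennreal (normal_density 0 (sqrt (1/2)) y))"
    unfolding \<nu>_def by (rule pair_measure_density) (use sf in \<open>auto simp: \<nu>_def intro: sigma_finite_lborel\<close>)
  also have "\<dots> = density (lborel \<Otimes>\<^sub>M lborel) (\<lambda>p. ennreal (exp (- (cmod ((\<lambda>(x, y). Complex x y) p))\<^sup>2) / pi))"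
  proof (rule arg_cong[where f="density (lborel \<Otimes>\<^sub>M lborel)"], rule ext)
    fix p :: "real \<times> real"
    obtain x y where p: "p = (x, y)" by force
    have nd: "normal_density 0 (sqrt (1/2)) x = exp (- x\<^sup>2) / sqrt pi" for x :: real
      by (simp add: normal_density_def)
    have "normal_density 0 (sqrt (1/2)) x * normal_density 0 (sqrt (1/2)) y = exp (- (cmod (Complex x y))\<^sup>2) / pi"
      unfolding nd cmod_power2 by (simp add: exp_add[symmetric] algebra_simps)
    then show "(\<lambda>(x, y). ennreal (normal_density 0 (sqrt (1/2)) x) * ennreal (normal_density 0 (sqrt (1/2)) y)) p
       = ennreal (exp (- (cmod ((\<lambda>(x, y). Complex x y) p))\<^sup>2) / pi)"
      by (simp add: p ennreal_mult[symmetric])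
  qed
  finally have "distr (\<nu> \<Otimes>\<^sub>M \<nu>) borel (\<lambda>(x, y). Complex x y)
     = distr (density (lborel \<Otimes>\<^sub>M lborel) (\<lambda>p. ennreal (exp (- (cmod ((\<lambda>(x, y). Complex x y) p))\<^sup>2) / pi))) borel (\<lambda>(x, y). Complex x y)"
    by simp
  also have "\<dots> = density (distr (lborel \<Otimes>\<^sub>M lborel) borel (\<lambda>(x, y). Complex x y)) (\<lambda>z. ennreal (exp (- (cmod z)\<^sup>2) / pi))"
    by (rule density_distr[symmetric, OF _ m]) simp
  finally show ?thesis unfolding lborel_complex cgauss_def .
qed

definition mat_entries :: "nat \<Rightarrow> nat \<Rightarrow> complex mat \<Rightarrow> (nat \<times> nat \<Rightarrow> complex)" where
  "mat_entries r n A = restrict (\<lambda>p. A $$ p) ({..<r} \<times> {..<n})"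

text \<open>The independent real family is regrouped into pairs of real and imaginary part, one pair
  per entry. Variance 1/2 for each part gives the density of \<open>cgauss\<close>, and independence
  of the entries turns the joint law into the product measure.\<close>

lemma distr_gaussian_mat:
  assumes "prob_space M" and S: "std_complex_gaussian_mat M r n S" and rn: "0 < r" "0 < n"
  shows "distr M (gauss ({..<r} \<times> {..<n})) (\<lambda>\<omega>. mat_entries r n (S \<omega>)) = gauss ({..<r} \<times> {..<n})"
    and "(\<lambda>\<omega>. mat_entries r n (S \<omega>)) \<in> measurable M (gauss ({..<r} \<times> {..<n}))"
proof -
  interpret prob_space M by fact
  let ?I = "{..<r} \<times> {..<n}"
  define X where "X = (\<lambda>((i, j), b) \<omega>. if b then Re (S \<omega> $$ (i, j)) else Im (S \<omega> $$ (i, j)))"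
  have ind: "indep_vars (\<lambda>_. borel) X (?I \<times> UNIV)"
    using S by (simp add: std_complex_gaussian_mat_def X_def lessThan_atLeast0)
  have dist: "distributed M lborel (X (p, b)) (\<lambda>x. ennreal (normal_density 0 (sqrt (1/2)) x))" if "p \<in> ?I" for p b
    using S that by (cases p) (auto simp: std_complex_gaussian_mat_def X_def)
  have Xpair: "Complex (X (p, True) \<omega>) (X (p, False) \<omega>) = S \<omega> $$ p" for p \<omega>
    by (cases p) (simp add: X_def)
  \<comment> \<open>The block of indices belonging to entry \<open>p\<close>; the blocks are
    disjoint, so the regrouped family is again independent.\<close>
  define K where "K p = {p} \<times> (UNIV :: bool set)" for p :: "nat \<times> nat"
  have "indep_vars (\<lambda>p. Pi\<^sub>M (K p) (\<lambda>_. borel)) (\<lambda>p \<omega>. restrict (\<lambda>k. X k \<omega>) (K p)) ?I"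
    by (rule indep_vars_restrict[OF ind]) (auto simp: K_def disjoint_family_on_def)
  then have "indep_vars (\<lambda>_. borel) (\<lambda>p \<omega>. (\<lambda>x. Complex (x (p, True)) (x (p, False))) (restrict (\<lambda>k. X k \<omega>) (K p))) ?I"
  proof (rule indep_vars_compose2)
    fix p
    have "(\<lambda>x. x (p, b)) \<in> borel_measurable (Pi\<^sub>M (K p) (\<lambda>_. borel :: real measure))" for b
      by (rule measurable_component_singleton) (simp add: K_def)
    then show "(\<lambda>x. Complex (x (p, True)) (x (p, False))) \<in> borel_measurable (Pi\<^sub>M (K p) (\<lambda>_. borel))"
      unfolding Complex_eq by measurable
  qed
  moreover have "(\<lambda>p \<omega>. (\<lambda>x. Complex (x (p, True)) (x (p, False))) (restrict (\<lambda>k. X k \<omega>) (K p))) = (\<lambda>p \<omega>. S \<omega> $$ p)"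
    by (intro ext) (simp add: K_def Xpair)
  ultimately have indS: "indep_vars (\<lambda>_. borel) (\<lambda>p \<omega>. S \<omega> $$ p) ?I" by simp
  have rv: "random_variable borel (\<lambda>\<omega>. S \<omega> $$ p)" if "p \<in> ?I" for p
    using indS that by (auto simp: indep_vars_def)
  have law: "distr M borel (\<lambda>\<omega>. S \<omega> $$ p) = cgauss" if p: "p \<in> ?I" for p
  proof -
    let ?T = "(p, True)" and ?F = "(p, False)"
    have "indep_var (Pi\<^sub>M {?T} (\<lambda>_. borel)) (\<lambda>\<omega>. restrict (\<lambda>k. X k \<omega>) {?T}) (Pi\<^sub>M {?F} (\<lambda>_. borel)) (\<lambda>\<omega>. restrict (\<lambda>k. X k \<omega>) {?F})"
      by (rule indep_var_restrict[OF ind]) (use p in auto)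
    then have "indep_var borel ((\<lambda>x. x ?T) \<circ> (\<lambda>\<omega>. restrict (\<lambda>k. X k \<omega>) {?T})) borel ((\<lambda>x. x ?F) \<circ> (\<lambda>\<omega>. restrict (\<lambda>k. X k \<omega>) {?F}))"
      by (rule indep_var_compose) (auto intro: measurable_component_singleton)
    then have "indep_var borel (X ?T) borel (X ?F)" by (simp add: comp_def)
    then have pair: "distr M borel (X ?T) \<Otimes>\<^sub>M distr M borel (X ?F) = distr M (borel \<Otimes>\<^sub>M borel) (\<lambda>\<omega>. (X ?T \<omega>, X ?F \<omega>))"
      and rvX: "random_variable borel (X ?T)" "random_variable borel (X ?F)"
      by (auto simp: indep_var_distribution_eq)
    have Xd: "distr M borel (X (p, b)) = density lborel (\<lambda>x. ennreal (normal_density 0 (sqrt (1/2)) x))" for b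
      using distributed_distr_eq_density[OF dist[OF p, of b]] by (simp cong: distr_cong)
    have cm: "(\<lambda>(x, y). Complex x y) \<in> borel_measurable (borel \<Otimes>\<^sub>M borel)"
      unfolding Complex_eq by measurable
    have "distr M borel (\<lambda>\<omega>. S \<omega> $$ p) = distr (distr M (borel \<Otimes>\<^sub>M borel) (\<lambda>\<omega>. (X ?T \<omega>, X ?F \<omega>))) borel (\<lambda>(x, y). Complex x y)"
      using rvX by (subst distr_distr[OF cm]) (auto simp: comp_def Xpair)
    also have "\<dots> = cgauss"
      unfolding pair[symmetric] Xd by (rule distr_normal_pair)
    finally show ?thesis .
  qed
  \<comment> \<open>The characterisation of independence by the joint law is applied with a nonempty
    index set, hence the positivity of both dimensions.\<close>
  have "?I \<noteq> {}" using rn by auto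
  with indS have "distr M (Pi\<^sub>M ?I (\<lambda>_. borel)) (\<lambda>\<omega>. \<lambda>p\<in>?I. S \<omega> $$ p) = Pi\<^sub>M ?I (\<lambda>p. distr M borel (\<lambda>\<omega>. S \<omega> $$ p))"
    using indep_vars_iff_distr_eq_PiM'[where I="?I" and M'="\<lambda>_. borel" and X="\<lambda>p \<omega>. S \<omega> $$ p"] rv by blast
  also have "\<dots> = gauss ?I" by (rule PiM_cong) (auto simp: law)
  finally have *: "distr M (Pi\<^sub>M ?I (\<lambda>_. borel)) (\<lambda>\<omega>. \<lambda>p\<in>?I. S \<omega> $$ p) = gauss ?I" .
  have "distr M (gauss ?I) (\<lambda>\<omega>. mat_entries r n (S \<omega>)) = distr M (Pi\<^sub>M ?I (\<lambda>_. borel)) (\<lambda>\<omega>. \<lambda>p\<in>?I. S \<omega> $$ p)"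
    by (rule distr_cong) (auto simp: sets_gauss mat_entries_def)
  with * show "distr M (gauss ?I) (\<lambda>\<omega>. mat_entries r n (S \<omega>)) = gauss ?I" by simp
  show "(\<lambda>\<omega>. mat_entries r n (S \<omega>)) \<in> measurable M (gauss ?I)"
    unfolding mat_entries_def using rv by (intro measurable_restrict) (auto simp: measurable_cong_sets[OF refl sets_cgauss])
qed

lemma sets_shrinks:
  "{p \<in> space (gauss ({..<r} \<times> {..<n}) \<Otimes>\<^sub>M gauss ({..<r} \<times> {..<n})). shrinks r n t (fst p) (snd p)}
    \<in> sets (gauss ({..<r} \<times> {..<n}) \<Otimes>\<^sub>M gauss ({..<r} \<times> {..<n}))"
proof -
  let ?P = "gauss ({..<r} \<times> {..<n}) \<Otimes>\<^sub>M gauss ({..<r} \<times> {..<n})"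
  define u where "u y c j = (\<Sum>i<r. cnj (y (i, j)) * c i)" for y :: "nat \<times> nat \<Rightarrow> complex" and c :: "nat \<Rightarrow> complex" and j
  define g where "g p c = sqnorm r (apply_mat n (fst p) (u (snd p) c)) - t * sqnorm n (u (snd p) c)"
    for p :: "(nat \<times> nat \<Rightarrow> complex) \<times> (nat \<times> nat \<Rightarrow> complex)" and c
  have iff: "(\<forall>c. 0 \<le> g p c) \<longleftrightarrow> \<not> shrinks r n t (fst p) (snd p)" for p
    unfolding g_def shrinks_def u_def[abs_def] by (simp add: not_less)
  have "{p \<in> space ?P. \<forall>c. 0 \<le> g p c} \<in> sets ?P"
  proof (rule sets_Collect_all_nonneg)
    fix c :: "nat \<Rightarrow> complex"
    have y: "(\<lambda>p. snd p (i, j)) \<in> borel_measurable ?P" if "i < r" "j < n" for i j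
      using that by (intro measurable_compose[OF measurable_snd measurable_gauss_component]) auto
    have s: "(\<lambda>p. fst p (i, j)) \<in> borel_measurable ?P" if "i < r" "j < n" for i j
      using that by (intro measurable_compose[OF measurable_fst measurable_gauss_component]) auto
    have cy: "(\<lambda>p. cnj (snd p (i, j))) \<in> borel_measurable ?P" if "i < r" "j < n" for i j
      using y[OF that] by (rule borel_measurable_continuous_on[OF continuous_on_cnj[OF continuous_on_id], simplified])
    have um: "(\<lambda>p. u (snd p) c j) \<in> borel_measurable ?P" if "j < n" for j
      unfolding u_def using cy that by (intro borel_measurable_sum borel_measurable_times) auto
    have "(\<lambda>p. apply_mat n (fst p) (u (snd p) c) a) \<in> borel_measurable ?P" if "a < r" for a
      unfolding apply_mat_def using um s that by (intro borel_measurable_sum borel_measurable_times) auto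
    then show "(\<lambda>p. g p c) \<in> borel_measurable ?P"
      unfolding g_def sqnorm_def using um
      by (intro borel_measurable_diff borel_measurable_times borel_measurable_const borel_measurable_sum borel_measurable_power borel_measurable_norm) auto
  next
    fix p show "continuous_on UNIV (g p)"
      unfolding g_def u_def sqnorm_def apply_mat_def by (intro continuous_intros)
  qed
  then have "space ?P - {p \<in> space ?P. \<not> shrinks r n t (fst p) (snd p)} \<in> sets ?P"
    unfolding iff by (rule sets.compl_sets)
  also have "space ?P - {p \<in> space ?P. \<not> shrinks r n t (fst p) (snd p)} = {p \<in> space ?P. shrinks r n t (fst p) (snd p)}"
    by auto
  finally show ?thesis .
qed

lemma sets_not_aligned:
  "{p \<in> space (gauss ({..<r} \<times> {..<n}) \<Otimes>\<^sub>M gauss ({..<r} \<times> {..<n})). \<not> aligned e r n x (fst p) (snd p)}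
    \<in> sets (gauss ({..<r} \<times> {..<n}) \<Otimes>\<^sub>M gauss ({..<r} \<times> {..<n}))"
proof -
  let ?P = "gauss ({..<r} \<times> {..<n}) \<Otimes>\<^sub>M gauss ({..<r} \<times> {..<n})"
  have y: "(\<lambda>p. snd p (i, j)) \<in> borel_measurable ?P" if "i < r" "j < n" for i j
    using that by (intro measurable_compose[OF measurable_snd measurable_gauss_component]) auto
  have s: "(\<lambda>p. fst p (i, j)) \<in> borel_measurable ?P" if "i < r" "j < n" for i j
    using that by (intro measurable_compose[OF measurable_fst measurable_gauss_component]) auto
  have ry: "(\<lambda>p. row_comb r (snd p) w j) \<in> borel_measurable ?P" if "j < n" for w j
    unfolding row_comb_def using y that by (intro borel_measurable_sum borel_measurable_times) auto
  have rs: "(\<lambda>p. row_comb r (fst p) w j) \<in> borel_measurable ?P" if "j < n" for w j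
    unfolding row_comb_def using s that by (intro borel_measurable_sum borel_measurable_times) auto
  have [measurable]: "(\<lambda>p. sqnorm n (\<lambda>j. row_comb r (fst p) w j - row_comb r (snd p) c j)) \<in> borel_measurable ?P" for w c
    unfolding sqnorm_def using ry rs
    by (intro borel_measurable_sum borel_measurable_power borel_measurable_norm borel_measurable_diff) auto
  have [measurable]: "(\<lambda>p. sqnorm n (row_comb r (fst p) w)) \<in> borel_measurable ?P" for w
    unfolding sqnorm_def using rs
    by (intro borel_measurable_sum borel_measurable_power borel_measurable_norm) auto
  show ?thesis unfolding aligned_def by measurable
qed

section \<open>Conditioning and the final union bound\<close>

text \<open>Conditioning on \<open>Y\<close>: the joint law is a product, so the measure of
  \<open>B\<close> is the mean of the measures of its sections. The bound on sections is assumed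
  almost everywhere because the full rank of \<open>Yt\<close> is known only almost surely.\<close>

lemma (in prob_space) emeasure_indep_pair_le:
  assumes ind: "indep_var N1 X N2 Y" and B: "B \<in> sets (N1 \<Otimes>\<^sub>M N2)"
    and q: "AE \<omega> in M. emeasure (distr M N1 X) {s \<in> space N1. (s, Y \<omega>) \<in> B} \<le> q"
  shows "emeasure M {\<omega> \<in> space M. (X \<omega>, Y \<omega>) \<in> B} \<le> q"
proof -
  have X: "random_variable N1 X" and Y: "random_variable N2 Y"
    and D: "distr M N1 X \<Otimes>\<^sub>M distr M N2 Y = distr M (N1 \<Otimes>\<^sub>M N2) (\<lambda>\<omega>. (X \<omega>, Y \<omega>))"
    using ind by (auto simp: indep_var_distribution_eq)
  interpret D1: prob_space "distr M N1 X" using X by (rule prob_space_distr)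
  interpret D2: prob_space "distr M N2 Y" using Y by (rule prob_space_distr)
  interpret D: pair_prob_space "distr M N1 X" "distr M N2 Y" ..
  have B': "B \<in> sets (distr M N1 X \<Otimes>\<^sub>M distr M N2 Y)" using B by (simp add: D)
  have sec: "(\<lambda>s. (s, Y \<omega>)) -` B = {s \<in> space N1. (s, Y \<omega>) \<in> B}" for \<omega>
    using sets.sets_into_space[OF B] by (auto simp: space_pair_measure)
  have meas: "(\<lambda>y. emeasure (distr M N1 X) ((\<lambda>s. (s, y)) -` B)) \<in> borel_measurable N2"
    using D.measurable_emeasure_Pair2[OF B'] by simp
  have "{\<omega> \<in> space M. (X \<omega>, Y \<omega>) \<in> B} = (\<lambda>\<omega>. (X \<omega>, Y \<omega>)) -` B \<inter> space M" by auto
  then have "emeasure M {\<omega> \<in> space M. (X \<omega>, Y \<omega>) \<in> B} = emeasure (distr M (N1 \<Otimes>\<^sub>M N2) (\<lambda>\<omega>. (X \<omega>, Y \<omega>))) B"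
    using X Y B by (subst emeasure_distr) auto
  also have "\<dots> = (\<integral>\<^sup>+y. emeasure (distr M N1 X) ((\<lambda>s. (s, y)) -` B) \<partial>distr M N2 Y)"
    unfolding D[symmetric] by (rule D.emeasure_pair_measure_alt2[OF B'])
  also have "\<dots> = (\<integral>\<^sup>+\<omega>. emeasure (distr M N1 X) {s \<in> space N1. (s, Y \<omega>) \<in> B} \<partial>M)"
    using nn_integral_distr[OF Y, of "\<lambda>y. emeasure (distr M N1 X) ((\<lambda>s. (s, y)) -` B)"] meas by (simp add: sec)
  also have "\<dots> \<le> (\<integral>\<^sup>+\<omega>. q \<partial>M)" by (rule nn_integral_mono_AE[OF q])
  finally show ?thesis by (simp add: emeasure_space_1)
qed

lemma emeasure_Collect_eq_nn_integral:
  assumes "{s \<in> space N. Q s} \<in> sets N"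
  shows "emeasure N {s \<in> space N. Q s} = (\<integral>\<^sup>+s. indicator {s. Q s} s \<partial>N)"
  unfolding nn_integral_indicator[OF assms, symmetric] by (rule nn_integral_cong) (simp add: indicator_def)

lemma mat_entries_apply: "i < r \<Longrightarrow> j < n \<Longrightarrow> mat_entries r n A (i, j) = A $$ (i, j)"
  by (simp add: mat_entries_def)

lemma index_mult_mat_sum:
  assumes "A \<in> carrier_mat m k" "B \<in> carrier_mat k n" "i < m" "j < n"
  shows "(A * B) $$ (i, j) = (\<Sum>l<k. A $$ (i, l) * B $$ (l, j))"
  using assms by (auto simp: scalar_prod_def lessThan_atLeast0 intro!: sum.cong)

lemma vnorm2_square_sqnorm:
  assumes "v \<in> carrier_vec n" "\<And>j. j < n \<Longrightarrow> cmod (v $ j) = cmod (u j)"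
  shows "(vnorm2 v)\<^sup>2 = sqnorm n u"
  using assms by (simp add: vnorm2_square sqnorm_def)

text \<open>Translates the good events, stated for coefficient functions on index pairs, into the
  matrix inequalities of \<open>double_sketch_bound\<close>.\<close>

lemma double_sketch_events:
  fixes S St Zt X0 Z V :: "complex mat"
  defines "Yt \<equiv> St * mat_adjoint X0 + Zt"
  assumes N: "admissible_norm N"
    and S: "S \<in> carrier_mat r n1" and St: "St \<in> carrier_mat r n2" and X0: "X0 \<in> carrier_mat n1 n2"
    and Z: "Z \<in> carrier_mat r n2" and Zt: "Zt \<in> carrier_mat r n1"
    and rk: "mrank Yt = r" and r0: "r0 \<le> n2"
    and V: "gauss_unitary n2 V" and VX: "\<And>a l. a < n1 \<Longrightarrow> r0 \<le> l \<Longrightarrow> l < n2 \<Longrightarrow> (\<Sum>j<n2. V $$ (l, j) * X0 $$ (a, j)) = 0"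
    and t: "0 < t" and x: "0 < x" "x < 1" and \<tau>: "0 < \<tau>"
    and dense: "\<And>X. open X \<Longrightarrow> X \<noteq> {} \<Longrightarrow> \<exists>q. e q \<in> X"
    and y: "\<And>i j. i < r \<Longrightarrow> j < n1 \<Longrightarrow> y (i, j) = Yt $$ (i, j)"
    and EA: "\<not> shrinks r n1 t (mat_entries r n1 S) y"
    and EB: "aligned e r n1 x (mat_entries r n1 S) y"
    and EC: "\<not> contracts r r0 (\<tau>\<^sup>2) (row_app {..<r} n2 V (mat_entries r n2 St))"
  shows "N (mat_adjoint Yt * pinv (S * mat_adjoint Yt) * (S * X0 + Z) - X0) \<le> N Zt / (sqrt x * \<tau>) + N Z / sqrt t"
proof -
  have Yt: "Yt \<in> carrier_mat r n1" using St X0 Zt by (simp add: Yt_def)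
  note Yt' = carrier_mat_adjoint[OF Yt] and S' = carrier_mat_adjoint[OF S]
  have Vc: "V \<in> carrier_mat n2 n2" using V by (rule gauss_unitary_carrier)
  \<comment> \<open>The first \<open>r0\<close> rows of \<open>V\<close>, transposed: since
    \<open>V\<close> times the transpose of \<open>X0\<close> vanishes beyond row \<open>r0\<close>,
    these columns recover \<open>X0\<close> through \<open>V0_X0\<close>.\<close>
  define V0 where "V0 = mat n2 r0 (\<lambda>(j, l). V $$ (l, j))"
  have V0: "V0 \<in> carrier_mat n2 r0" by (simp add: V0_def)
  note V0' = carrier_mat_adjoint[OF V0]
  have V0_orth: "mat_adjoint V0 * V0 = 1\<^sub>m r0"
  proof (rule eq_matI)
    fix l l' assume l: "l < dim_row (1\<^sub>m r0 :: complex mat)" "l' < dim_col (1\<^sub>m r0 :: complex mat)"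
    have "(mat_adjoint V0 * V0) $$ (l, l') = (\<Sum>j<n2. V $$ (l', j) * cnj (V $$ (l, j)))"
      using l V0 r0 by (auto simp: scalar_prod_def lessThan_atLeast0 V0_def mult.commute intro!: sum.cong)
    also have "\<dots> = of_bool (l' = l)" using l r0 by (intro gauss_unitary_rows[OF V]) auto
    finally show "(mat_adjoint V0 * V0) $$ (l, l') = 1\<^sub>m r0 $$ (l, l')" using l by simp
  qed (use V0 in auto)
  have XV: "X0 * V0 \<in> carrier_mat n1 r0" using X0 V0 by simp
  have V0_X0: "X0 * V0 * mat_adjoint V0 = X0"
  proof (rule eq_matI)
    fix a b assume "a < dim_row X0" "b < dim_col X0"
    then have ab: "a < n1" "b < n2" using X0 by auto
    have XVi: "(X0 * V0) $$ (a, l) = (\<Sum>j<n2. V $$ (l, j) * X0 $$ (a, j))" if "l < r0" for l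
      using that ab X0 V0 by (auto simp: scalar_prod_def lessThan_atLeast0 V0_def mult.commute intro!: sum.cong)
    have "(X0 * V0 * mat_adjoint V0) $$ (a, b) = (\<Sum>l<r0. (X0 * V0) $$ (a, l) * mat_adjoint V0 $$ (l, b))"
      by (rule index_mult_mat_sum[OF XV V0' ab])
    also have "\<dots> = (\<Sum>l<r0. cnj (V $$ (l, b)) * (\<Sum>j<n2. V $$ (l, j) * X0 $$ (a, j)))"
    proof (intro sum.cong refl)
      fix l assume "l \<in> {..<r0}"
      then show "(X0 * V0) $$ (a, l) * mat_adjoint V0 $$ (l, b) = cnj (V $$ (l, b)) * (\<Sum>j<n2. V $$ (l, j) * X0 $$ (a, j))"
        using XVi[of l] ab V0 by (simp add: V0_def del: index_mult_mat(1))
    qed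
    also have "\<dots> = (\<Sum>l<n2. cnj (V $$ (l, b)) * (\<Sum>j<n2. V $$ (l, j) * X0 $$ (a, j)))"
      using VX ab by (intro sum_vanishing_tail[symmetric] r0) simp
    also have "\<dots> = X0 $$ (a, b)" by (rule gauss_unitary_inverse(1)[OF V ab(2)])
    finally show "(X0 * V0 * mat_adjoint V0) $$ (a, b) = X0 $$ (a, b)" .
  qed (use X0 V0 in auto)
  show ?thesis
    unfolding Yt_def
  proof (rule double_sketch_bound[OF N S St X0 Z Zt V0 V0_orth V0_X0 _ t _ x _ \<tau>], unfold Yt_def[symmetric])
    fix c :: "complex Matrix.vec" assume "c \<in> carrier_vec r" "mat_adjoint Yt *\<^sub>v c = 0\<^sub>v n1"
    then show "c = 0\<^sub>v r" by (rule adjoint_injective_of_full_row_rank[OF Yt rk])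
  next
    fix c :: "complex Matrix.vec" assume c: "c \<in> carrier_vec r"
    define u where "u j = (\<Sum>i<r. cnj (y (i, j)) * c $ i)" for j
    have Yc: "mat_adjoint Yt *\<^sub>v c \<in> carrier_vec n1" by (rule mult_mat_vec_carrier[OF Yt' c])
    have u: "(mat_adjoint Yt *\<^sub>v c) $ j = u j" if "j < n1" for j
      using that Yt y unfolding index_mult_mat_vec_sum[OF Yt' c that] u_def by (intro sum.cong) auto
    have Su: "(S *\<^sub>v (mat_adjoint Yt *\<^sub>v c)) $ a = apply_mat n1 (mat_entries r n1 S) u a" if "a < r" for a
      using that unfolding index_mult_mat_vec_sum[OF S Yc that] apply_mat_def
      by (intro sum.cong refl) (simp add: u mat_entries_apply del: index_mult_mat_vec)
    have "t * sqnorm n1 u \<le> sqnorm r (apply_mat n1 (mat_entries r n1 S) u)"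
      using EA unfolding shrinks_def u_def[abs_def] not_ex not_less by blast
    moreover have "(vnorm2 (mat_adjoint Yt *\<^sub>v c))\<^sup>2 = sqnorm n1 u"
      using u by (intro vnorm2_square_sqnorm[OF Yc]) (simp del: index_mult_mat_vec)
    moreover have "(vnorm2 (S *\<^sub>v (mat_adjoint Yt *\<^sub>v c)))\<^sup>2 = sqnorm r (apply_mat n1 (mat_entries r n1 S) u)"
      using Su by (intro vnorm2_square_sqnorm mult_mat_vec_carrier[OF S Yc]) (simp del: index_mult_mat_vec)
    ultimately show "t * (vnorm2 (mat_adjoint Yt *\<^sub>v c))\<^sup>2 \<le> (vnorm2 (S *\<^sub>v (mat_adjoint Yt *\<^sub>v c)))\<^sup>2" by simp
  next
    fix v d :: "complex Matrix.vec"
    assume v: "v \<in> carrier_vec r" and d: "d \<in> carrier_vec n1" and Yd: "Yt *\<^sub>v d = 0\<^sub>v r"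
    \<comment> \<open>Conjugated, since the adjoint of \<open>S\<close> applied to \<open>v\<close>
      is the conjugate of the combination of the rows of \<open>S\<close> with coefficients
      \<open>cnj (v $ i)\<close>.\<close>
    define w where "w i = cnj (v $ i)" for i
    define p where "p = row_comb r (mat_entries r n1 S) w"
    have Sv: "mat_adjoint S *\<^sub>v v \<in> carrier_vec n1" by (rule mult_mat_vec_carrier[OF S' v])
    have s: "(mat_adjoint S *\<^sub>v v) $ j = cnj (p j)" if "j < n1" for j
      using that S unfolding index_mult_mat_vec_sum[OF S' v that] p_def row_comb_def w_def
      by (simp add: mat_entries_apply mult.commute)
    have "(\<Sum>j<n1. y (i, j) * d $ j) = 0" if "i < r" for i
    proof -
      have "(Yt *\<^sub>v d) $ i = (\<Sum>j<n1. y (i, j) * d $ j)"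
        using that y unfolding index_mult_mat_vec_sum[OF Yt d that] by (intro sum.cong) auto
      then show ?thesis using Yd that by simp
    qed
    from aligned_orthogonal_bound[OF dense EB this]
    have "(cmod (\<Sum>j<n1. p j * d $ j))\<^sup>2 \<le> (1 - x) * sqnorm n1 p * sqnorm n1 (\<lambda>j. d $ j)"
      by (simp add: p_def)
    moreover have "cip (mat_adjoint S *\<^sub>v v) d = cnj (\<Sum>j<n1. p j * d $ j)"
      using d s by (simp add: cip_def del: index_mult_mat_vec)
    then have "cmod (cip (mat_adjoint S *\<^sub>v v) d) = cmod (\<Sum>j<n1. p j * d $ j)" by (simp only: complex_mod_cnj)
    moreover have "(vnorm2 (mat_adjoint S *\<^sub>v v))\<^sup>2 = sqnorm n1 p"
      using s by (intro vnorm2_square_sqnorm[OF Sv]) (simp del: index_mult_mat_vec)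
    moreover have "(vnorm2 d)\<^sup>2 = sqnorm n1 (\<lambda>j. d $ j)"
      by (intro vnorm2_square_sqnorm[OF d]) simp
    ultimately show "(cmod (cip (mat_adjoint S *\<^sub>v v) d))\<^sup>2 \<le> (1 - x) * (vnorm2 (mat_adjoint S *\<^sub>v v))\<^sup>2 * (vnorm2 d)\<^sup>2"
      by simp
  next
    fix c :: "complex Matrix.vec" assume c: "c \<in> carrier_vec r0"
    have Vcc: "V0 *\<^sub>v c \<in> carrier_vec n2" by (rule mult_mat_vec_carrier[OF V0 c])
    let ?G = "row_app {..<r} n2 V (mat_entries r n2 St)"
    have V0c: "(V0 *\<^sub>v c) $ j = (\<Sum>l<r0. V $$ (l, j) * c $ l)" if "j < n2" for j
      unfolding index_mult_mat_vec_sum[OF V0 c that] using that by (intro sum.cong) (auto simp: V0_def)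
    have "(St *\<^sub>v (V0 *\<^sub>v c)) $ a = apply_mat r0 ?G (\<lambda>l. c $ l) a" if a: "a < r" for a
    proof -
      have "(St *\<^sub>v (V0 *\<^sub>v c)) $ a = (\<Sum>j<n2. St $$ (a, j) * (\<Sum>l<r0. V $$ (l, j) * c $ l))"
        unfolding index_mult_mat_vec_sum[OF St Vcc a]
        by (intro sum.cong refl) (simp add: V0c del: index_mult_mat_vec)
      also have "\<dots> = (\<Sum>j<n2. \<Sum>l<r0. V $$ (l, j) * St $$ (a, j) * c $ l)"
        by (simp add: sum_distrib_left mult_ac)
      also have "\<dots> = (\<Sum>l<r0. \<Sum>j<n2. V $$ (l, j) * St $$ (a, j) * c $ l)" by (rule sum.swap)
      also have "\<dots> = apply_mat r0 ?G (\<lambda>l. c $ l) a"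
        using a r0 unfolding apply_mat_def
        by (intro sum.cong refl) (simp add: mat_entries_apply sum_distrib_right)
      finally show ?thesis .
    qed
    then have "(vnorm2 (St *\<^sub>v (V0 *\<^sub>v c)))\<^sup>2 = sqnorm r (apply_mat r0 ?G (\<lambda>l. c $ l))"
      by (intro vnorm2_square_sqnorm mult_mat_vec_carrier[OF St Vcc]) (simp del: index_mult_mat_vec)
    moreover have "(vnorm2 c)\<^sup>2 = sqnorm r0 (\<lambda>l. c $ l)" by (intro vnorm2_square_sqnorm[OF c]) simp
    moreover have "\<tau>\<^sup>2 * sqnorm r0 (\<lambda>l. c $ l) \<le> sqnorm r (apply_mat r0 ?G (\<lambda>l. c $ l))"
      using EC unfolding contracts_def not_ex not_less by blast
    ultimately have "(\<tau> * vnorm2 c)\<^sup>2 \<le> (vnorm2 (St *\<^sub>v (V0 *\<^sub>v c)))\<^sup>2"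
      by (simp add: power_mult_distrib)
    then show "\<tau> * vnorm2 c \<le> vnorm2 (St *\<^sub>v (V0 *\<^sub>v c))"
      by (rule power2_le_imp_le) simp
  qed
qed

lemma dense_sequence_exists:
  "\<exists>e :: nat \<Rightarrow> 'a :: second_countable_topology. \<forall>X. open X \<longrightarrow> X \<noteq> {} \<longrightarrow> (\<exists>q. e q \<in> X)"
proof -
  obtain D :: "'a set" where D: "countable D" "\<And>X. open X \<Longrightarrow> X \<noteq> {} \<Longrightarrow> \<exists>d\<in>D. d \<in> X"
    using countable_dense_exists by metis
  then have "D \<noteq> {}" using D(2)[OF open_UNIV] by auto
  with D show ?thesis by (intro exI[of _ "from_nat_into D"]) (metis from_nat_into_surj)
qed

theorem theorem2:
  fixes M :: "'a measure"
    and n1 n2 r r0 :: nat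
    and X0 Z :: "complex mat"
    and S St Zt :: "'a \<Rightarrow> complex mat"
    and N :: "complex mat \<Rightarrow> real"
    and \<delta>1 \<delta>2 \<epsilon> :: real
  assumes "prob_space M"
    and "0 < r0" "r0 < r" "r < n1" "0 < n2"
    and "X0 \<in> carrier_mat n1 n2" "mrank X0 = r0"
    and "std_complex_gaussian_mat M r n1 S"
    and "std_complex_gaussian_mat M r n2 St"
    and "Z \<in> carrier_mat r n2"
    and "\<forall>\<omega>\<in>space M. Zt \<omega> \<in> carrier_mat r n1"
    and "prob_space.indep_var M
           (entries_space [(r,n1)]) (\<lambda>\<omega>. entries [(r,n1)] [S \<omega>])
           (entries_space [(r,n2),(r,n1)]) (\<lambda>\<omega>. entries [(r,n2),(r,n1)] [St \<omega>, Zt \<omega>])"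
    and "AE \<omega> in M. mrank (St \<omega> * mat_adjoint X0 + Zt \<omega>) = r"
    and "admissible_norm N"
    and "0 < \<delta>1" "0 < \<epsilon>" "\<epsilon> < 1"
    and "exp (- (sqrt (real r) - sqrt (real r0))\<^sup>2) < \<delta>2" "\<delta>2 < 1"
  shows "\<exists>A\<in>sets M. prob_space.prob M A \<ge> 1 - \<delta>1 - \<delta>2 - \<epsilon> \<and>
           (\<forall>\<omega>\<in>A.
              (let Y = S \<omega> * X0 + Z;
                   Yt = St \<omega> * mat_adjoint X0 + Zt \<omega>;
                   X = mat_adjoint Yt * pinv (S \<omega> * mat_adjoint Yt) * Y
               in N (X - X0) \<le>
                    sqrt (real r * real (n1 - r)) * N (Zt \<omega>)
                      / (sqrt \<delta>1 * (sqrt (real r) - sqrt (real r0) - sqrt (ln (1 / \<delta>2))))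
                    + sqrt (real r) * N Z / sqrt (ln (1 / (1 - \<epsilon>)))))"
proof -
  interpret prob_space M by fact
  have \<delta>2: "0 < \<delta>2" by (rule less_trans[OF exp_gt_zero assms(18)])
  show ?thesis
  \<comment> \<open>For \<delta>1 at least 1 the claimed probability is negative and the empty event
    serves; otherwise \<open>x\<close> below is smaller than 1.\<close>
  proof (cases "\<delta>1 < 1")
    case False
    then show ?thesis using \<delta>2 \<open>0 < \<epsilon>\<close> by (intro bexI[of _ "{}"]) auto
  next
    case True
    define k where "k = n1 - r"
    have n1: "n1 = r + k" "0 < k" "0 < r" using assms(3,4) by (auto simp: k_def)
    \<comment> \<open>Makes the Bernoulli bound \<open>real (r * k) * x\<close> of
      \<open>nn_integral_not_aligned_le\<close> equal to \<delta>1.\<close>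
    define x where "x = \<delta>1 / real (r * k)"
    have rk1: "1 \<le> real (r * k)" using n1 by (simp add: Suc_leI flip: of_nat_mult)
    have x: "0 < x" "x < 1" "real (r * k) * x = \<delta>1"
    proof -
      show "0 < x" using rk1 \<open>0 < \<delta>1\<close> unfolding x_def by (intro divide_pos_pos) linarith+
      show "real (r * k) * x = \<delta>1" using rk1 unfolding x_def by (metis nonzero_mult_div_cancel_left not_one_le_zero times_divide_eq_right)
      have "\<delta>1 < 1 * real (r * k)" using rk1 True by linarith
      then show "x < 1" using rk1 unfolding x_def by (subst pos_divide_less_eq) linarith+
    qed
    \<comment> \<open>Solves \<open>1 - exp (- (real r * t)) = \<epsilon>\<close>, the bound of
      \<open>nn_integral_shrinks_le\<close>.\<close>
    define t where "t = ln (1 / (1 - \<epsilon>)) / real r"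
    have lnpos: "0 < ln (1 / (1 - \<epsilon>))" using \<open>0 < \<epsilon>\<close> \<open>\<epsilon> < 1\<close> by (intro ln_gt_zero) simp
    then have t: "0 < t" using n1 by (simp add: t_def)
    have "real r * t = ln (1 / (1 - \<epsilon>))" using n1 by (simp add: t_def)
    then have expt: "1 - exp (- (real r * t)) = \<epsilon>" using \<open>\<epsilon> < 1\<close> by (simp add: ln_div)
    \<comment> \<open>Solves \<open>exp (- s\<^sup>2) = \<delta>2\<close>; the lower bound assumed
      for \<delta>2 says exactly that \<open>s\<close> stays below the difference of the square
      roots.\<close>
    define s where "s = sqrt (ln (1 / \<delta>2))"
    have ln2: "0 < ln (1 / \<delta>2)" using \<delta>2 \<open>\<delta>2 < 1\<close> by (intro ln_gt_zero) simp
    have s0: "0 < s" using ln2 by (simp add: s_def)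
    have exps: "exp (- s\<^sup>2) = \<delta>2" using ln2 \<delta>2 by (simp add: s_def ln_div)
    have gap: "0 < sqrt (real r) - sqrt (real r0)" using \<open>r0 < r\<close> by simp
    have "s < sqrt (real r) - sqrt (real r0)"
    proof (rule power2_less_imp_less)
      show "s\<^sup>2 < (sqrt (real r) - sqrt (real r0))\<^sup>2" using assms(18) unfolding exps[symmetric] by simp
    qed (use gap in simp)
    note s = s0 this
    define \<tau> where "\<tau> = sqrt (real r) - sqrt (real r0) - s"
    have \<tau>: "0 < \<tau>" using s by (simp add: \<tau>_def)
    have X0: "X0 \<in> carrier_mat n1 n2" by fact
    have r0n2: "r0 \<le> n2"
      using vec_space.rank_le_nc[OF X0] \<open>mrank X0 = r0\<close> X0 by (simp add: mrank_def)
    obtain V where V: "gauss_unitary n2 V"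
      and VX: "\<And>a l. a < n1 \<Longrightarrow> r0 \<le> l \<Longrightarrow> l < n2 \<Longrightarrow> (\<Sum>j<n2. V $$ (l, j) * X0 $$ (a, j)) = 0"
      using gauss_unitary_row_space[OF X0] r0n2 \<open>mrank X0 = r0\<close> by auto
    obtain e :: "nat \<Rightarrow> nat \<Rightarrow> complex" where dense: "\<And>X. open X \<Longrightarrow> X \<noteq> {} \<Longrightarrow> \<exists>q. e q \<in> X"
      using dense_sequence_exists by metis
    define Yt where "Yt \<omega> = St \<omega> * mat_adjoint X0 + Zt \<omega>" for \<omega>
    have Sc: "S \<omega> \<in> carrier_mat r n1" and Stc: "St \<omega> \<in> carrier_mat r n2" and Ztc: "Zt \<omega> \<in> carrier_mat r n1"
      if "\<omega> \<in> space M" for \<omega>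
      using assms(8,9,11) that by (auto simp: std_complex_gaussian_mat_def)
    have Ytc: "Yt \<omega> \<in> carrier_mat r n1" if "\<omega> \<in> space M" for \<omega>
      using Stc[OF that] Ztc[OF that] X0 by (simp add: Yt_def)
    let ?I = "{..<r} \<times> {..<n1}"
    let ?G = "gauss ?I"
    define fS where "fS u = restrict (\<lambda>(i, j). u (0, i, j)) ?I" for u :: "nat \<times> nat \<times> nat \<Rightarrow> complex"
    \<comment> \<open>Computes the entries of \<open>Yt\<close> from those of the pair
      (\<open>St\<close>, \<open>Zt\<close>), so that the independence of \<open>S\<close> from the
      pair passes to \<open>S\<close> and \<open>Yt\<close>.\<close>
    define fY where "fY u = restrict (\<lambda>(i, j). (\<Sum>l<n2. u (0, i, l) * cnj (X0 $$ (j, l))) + u (1, i, j)) ?I" for u :: "nat \<times> nat \<times> nat \<Rightarrow> complex"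
    define xS where "xS \<omega> = mat_entries r n1 (S \<omega>)" for \<omega>
    define xY where "xY \<omega> = fY (entries [(r,n2),(r,n1)] [St \<omega>, Zt \<omega>])" for \<omega>
    have xY: "xY \<omega> (i, j) = Yt \<omega> $$ (i, j)" if "\<omega> \<in> space M" "i < r" "j < n1" for \<omega> i j
    proof -
      have c: "mat_adjoint X0 \<in> carrier_mat n2 n1" using X0 by simp
      have "Yt \<omega> $$ (i, j) = (St \<omega> * mat_adjoint X0) $$ (i, j) + Zt \<omega> $$ (i, j)"
        unfolding Yt_def using that Ztc[OF that(1)] by (intro index_add_mat) auto
      also have "(St \<omega> * mat_adjoint X0) $$ (i, j) = (\<Sum>l<n2. St \<omega> $$ (i, l) * cnj (X0 $$ (j, l)))"
        unfolding index_mult_mat_sum[OF Stc[OF that(1)] c that(2,3)] using X0 that by (intro sum.cong) auto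
      finally show ?thesis using that by (simp add: xY_def fY_def entries_def entry_index_def)
    qed
    have comp: "(\<lambda>u. u p) \<in> borel_measurable (entries_space ds)" if "p \<in> entry_index ds" for p ds
      unfolding entries_space_def using that by (rule measurable_component_singleton)
    have "fS \<in> measurable (entries_space [(r,n1)]) ?G"
      unfolding fS_def
    proof (rule measurable_restrict)
      fix p assume "p \<in> ?I"
      then show "(\<lambda>u. case p of (i, j) \<Rightarrow> u (0, i, j)) \<in> measurable (entries_space [(r,n1)]) cgauss"
        using comp[of "(0, fst p, snd p)" "[(r,n1)]"]
        by (auto simp: split_def entry_index_def measurable_cong_sets[OF refl sets_cgauss])
    qed
    moreover have "fY \<in> measurable (entries_space [(r,n2),(r,n1)]) ?G"
      unfolding fY_def
    proof (rule measurable_restrict)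
      fix p assume p: "p \<in> ?I"
      have "(\<lambda>u. (\<Sum>l<n2. u (0, fst p, l) * cnj (X0 $$ (snd p, l))) + u (1, fst p, snd p)) \<in> borel_measurable (entries_space [(r,n2),(r,n1)])"
        using p by (intro borel_measurable_add borel_measurable_sum borel_measurable_times borel_measurable_const comp)
          (auto simp: entry_index_def)
      then show "(\<lambda>u. case p of (i, j) \<Rightarrow> (\<Sum>l<n2. u (0, i, l) * cnj (X0 $$ (j, l))) + u (1, i, j)) \<in> measurable (entries_space [(r,n2),(r,n1)]) cgauss"
        by (simp add: split_def measurable_cong_sets[OF refl sets_cgauss])
    qed
    ultimately have "indep_var ?G (fS \<circ> (\<lambda>\<omega>. entries [(r,n1)] [S \<omega>])) ?G (fY \<circ> (\<lambda>\<omega>. entries [(r,n2),(r,n1)] [St \<omega>, Zt \<omega>]))"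
      by (rule indep_var_compose[OF assms(12)])
    moreover have "fS \<circ> (\<lambda>\<omega>. entries [(r,n1)] [S \<omega>]) = xS"
      by (auto simp: fun_eq_iff fS_def xS_def mat_entries_def entries_def entry_index_def restrict_def)
    moreover have "fY \<circ> (\<lambda>\<omega>. entries [(r,n2),(r,n1)] [St \<omega>, Zt \<omega>]) = xY"
      by (simp add: fun_eq_iff xY_def)
    ultimately have indep: "indep_var ?G xS ?G xY" by simp
    have lawS: "distr M ?G xS = ?G"
      unfolding xS_def using distr_gaussian_mat(1)[OF assms(1,8)] n1 by simp
    define B1 where "B1 = {p \<in> space (?G \<Otimes>\<^sub>M ?G). shrinks r n1 t (fst p) (snd p)}"
    define B2 where "B2 = {p \<in> space (?G \<Otimes>\<^sub>M ?G). \<not> aligned e r n1 x (fst p) (snd p)}"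
    have B: "B1 \<in> sets (?G \<Otimes>\<^sub>M ?G)" "B2 \<in> sets (?G \<Otimes>\<^sub>M ?G)"
      unfolding B1_def B2_def by (rule sets_shrinks, rule sets_not_aligned)
    have xSm: "xS \<in> measurable M ?G" and xYm: "xY \<in> measurable M ?G"
      using indep by (auto simp: indep_var_distribution_eq)
    have xYs: "xY \<omega> \<in> space ?G" if "\<omega> \<in> space M" for \<omega> using measurable_space[OF xYm that] .
    have sec: "{s \<in> space ?G. (s, xY \<omega>) \<in> B} \<in> sets ?G" if "B \<in> sets (?G \<Otimes>\<^sub>M ?G)" for B \<omega>
    proof -
      have "(\<lambda>s. (s, xY \<omega>)) -` B = {s \<in> space ?G. (s, xY \<omega>) \<in> B}"
        using sets.sets_into_space[OF that] by (auto simp: space_pair_measure)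
      then show ?thesis using sets_Pair2[OF that, of "xY \<omega>"] by simp
    qed
    have "emeasure M {\<omega> \<in> space M. (xS \<omega>, xY \<omega>) \<in> B1} \<le> ennreal \<epsilon>"
    proof (rule emeasure_indep_pair_le[OF indep B(1)], rule AE_I2)
      fix \<omega> assume \<omega>: "\<omega> \<in> space M"
      have "emeasure ?G {s \<in> space ?G. (s, xY \<omega>) \<in> B1} = (\<integral>\<^sup>+s. indicator {s. (s, xY \<omega>) \<in> B1} s \<partial>?G)"
        by (rule emeasure_Collect_eq_nn_integral[OF sec[OF B(1)]])
      also have "\<dots> \<le> (\<integral>\<^sup>+s. indicator {s. shrinks r n1 t s (xY \<omega>)} s \<partial>?G)"
        by (intro nn_integral_mono) (auto simp: B1_def indicator_def)
      also have "\<dots> \<le> ennreal \<epsilon>"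
        using nn_integral_shrinks_le[of r n1 t "xY \<omega>"] t assms(4) unfolding expt by simp
      finally show "emeasure (distr M ?G xS) {s \<in> space ?G. (s, xY \<omega>) \<in> B1} \<le> ennreal \<epsilon>" by (simp only: lawS)
    qed
    moreover have "emeasure M {\<omega> \<in> space M. (xS \<omega>, xY \<omega>) \<in> B2} \<le> ennreal \<delta>1"
    proof (rule emeasure_indep_pair_le[OF indep B(2)])
      \<comment> \<open>Full rank of \<open>Yt\<close> provides the independent rows required by
        \<open>nn_integral_not_aligned_le\<close>.\<close>
      have "AE \<omega> in M. mrank (Yt \<omega>) = r" using assms(13) by (simp add: Yt_def)
      with AE_space show "AE \<omega> in M. emeasure (distr M ?G xS) {s \<in> space ?G. (s, xY \<omega>) \<in> B2} \<le> ennreal \<delta>1"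
      proof eventually_elim
        case (elim \<omega>)
        have ind: "c i = 0" if c: "\<And>j. j < r + k \<Longrightarrow> row_comb r (xY \<omega>) c j = 0" and i: "i < r" for c i
        proof -
          let ?c = "vec r (\<lambda>i. cnj (c i))"
          have Yc: "mat_adjoint (Yt \<omega>) \<in> carrier_mat n1 r" using Ytc[OF elim(1)] by simp
          have "mat_adjoint (Yt \<omega>) *\<^sub>v ?c = 0\<^sub>v n1"
          proof (rule eq_vecI)
            fix j assume "j < dim_vec (0\<^sub>v n1 :: complex Matrix.vec)"
            then have j: "j < n1" by simp
            have "(mat_adjoint (Yt \<omega>) *\<^sub>v ?c) $ j = (\<Sum>i<r. mat_adjoint (Yt \<omega>) $$ (j, i) * ?c $ i)"
              by (rule index_mult_mat_vec_sum[OF Yc _ j]) simp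
            also have "\<dots> = cnj (row_comb r (xY \<omega>) c j)"
              using Ytc[OF elim(1)] j elim(1) by (simp add: row_comb_def xY mult.commute)
            also have "\<dots> = 0" using c j n1 by simp
            finally show "(mat_adjoint (Yt \<omega>) *\<^sub>v ?c) $ j = 0\<^sub>v n1 $ j" using j by simp
          qed (use Ytc[OF elim(1)] in auto)
          then have "?c = 0\<^sub>v r"
            by (intro adjoint_injective_of_full_row_rank[OF Ytc[OF elim(1)] elim(2)]) auto
          then have "?c $ i = 0" using i by simp
          then show ?thesis using i by simp
        qed
        have "emeasure ?G {s \<in> space ?G. (s, xY \<omega>) \<in> B2} = (\<integral>\<^sup>+s. indicator {s. (s, xY \<omega>) \<in> B2} s \<partial>?G)"
          by (rule emeasure_Collect_eq_nn_integral[OF sec[OF B(2)]])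
        also have "\<dots> \<le> (\<integral>\<^sup>+s. indicator {s. \<not> aligned e r n1 x s (xY \<omega>)} s \<partial>?G)"
          by (intro nn_integral_mono) (auto simp: B2_def indicator_def)
        also have "\<dots> \<le> ennreal \<delta>1"
          unfolding n1(1) x(3)[symmetric]
        proof (rule nn_integral_not_aligned_le)
          show "\<exists>q. e q \<in> X" if "open X" "X \<noteq> {}" for X by (rule dense[OF that])
          show "c i = 0" if "\<And>j. j < r + k \<Longrightarrow> row_comb r (xY \<omega>) c j = 0" "i < r" for c i by (rule ind[OF that])
        qed (rule x)+
        finally show ?case by (simp only: lawS)
      qed
    qed
    moreover
    \<comment> \<open>This event is determined by \<open>St\<close>; \<open>Zt\<close> does not
      enter, so no independence between the two is called for.\<close>
    define B3 where "B3 = {\<omega> \<in> space M. contracts r r0 (\<tau>\<^sup>2) (row_app {..<r} n2 V (mat_entries r n2 (St \<omega>)))}"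
    have "B3 \<in> sets M \<and> emeasure M B3 \<le> ennreal \<delta>2"
    proof -
      let ?H = "gauss ({..<r} \<times> {..<n2})"
      have T: "(\<lambda>\<omega>. mat_entries r n2 (St \<omega>)) \<in> measurable M ?H" "distr M ?H (\<lambda>\<omega>. mat_entries r n2 (St \<omega>)) = ?H"
        using distr_gaussian_mat[OF assms(1,9)] n1 assms(5) by auto
      have im: "(\<lambda>G. indicator {G. contracts r r0 (\<tau>\<^sup>2) G} G :: ennreal) \<in> borel_measurable ?H"
        by (rule measurable_indicator_contracts[OF r0n2])
      have rm: "(\<lambda>G. indicator {G. contracts r r0 (\<tau>\<^sup>2) G} (row_app {..<r} n2 V G) :: ennreal) \<in> borel_measurable ?H"
        using measurable_compose[OF measurable_row_app im] by simp
      have mm: "(\<lambda>\<omega>. indicator {G. contracts r r0 (\<tau>\<^sup>2) G} (row_app {..<r} n2 V (mat_entries r n2 (St \<omega>))) :: ennreal) \<in> borel_measurable M"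
        using measurable_compose[OF T(1) rm] by simp
      have "B3 = {\<omega> \<in> space M. (indicator {G. contracts r r0 (\<tau>\<^sup>2) G} (row_app {..<r} n2 V (mat_entries r n2 (St \<omega>))) :: ennreal) = 1}"
        by (auto simp: B3_def indicator_def)
      also have "\<dots> \<in> sets M" using mm by measurable
      finally have B3: "B3 \<in> sets M" .
      have "emeasure M B3 = (\<integral>\<^sup>+\<omega>. indicator {G. contracts r r0 (\<tau>\<^sup>2) G} (row_app {..<r} n2 V (mat_entries r n2 (St \<omega>))) \<partial>M)"
        unfolding nn_integral_indicator[OF B3, symmetric] by (rule nn_integral_cong) (simp add: B3_def indicator_def)
      also have "\<dots> = (\<integral>\<^sup>+G. indicator {G. contracts r r0 (\<tau>\<^sup>2) G} (row_app {..<r} n2 V G) \<partial>?H)"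
        using nn_integral_distr[OF T(1), of "\<lambda>G. indicator {G. contracts r r0 (\<tau>\<^sup>2) G} (row_app {..<r} n2 V G)"] rm by (simp add: T(2))
      also have "\<dots> = (\<integral>\<^sup>+G. indicator {G. contracts r r0 (\<tau>\<^sup>2) G} G \<partial>?H)"
        by (rule nn_integral_row_app[OF V _ im]) simp
      also have "\<dots> = (\<integral>\<^sup>+G. indicator {G. contracts r r0 (\<tau>\<^sup>2) G} G \<partial>gauss ({..<r} \<times> {..<r0}))"
        by (rule nn_integral_contracts_restrict[OF r0n2])
      also have "\<dots> \<le> ennreal \<delta>2"
        using nn_integral_contracts_le[OF \<open>0 < r0\<close> s] by (simp only: exps \<tau>_def)
      finally show ?thesis using B3 by blast
    qed
    \<comment> \<open>The set where the rank fails is replaced by a measurable null set containing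
      it, so that the final event is measurable.\<close>
    moreover obtain Q where Q: "{\<omega> \<in> space M. \<not> mrank (Yt \<omega>) = r} \<subseteq> Q" "emeasure M Q = 0" "Q \<in> sets M"
      using assms(13) unfolding Yt_def by (rule AE_E)
    moreover define C1 C2 where "C1 = {\<omega> \<in> space M. (xS \<omega>, xY \<omega>) \<in> B1}" and "C2 = {\<omega> \<in> space M. (xS \<omega>, xY \<omega>) \<in> B2}"
    moreover have Cs: "C1 \<in> sets M" "C2 \<in> sets M"
    proof -
      have "(\<lambda>\<omega>. (xS \<omega>, xY \<omega>)) \<in> measurable M (?G \<Otimes>\<^sub>M ?G)" using xSm xYm by measurable
      from measurable_sets[OF this B(1)] measurable_sets[OF this B(2)] show "C1 \<in> sets M" "C2 \<in> sets M"
        by (auto simp: C1_def C2_def vimage_def Int_def conj_commute)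
    qed
    ultimately have p: "prob C1 \<le> \<epsilon>" "prob C2 \<le> \<delta>1" "prob B3 \<le> \<delta>2" "prob Q = 0" and B3: "B3 \<in> sets M" and Qs: "Q \<in> sets M"
      using \<open>0 < \<epsilon>\<close> \<open>0 < \<delta>1\<close> \<delta>2 by (simp_all add: emeasure_eq_measure)
    define A where "A = space M - (C1 \<union> C2 \<union> B3 \<union> Q)"
    have As: "A \<in> sets M" using Cs B3 Qs by (auto simp: A_def)
    have "prob (C1 \<union> C2 \<union> B3 \<union> Q) \<le> prob C1 + prob C2 + prob B3 + prob Q"
      using measure_Un_le[of "C1 \<union> C2 \<union> B3" M Q] measure_Un_le[of "C1 \<union> C2" M B3]
        measure_Un_le[of C1 M C2] Cs B3 Qs by auto
    then have "prob (C1 \<union> C2 \<union> B3 \<union> Q) \<le> \<epsilon> + \<delta>1 + \<delta>2" using p by linarith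
    moreover have "prob A = 1 - prob (C1 \<union> C2 \<union> B3 \<union> Q)"
      unfolding A_def using Cs B3 Qs by (intro prob_compl) auto
    ultimately have pA: "1 - \<delta>1 - \<delta>2 - \<epsilon> \<le> prob A" by linarith
    have "N (mat_adjoint (Yt \<omega>) * pinv (S \<omega> * mat_adjoint (Yt \<omega>)) * (S \<omega> * X0 + Z) - X0)
      \<le> sqrt (real r * real (n1 - r)) * N (Zt \<omega>) / (sqrt \<delta>1 * \<tau>) + sqrt (real r) * N Z / sqrt (ln (1 / (1 - \<epsilon>)))"
      if \<omega>A: "\<omega> \<in> A" for \<omega>
    proof -
      have \<omega>: "\<omega> \<in> space M" and nC: "\<omega> \<notin> C1" "\<omega> \<notin> C2" "\<omega> \<notin> B3" "\<omega> \<notin> Q" using \<omega>A by (auto simp: A_def)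
      have sp: "(xS \<omega>, xY \<omega>) \<in> space (?G \<Otimes>\<^sub>M ?G)"
        using measurable_space[OF xSm \<omega>] xYs[OF \<omega>] by (simp add: space_pair_measure)
      have "N (mat_adjoint (Yt \<omega>) * pinv (S \<omega> * mat_adjoint (Yt \<omega>)) * (S \<omega> * X0 + Z) - X0) \<le> N (Zt \<omega>) / (sqrt x * \<tau>) + N Z / sqrt t"
        unfolding Yt_def
      proof (rule double_sketch_events[where e = e and y = "xY \<omega>" and V = V and ?r0.0 = r0 and ?n1.0 = n1 and ?n2.0 = n2])
        show "mrank (St \<omega> * mat_adjoint X0 + Zt \<omega>) = r" unfolding Yt_def[symmetric] using nC(4) \<omega> Q(1) by blast
        show "\<And>i j. i < r \<Longrightarrow> j < n1 \<Longrightarrow> xY \<omega> (i, j) = (St \<omega> * mat_adjoint X0 + Zt \<omega>) $$ (i, j)"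
          unfolding Yt_def[symmetric] by (rule xY[OF \<omega>])
        show "\<exists>q. e q \<in> X" if "open X" "X \<noteq> {}" for X by (rule dense[OF that])
        show "(\<Sum>j<n2. V $$ (l, j) * X0 $$ (a, j)) = 0" if "a < n1" "r0 \<le> l" "l < n2" for a l by (rule VX[OF that])
        show "\<not> shrinks r n1 t (mat_entries r n1 (S \<omega>)) (xY \<omega>)"
          using nC(1) \<omega> sp by (simp add: C1_def B1_def xS_def)
        show "aligned e r n1 x (mat_entries r n1 (S \<omega>)) (xY \<omega>)"
          using nC(2) \<omega> sp by (simp add: C2_def B2_def xS_def)
        show "\<not> contracts r r0 (\<tau>\<^sup>2) (row_app {..<r} n2 V (mat_entries r n2 (St \<omega>)))"
          using nC(3) \<omega> by (simp add: B3_def)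
      qed (fact assms(14) Sc[OF \<omega>] Stc[OF \<omega>] X0 assms(10) Ztc[OF \<omega>] r0n2 V t x(1,2) \<tau>)+
      moreover have "N (Zt \<omega>) / (sqrt x * \<tau>) = sqrt (real r * real (n1 - r)) * N (Zt \<omega>) / (sqrt \<delta>1 * \<tau>)"
      proof -
        have "sqrt x = sqrt \<delta>1 / sqrt (real r * real k)" by (simp add: x_def real_sqrt_divide)
        then show ?thesis by (simp add: k_def[symmetric] mult.commute)
      qed
      moreover have "N Z / sqrt t = sqrt (real r) * N Z / sqrt (ln (1 / (1 - \<epsilon>)))"
      proof -
        have "sqrt t = sqrt (ln (1 / (1 - \<epsilon>))) / sqrt (real r)" by (simp only: t_def real_sqrt_divide)
        then show ?thesis by (simp add: mult.commute)
      qed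
      ultimately show ?thesis by simp
    qed
    then show ?thesis
      using As pA unfolding Let_def Yt_def \<tau>_def s_def by (intro bexI[of _ A]) auto
  qed
qed

end
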